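(* Let $\Gamma_1, \Gamma_2$ be tropical curves and let $\psi : \operatorname{Rat}(\Gamma_1) \to \operatorname{Rat}(\Gamma_2)$ be a semiring isomorphism between their rational function semifields. Then $\psi(1) \in \mathbb{R}_{>0}$ (where $1$ is the constant function with value the real number $1$, and real numbers are identified with constant functions), and $\psi$ induces a $\psi(1)$-expansive map $\varphi : \Gamma_1 \to \Gamma_2$. In particular, when $\psi$ is a $\boldsymbol{T}$-algebra isomorphism, $\psi(1) = 1$ and $\varphi$ is a finite harmonic morphism of degree one.
   Context: **Semirings.** A semiring is a commutative semiring with absorbing additive neutral element, multiplicative identity, and these two distinct. A semiring homomorphism preserves addition, multiplication, the additive neutral element and the multiplicative identity; a semiring isomorphism is a bijective one. The tropical semifield is $\boldsymbol{T} := (\mathbb{R} \cup \{-\infty\}, \oplus = \max, \odot = +)$ (additive neutral element $-\infty$, multiplicative identity the real number $0$). **Tropical curves.** A graph is an unweighted, undirected, finite, connected nonempty multigraph, possibly with loops. A leaf end is a vertex of valence one (loops count twice); a leaf edge is an edge incident to a leaf end. An edge-weighted graph $(G,l)$ is a graph $G$ with a function $l : E(G) \to \mathbb{R}_{>0} \cup \{\infty\}$ that takes the value $\infty$ only on leaf edges. A tropical curve $\Gamma$ is the underlying topological space of some $(G,l)$ together with an identification of each edge $e$ with $[0,l(e)]$, where $[0,\infty]$ is the one-point compactification of $[0,\infty)$; if $l(e)=\infty$, the leaf end of $e$ is identified with $\infty$ (if $E(G)=\{e\}$ and $l(e)=\infty$, either leaf end may be chosen). $(G,l)$ is a model for $\Gamma$;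 it is loopless if $G$ is. Points identified with $\infty$ are points at infinity and form the set $\Gamma_\infty$; other points are finite points. $\operatorname{dist}$ is the path-length distance; the distance between a point at infinity and any other point is $\infty$. The valence $\operatorname{val}(x)$ of a finite point is the number of connected components of $U\setminus\{x\}$ for small connected neighborhoods $U$ of $x$; $\operatorname{val}(x)=1$ for a point at infinity. The canonical model $(G_\circ, l_\circ)$ has vertex set $\{x : \operatorname{val}(x)\neq 2\}$, except that if $\Gamma$ is homeomorphic to a circle the vertex set is one arbitrary point, and if $\Gamma$ is obtained from a tree with two edges, both of length $\infty$, sharing a vertex, the vertex set is the two points at infinity and an arbitrary finite point. "An edge of $\Gamma$" means an edge of $G_\circ$. **Rational functions.** A rational function on $\Gamma$ is either the constant function $-\infty$ or a continuous map $f:\Gamma\to\mathbb{R}\cup\{\pm\infty\}$ that is piecewise affine with integer slopes and finitely many pieces and takes values $\pm\infty$ only at points at infinity. $\operatorname{Rat}(\Gamma)$ is the set of these; with $(f\oplus g)(x)=\max\{f(x),g(x)\}$ and $(f\odot g)(x)=f(x)+g(x)$ at finite points, extended continuously to points at infinity (and $f\oplus(-\infty)=f$, $f\odot(-\infty)=-\infty$), it is a semifield, and a $\boldsymbol{T}$-algebra via the inclusion of constants $\boldsymbol{T}\hookrightarrow\operatorname{Rat}(\Gamma)$. A $\boldsymbol{T}$-algebra isomorphism $\operatorname{Rat}(\Gamma_1)\to\operatorname{Rat}(\Gamma_2)$ is a semiring isomorphism that is compatible with the inclusions of $\boldsymbol{T}$, i.e. sends each constant $t$ to the constant $t$. **Expansive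 maps.** For $r\in\mathbb{R}_{>0}$, an $r$-expansive map $\varphi:\Gamma_1\to\Gamma_2$ is a continuous bijection that restricts to a bijection $\Gamma_1\setminus\Gamma_{1\infty}\to\Gamma_2\setminus\Gamma_{2\infty}$ with $r\cdot\operatorname{dist}(x,y)=\operatorname{dist}(\varphi(x),\varphi(y))$ for all $x,y\in\Gamma_1\setminus\Gamma_{1\infty}$. **Chip-firing moves and the induced map.** A subgraph of $\Gamma$ is a compact subset with finitely many connected components. For a subgraph $\Gamma'$ with no connected component consisting only of a point at infinity and $l\in\mathbb{R}_{>0}\cup\{\infty\}$, $\operatorname{CF}(\Gamma';l)(x):=-\min(l,\operatorname{dist}(x,\Gamma'))$. The map $\varphi$ induced by $\psi$ is the following: for a finite point $x$ of $\Gamma_1$, $\varphi(x)$ is the unique finite point $x'$ of $\Gamma_2$ such that $\psi(\operatorname{CF}(\{x\};\varepsilon))=\operatorname{CF}(\{x'\};\psi(1)\cdot\varepsilon)$ for some $\varepsilon>0$; for $x\in\Gamma_{1\infty}$, $\varphi(x)$ is the unique $x'\in\Gamma_{2\infty}$ such that, for some finite point $y$ on the edge incident to $x$, $\varphi(y)$ lies on the edge incident to $x'$ and $\psi(\operatorname{CF}(\Gamma_1\setminus(y,x];\infty))=\operatorname{CF}(\Gamma_2\setminus(\varphi(y),x'];\infty)$. That such points exist and are unique is part of the assertion. **Finite harmonic morphisms.** A continuous map $\varphi:\Gamma\to\Gamma'$ is a finite harmonic morphism if there are loopless models $(G,l)$, $(G',l')$ for $\Gamma,\Gamma'$ such that (1)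 $\varphi(V(G))\subset V(G')$; (2) $\varphi(E(G))\subset E(G')$; (3) for each edge $e$ of $G$ there is a positive integer $\deg_e(\varphi)$ with $\operatorname{dist}(\varphi(x),\varphi(y))=\deg_e(\varphi)\cdot\operatorname{dist}(x,y)$ for all $x,y\in e$; (4) for every vertex $v$ of $G$, the sum $\deg_v(\varphi)=\sum_{e\in E(G):\,e\mapsto e',\,v\in e}\deg_e(\varphi)$ is independent of the edge $e'\in E(G')$ incident to $\varphi(v)$. Its degree is $\sum_{v\mapsto v'}\deg_v(\varphi)$, which is independent of the vertex $v'$ of $G'$. If both curves are singletons, $\varphi$ is regarded as a finite harmonic morphism that can have any positive integer as degree. *)

theory Defs
  imports "HOL-Analysis.Analysis" "HOL-Algebra.Ring"
begin

section \<open>Edge-weighted multigraphs\<close>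

text \<open>Undirected multigraphs, loops allowed: an edge has one end (a loop) or two.\<close>

record ('v, 'e) wgraph =
  verts :: "'v set"
  edges :: "'e set"
  ends :: "'e \<Rightarrow> 'v set"
  len :: "'e \<Rightarrow> ereal"

definition multigraph :: "('v, 'e, 'm) wgraph_scheme \<Rightarrow> bool" where
  "multigraph G \<longleftrightarrow>
     finite (verts G) \<and> verts G \<noteq> {} \<and> finite (edges G) \<and>
     (\<forall>e\<in>edges G. ends G e \<subseteq> verts G \<and> card (ends G e) \<in> {1, 2}) \<and>
     (\<forall>u\<in>verts G. \<forall>v\<in>verts G. (u, v) \<in> {(a, b). \<exists>e\<in>edges G. ends G e = {a, b}}\<^sup>*)"

definition loopless :: "('v, 'e, 'm) wgraph_scheme \<Rightarrow> bool" where
  "loopless G \<longleftrightarrow> (\<forall>e\<in>edges G. card (ends G e) = 2)"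

definition vertex_valence :: "('v, 'e, 'm) wgraph_scheme \<Rightarrow> 'v \<Rightarrow> nat" where
  "vertex_valence G v = card {e \<in> edges G. v \<in> ends G e} + card {e \<in> edges G. ends G e = {v}}"

definition leaf_end :: "('v, 'e, 'm) wgraph_scheme \<Rightarrow> 'v \<Rightarrow> bool" where
  "leaf_end G v \<longleftrightarrow> v \<in> verts G \<and> vertex_valence G v = 1"

definition leaf_edge :: "('v, 'e, 'm) wgraph_scheme \<Rightarrow> 'e \<Rightarrow> bool" where
  "leaf_edge G e \<longleftrightarrow> e \<in> edges G \<and> (\<exists>v\<in>ends G e. leaf_end G v)"

definition edge_weighted_graph :: "('v, 'e, 'm) wgraph_scheme \<Rightarrow> bool" where
  "edge_weighted_graph G \<longleftrightarrow>
     multigraph G \<and> (\<forall>e\<in>edges G. 0 < len G e \<and> (len G e = \<infinity> \<longrightarrow> leaf_edge G e))"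


section \<open>Tropical curves\<close>

text \<open>
  A tropical curve is an edge-weighted graph realised on a set of points: the vertices are points,
  the edges are (closed) sets of points, and \<open>chart \<Gamma> e\<close> is the identification of the
  interval \<open>[0, len \<Gamma> e]\<close> of extended reals with \<open>e\<close>; for a loop it identifies the two
  end points of the interval. Distinct edges are distinct sets because their interiors are nonempty
  and disjoint.
\<close>

record 'a curve = "('a, 'a set) wgraph" +
  chart :: "'a set \<Rightarrow> ereal \<Rightarrow> 'a"

definition tropical_curve :: "'a curve \<Rightarrow> bool" where
  "tropical_curve \<Gamma> \<longleftrightarrow>
     edge_weighted_graph \<Gamma> \<and>
     (\<forall>e\<in>edges \<Gamma>.
        chart \<Gamma> e ` {0..len \<Gamma> e} = e \<and>
        ends \<Gamma> e = {chart \<Gamma> e 0, chart \<Gamma> e (len \<Gamma> e)} \<and>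
        (len \<Gamma> e = \<infinity> \<longrightarrow> leaf_end \<Gamma> (chart \<Gamma> e \<infinity>)) \<and>
        inj_on (chart \<Gamma> e) {0<..<len \<Gamma> e} \<and>
        chart \<Gamma> e ` {0<..<len \<Gamma> e} \<inter> verts \<Gamma> = {}) \<and>
     (\<forall>e\<in>edges \<Gamma>. \<forall>e'\<in>edges \<Gamma>. e \<noteq> e' \<longrightarrow> e \<inter> e' \<subseteq> verts \<Gamma>)"

definition points :: "'a curve \<Rightarrow> 'a set" where
  "points \<Gamma> = verts \<Gamma> \<union> \<Union>(edges \<Gamma>)"

definition inf_points :: "'a curve \<Rightarrow> 'a set" where
  "inf_points \<Gamma> = {chart \<Gamma> e \<infinity> | e. e \<in> edges \<Gamma> \<and> len \<Gamma> e = \<infinity>}"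

definition fin_points :: "'a curve \<Rightarrow> 'a set" where
  "fin_points \<Gamma> = points \<Gamma> - inf_points \<Gamma>"

text \<open>The quotient topology obtained by gluing the intervals \<open>[0, len \<Gamma> e]\<close> along the vertices.\<close>

definition curve_topology :: "'a curve \<Rightarrow> 'a topology" where
  "curve_topology \<Gamma> = topology (\<lambda>U. U \<subseteq> points \<Gamma> \<and>
     (\<forall>e\<in>edges \<Gamma>. openin (top_of_set {0..len \<Gamma> e}) {t \<in> {0..len \<Gamma> e}. chart \<Gamma> e t \<in> U}))"

lemma openin_curve_topology:
  "openin (curve_topology \<Gamma>) U \<longleftrightarrow> U \<subseteq> points \<Gamma> \<and>
     (\<forall>e\<in>edges \<Gamma>. openin (top_of_set {0..len \<Gamma> e}) {t \<in> {0..len \<Gamma> e}. chart \<Gamma> e t \<in> U})"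
proof -
  define P where "P e U = {t \<in> {0..len \<Gamma> e}. chart \<Gamma> e t \<in> U}" for e U
  have i: "P e (S \<inter> T) = P e S \<inter> P e T" and u: "P e (\<Union>K) = \<Union>(P e ` K)" for e S T K
    by (auto simp: P_def)
  have "istopology (\<lambda>U. U \<subseteq> points \<Gamma> \<and>
      (\<forall>e\<in>edges \<Gamma>. openin (top_of_set {0..len \<Gamma> e}) (P e U)))"
    unfolding istopology_def i u
    by (intro conjI allI impI ballI openin_Int openin_Union) blast+
  from topology_inverse'[OF this] show ?thesis
    unfolding curve_topology_def P_def by simp
qed

text \<open>
  A path is a finite concatenation of segments of edges, and \<open>path_length \<Gamma> x y d\<close> says
  that some path from \<open>x\<close> to \<open>y\<close> has length \<open>d\<close>. A nonconstant path ending at a point at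
  infinity has length \<open>\<infinity>\<close>.
\<close>

inductive path_length :: "'a curve \<Rightarrow> 'a \<Rightarrow> 'a \<Rightarrow> ereal \<Rightarrow> bool" for \<Gamma> where
  const: "x \<in> points \<Gamma> \<Longrightarrow> path_length \<Gamma> x x 0"
| segment: "\<lbrakk>path_length \<Gamma> x (chart \<Gamma> e s) d; e \<in> edges \<Gamma>; s \<in> {0..len \<Gamma> e}; t \<in> {0..len \<Gamma> e}\<rbrakk>
    \<Longrightarrow> path_length \<Gamma> x (chart \<Gamma> e t) (d + \<bar>s - t\<bar>)"

definition cdist :: "'a curve \<Rightarrow> 'a \<Rightarrow> 'a \<Rightarrow> ereal" where
  "cdist \<Gamma> x y = Inf {d. path_length \<Gamma> x y d}"

text \<open>
  \<open>M\<close> is a model for \<open>\<Gamma>\<close>: the two realised edge-weighted graphs have the same underlying space,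
  and their identifications of edges with intervals determine the same lengths and the same points
  at infinity.
\<close>

definition model_for :: "'a curve \<Rightarrow> 'a curve \<Rightarrow> bool" where
  "model_for \<Gamma> M \<longleftrightarrow>
     tropical_curve M \<and> curve_topology M = curve_topology \<Gamma> \<and> inf_points M = inf_points \<Gamma> \<and>
     (\<forall>x\<in>points \<Gamma>. \<forall>y\<in>points \<Gamma>. cdist M x y = cdist \<Gamma> x y)"

definition valence :: "'a curve \<Rightarrow> 'a \<Rightarrow> nat" where
  "valence \<Gamma> x =
     (if x \<in> inf_points \<Gamma> then 1
      else THE n. \<exists>W. openin (curve_topology \<Gamma>) W \<and> x \<in> W \<and>
        (\<forall>U. U \<subseteq> W \<and> x \<in> (curve_topology \<Gamma>) interior_of U \<and> connectedin (curve_topology \<Gamma>) U \<longrightarrow>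
           card (connected_components_of (subtopology (curve_topology \<Gamma>) (U - {x}))) = n))"

definition is_circle :: "'a curve \<Rightarrow> bool" where
  "is_circle \<Gamma> \<longleftrightarrow> curve_topology \<Gamma> homeomorphic_space top_of_set (sphere (0::complex) 1)"

text \<open>
  The curves obtained from a tree with two edges of infinite length. (Two edges of infinite length
  are leaf edges, so by connectedness they share their other ends.)
\<close>

definition is_double_ray :: "'a curve \<Rightarrow> bool" where
  "is_double_ray \<Gamma> \<longleftrightarrow>
     (\<exists>M. model_for \<Gamma> M \<and> card (edges M) = 2 \<and> (\<forall>e\<in>edges M. len M e = \<infinity>))"

text \<open>A predicate, since the canonical model involves an arbitrary choice in the two special cases.\<close>

definition canonical_model :: "'a curve \<Rightarrow> 'a curve \<Rightarrow> bool" where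
  "canonical_model \<Gamma> M \<longleftrightarrow>
     model_for \<Gamma> M \<and>
     (if is_circle \<Gamma> then \<exists>p\<in>points \<Gamma>. verts M = {p}
      else if is_double_ray \<Gamma> then \<exists>p\<in>fin_points \<Gamma>. verts M = insert p (inf_points \<Gamma>)
      else verts M = {x \<in> points \<Gamma>. valence \<Gamma> x \<noteq> 2})"


section \<open>Rational functions\<close>

text \<open>
  Functions on a curve are \<open>ereal\<close>-valued and, so that equality of functions is equality on the
  curve, \<open>undefined\<close> outside its set of points.
\<close>

definition const_fun :: "'a curve \<Rightarrow> ereal \<Rightarrow> 'a \<Rightarrow> ereal" where
  "const_fun \<Gamma> t = (\<lambda>x\<in>points \<Gamma>. t)"

definition piecewise_affine :: "'a curve \<Rightarrow> ('a \<Rightarrow> ereal) \<Rightarrow> bool" where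
  "piecewise_affine \<Gamma> f \<longleftrightarrow>
     (\<forall>e\<in>edges \<Gamma>. \<exists>S. finite S \<and>
        (\<forall>a b. 0 \<le> a \<and> a < b \<and> b \<le> len \<Gamma> e \<and> {a<..<b} \<inter> S = {} \<longrightarrow>
           (\<exists>(m::int) (c::real). \<forall>t::real. a < ereal t \<and> ereal t < b \<longrightarrow>
              f (chart \<Gamma> e (ereal t)) = ereal (of_int m * t + c))))"

definition rational_function :: "'a curve \<Rightarrow> ('a \<Rightarrow> ereal) \<Rightarrow> bool" where
  "rational_function \<Gamma> f \<longleftrightarrow>
     f = const_fun \<Gamma> (-\<infinity>) \<or>
     (f \<in> extensional (points \<Gamma>) \<and> continuous_map (curve_topology \<Gamma>) euclidean f \<and>
      piecewise_affine \<Gamma> f \<and> (\<forall>x\<in>points \<Gamma>. \<bar>f x\<bar> = \<infinity> \<longrightarrow> x \<in> inf_points \<Gamma>))"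

text \<open>
  The pointwise maximum is continuous also at the points at infinity, hence is its own continuous
  extension; the pointwise sum in \<open>ereal\<close> is not, as opposite infinities may meet.
\<close>

definition trop_add :: "'a curve \<Rightarrow> ('a \<Rightarrow> ereal) \<Rightarrow> ('a \<Rightarrow> ereal) \<Rightarrow> 'a \<Rightarrow> ereal" where
  "trop_add \<Gamma> f g = (\<lambda>x\<in>points \<Gamma>. max (f x) (g x))"

definition trop_mult :: "'a curve \<Rightarrow> ('a \<Rightarrow> ereal) \<Rightarrow> ('a \<Rightarrow> ereal) \<Rightarrow> 'a \<Rightarrow> ereal" where
  "trop_mult \<Gamma> f g =
     (if f = const_fun \<Gamma> (-\<infinity>) \<or> g = const_fun \<Gamma> (-\<infinity>) then const_fun \<Gamma> (-\<infinity>)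
      else THE h. h \<in> extensional (points \<Gamma>) \<and> continuous_map (curve_topology \<Gamma>) euclidean h \<and>
             (\<forall>x\<in>fin_points \<Gamma>. h x = f x + g x))"

definition Rat_semifield :: "'a curve \<Rightarrow> ('a \<Rightarrow> ereal) ring" where
  "Rat_semifield \<Gamma> =
     \<lparr>carrier = {f. rational_function \<Gamma> f}, mult = trop_mult \<Gamma>, one = const_fun \<Gamma> 0,
      zero = const_fun \<Gamma> (-\<infinity>), add = trop_add \<Gamma>\<rparr>"

text \<open>\<open>ring_hom\<close> does not mention \<open>\<zero>\<close>: its preservation is automatic for rings, but not for semirings.\<close>

definition semiring_hom :: "('a, 'm) ring_scheme \<Rightarrow> ('b, 'n) ring_scheme \<Rightarrow> ('a \<Rightarrow> 'b) set" where
  "semiring_hom R S = {h \<in> ring_hom R S. h \<zero>\<^bsub>R\<^esub> = \<zero>\<^bsub>S\<^esub>}"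

definition semiring_iso :: "('a, 'm) ring_scheme \<Rightarrow> ('b, 'n) ring_scheme \<Rightarrow> ('a \<Rightarrow> 'b) set" where
  "semiring_iso R S = {h \<in> semiring_hom R S. bij_betw h (carrier R) (carrier S)}"

definition T_algebra_iso :: "'a curve \<Rightarrow> 'b curve \<Rightarrow> (('a \<Rightarrow> ereal) \<Rightarrow> ('b \<Rightarrow> ereal)) set" where
  "T_algebra_iso \<Gamma>\<^sub>1 \<Gamma>\<^sub>2 =
     {\<psi> \<in> semiring_iso (Rat_semifield \<Gamma>\<^sub>1) (Rat_semifield \<Gamma>\<^sub>2).
        \<forall>t. t \<noteq> \<infinity> \<longrightarrow> \<psi> (const_fun \<Gamma>\<^sub>1 t) = const_fun \<Gamma>\<^sub>2 t}"


section \<open>Expansive maps and maps induced by semiring isomorphisms\<close>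

definition expansive_map :: "real \<Rightarrow> 'a curve \<Rightarrow> 'b curve \<Rightarrow> ('a \<Rightarrow> 'b) \<Rightarrow> bool" where
  "expansive_map r \<Gamma>\<^sub>1 \<Gamma>\<^sub>2 \<phi> \<longleftrightarrow>
     0 < r \<and> continuous_map (curve_topology \<Gamma>\<^sub>1) (curve_topology \<Gamma>\<^sub>2) \<phi> \<and>
     bij_betw \<phi> (points \<Gamma>\<^sub>1) (points \<Gamma>\<^sub>2) \<and> bij_betw \<phi> (fin_points \<Gamma>\<^sub>1) (fin_points \<Gamma>\<^sub>2) \<and>
     (\<forall>x\<in>fin_points \<Gamma>\<^sub>1. \<forall>y\<in>fin_points \<Gamma>\<^sub>1.
        ereal r * cdist \<Gamma>\<^sub>1 x y = cdist \<Gamma>\<^sub>2 (\<phi> x) (\<phi> y))"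

definition CF :: "'a curve \<Rightarrow> 'a set \<Rightarrow> ereal \<Rightarrow> 'a \<Rightarrow> ereal" where
  "CF \<Gamma> A l = (\<lambda>x\<in>points \<Gamma>. - min l (INF y\<in>A. cdist \<Gamma> x y))"

text \<open>
  The half-open segment \<open>(y, x]\<close> on the edge \<open>e\<close>, where \<open>x\<close> has the larger coordinate; this is
  always so when \<open>x\<close> is a point at infinity and \<open>y\<close> is finite.
\<close>

definition half_open_segment :: "'a curve \<Rightarrow> 'a set \<Rightarrow> 'a \<Rightarrow> 'a \<Rightarrow> 'a set" where
  "half_open_segment M e y x =
     {chart M e u | s u t. 0 \<le> s \<and> s < u \<and> u \<le> t \<and> t \<le> len M e \<and> chart M e s = y \<and> chart M e t = x}"

definition corresponding_finite ::
  "'a curve \<Rightarrow> 'b curve \<Rightarrow> (('a \<Rightarrow> ereal) \<Rightarrow> ('b \<Rightarrow> ereal)) \<Rightarrow> real \<Rightarrow> 'a \<Rightarrow> 'b \<Rightarrow> bool" where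
  "corresponding_finite \<Gamma>\<^sub>1 \<Gamma>\<^sub>2 \<psi> r x x' \<longleftrightarrow>
     x' \<in> fin_points \<Gamma>\<^sub>2 \<and>
     (\<exists>\<epsilon>::real. 0 < \<epsilon> \<and> \<psi> (CF \<Gamma>\<^sub>1 {x} (ereal \<epsilon>)) = CF \<Gamma>\<^sub>2 {x'} (ereal (r * \<epsilon>)))"

text \<open>
  Here \<open>C\<^sub>1\<close> and \<open>C\<^sub>2\<close> are canonical models of the two curves, and \<open>\<phi>\<close> matters at finite points only.
\<close>

definition corresponding_infinite ::
  "'a curve \<Rightarrow> 'b curve \<Rightarrow> 'a curve \<Rightarrow> 'b curve \<Rightarrow> (('a \<Rightarrow> ereal) \<Rightarrow> ('b \<Rightarrow> ereal)) \<Rightarrow> ('a \<Rightarrow> 'b)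
    \<Rightarrow> 'a \<Rightarrow> 'b \<Rightarrow> bool" where
  "corresponding_infinite \<Gamma>\<^sub>1 \<Gamma>\<^sub>2 C\<^sub>1 C\<^sub>2 \<psi> \<phi> x x' \<longleftrightarrow>
     x' \<in> inf_points \<Gamma>\<^sub>2 \<and>
     (\<exists>e\<in>edges C\<^sub>1. \<exists>e'\<in>edges C\<^sub>2. \<exists>y\<in>fin_points \<Gamma>\<^sub>1.
        x \<in> e \<and> y \<in> e \<and> x' \<in> e' \<and> \<phi> y \<in> e' \<and>
        \<psi> (CF \<Gamma>\<^sub>1 (points \<Gamma>\<^sub>1 - half_open_segment C\<^sub>1 e y x) \<infinity>) =
          CF \<Gamma>\<^sub>2 (points \<Gamma>\<^sub>2 - half_open_segment C\<^sub>2 e' (\<phi> y) x') \<infinity>)"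

text \<open>
  \<open>\<psi>\<close>, which maps the constant \<open>1\<close> to the constant \<open>r\<close>, induces \<open>\<phi>\<close>. The condition at the points at
  infinity is required for every choice of canonical models.
\<close>

definition induces ::
  "'a curve \<Rightarrow> 'b curve \<Rightarrow> (('a \<Rightarrow> ereal) \<Rightarrow> ('b \<Rightarrow> ereal)) \<Rightarrow> real \<Rightarrow> ('a \<Rightarrow> 'b) \<Rightarrow> bool" where
  "induces \<Gamma>\<^sub>1 \<Gamma>\<^sub>2 \<psi> r \<phi> \<longleftrightarrow>
     (\<forall>x\<in>fin_points \<Gamma>\<^sub>1.
        corresponding_finite \<Gamma>\<^sub>1 \<Gamma>\<^sub>2 \<psi> r x (\<phi> x) \<and>
        (\<forall>x'. corresponding_finite \<Gamma>\<^sub>1 \<Gamma>\<^sub>2 \<psi> r x x' \<longrightarrow> x' = \<phi> x)) \<and>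
     (\<forall>C\<^sub>1 C\<^sub>2. canonical_model \<Gamma>\<^sub>1 C\<^sub>1 \<longrightarrow> canonical_model \<Gamma>\<^sub>2 C\<^sub>2 \<longrightarrow>
        (\<forall>x\<in>inf_points \<Gamma>\<^sub>1.
           corresponding_infinite \<Gamma>\<^sub>1 \<Gamma>\<^sub>2 C\<^sub>1 C\<^sub>2 \<psi> \<phi> x (\<phi> x) \<and>
           (\<forall>x'. corresponding_infinite \<Gamma>\<^sub>1 \<Gamma>\<^sub>2 C\<^sub>1 C\<^sub>2 \<psi> \<phi> x x' \<longrightarrow> x' = \<phi> x)))"


section \<open>Finite harmonic morphisms\<close>

definition local_degree :: "'a curve \<Rightarrow> ('a \<Rightarrow> 'b) \<Rightarrow> ('a set \<Rightarrow> nat) \<Rightarrow> 'a \<Rightarrow> 'b set \<Rightarrow> nat" where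
  "local_degree G \<phi> dg v e' = (\<Sum>e\<in>{e \<in> edges G. \<phi> ` e = e' \<and> v \<in> e}. dg e)"

definition harmonic_on_models ::
  "'a curve \<Rightarrow> 'b curve \<Rightarrow> 'a curve \<Rightarrow> 'b curve \<Rightarrow> ('a \<Rightarrow> 'b) \<Rightarrow> ('a set \<Rightarrow> nat) \<Rightarrow> bool" where
  "harmonic_on_models \<Gamma> \<Gamma>' G G' \<phi> dg \<longleftrightarrow>
     model_for \<Gamma> G \<and> loopless G \<and> model_for \<Gamma>' G' \<and> loopless G' \<and>
     \<phi> ` verts G \<subseteq> verts G' \<and>
     (\<forall>e\<in>edges G. \<phi> ` e \<in> edges G') \<and>
     (\<forall>e\<in>edges G. 0 < dg e \<and>
        (\<forall>x\<in>e. \<forall>y\<in>e. cdist \<Gamma>' (\<phi> x) (\<phi> y) = ereal (of_nat (dg e)) * cdist \<Gamma> x y)) \<and>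
     (\<forall>v\<in>verts G. \<forall>e'\<in>edges G'. \<forall>e''\<in>edges G'. \<phi> v \<in> e' \<longrightarrow> \<phi> v \<in> e'' \<longrightarrow>
        local_degree G \<phi> dg v e' = local_degree G \<phi> dg v e'')"

definition vertex_degree ::
  "'a curve \<Rightarrow> 'b curve \<Rightarrow> ('a \<Rightarrow> 'b) \<Rightarrow> ('a set \<Rightarrow> nat) \<Rightarrow> 'a \<Rightarrow> nat" where
  "vertex_degree G G' \<phi> dg v = (THE n. \<forall>e'\<in>edges G'. \<phi> v \<in> e' \<longrightarrow> local_degree G \<phi> dg v e' = n)"

definition finite_harmonic_morphism :: "'a curve \<Rightarrow> 'b curve \<Rightarrow> ('a \<Rightarrow> 'b) \<Rightarrow> bool" where
  "finite_harmonic_morphism \<Gamma> \<Gamma>' \<phi> \<longleftrightarrow>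
     continuous_map (curve_topology \<Gamma>) (curve_topology \<Gamma>') \<phi> \<and>
     (\<exists>G G' dg. harmonic_on_models \<Gamma> \<Gamma>' G G' \<phi> dg)"

text \<open>A map between singletons may have any positive degree; there is no edge to compute it from.\<close>

definition has_degree :: "'a curve \<Rightarrow> 'b curve \<Rightarrow> ('a \<Rightarrow> 'b) \<Rightarrow> nat \<Rightarrow> bool" where
  "has_degree \<Gamma> \<Gamma>' \<phi> d \<longleftrightarrow>
     (if is_singleton (points \<Gamma>) \<and> is_singleton (points \<Gamma>') then 0 < d
      else \<exists>G G' dg. harmonic_on_models \<Gamma> \<Gamma>' G G' \<phi> dg \<and>
        (\<forall>v'\<in>verts G'. (\<Sum>v\<in>{v \<in> verts G. \<phi> v = v'}. vertex_degree G G' \<phi> dg v) = d))"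

end

theory Submission
  imports Defs
begin

text \<open>
  The rational functions other than \<open>-\<infinity>\<close> form a lattice-ordered abelian group under pointwise maximum and
  addition. The point of the proof is that an isomorphism \<open>\<psi>\<close> of such groups can only be a scaled substitution:
  there are a real number \<open>r > 0\<close> and a homeomorphism \<open>\<phi>\<close> with \<open>\<psi> f (\<phi> x) = r * f x\<close> for every rational
  function \<open>f\<close> and every point \<open>x\<close>. The rest of the theorem is read off from this formula.

  \<^emph>\<open>Constants.\<close> Slopes are integers, so a function that can be divided by every power of 2 has slope 0
  everywhere and is constant. Being divisible is preserved by \<open>\<psi>\<close>, hence \<open>\<psi>\<close> maps constants to constants; it acts
  on them by an additive and monotone function, which is multiplication by \<open>r = \<psi> 1\<close>
  (\<open>psi_const\<close>, \<open>psi_const_scale\<close>).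

  \<^emph>\<open>Points.\<close> Fix a point \<open>y\<close> of the second curve and consider \<open>f \<mapsto> \<psi> f y / r\<close> on the bounded functions \<open>f\<close> of the
  first. It is additive, respects maxima and fixes the constants. If it differed from evaluation at every point
  \<open>x\<close>, then each \<open>x\<close> would have a function \<open>g \<ge> 0\<close> with \<open>g x > 0\<close> that is sent to 0; the curve being compact, the maximum
  of finitely many of them would exceed a positive constant and still be sent to 0. So it is evaluation at a point
  \<open>\<theta> y\<close> (\<open>psi_evaluation_bounded\<close>), and unbounded functions follow by truncation (\<open>psi_evaluation\<close>). The same argument
  for the inverse of \<open>\<psi>\<close> yields \<open>\<phi>\<close>, inverse to \<open>\<theta>\<close> because bounded rational functions separate points
  (\<open>psi_substitution\<close>). Separation and compactness also make \<open>\<phi>\<close> continuous (\<open>phi_continuous\<close>), and \<open>\<phi>\<close> respects the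
  points at infinity, which are the points where some rational function is infinite (\<open>phi_infinite\<close>).

  \<^emph>\<open>Distances.\<close> Integrality of slopes is used once more. The function \<open>u = - dist (\<phi> x) (\<phi> _) / r\<close> is rational on the
  first curve. Where it has slope \<open>m\<close> it equals, up to a constant, an integer multiple by \<open>m\<close> or \<open>-m\<close> of a function
  \<open>g\<close> of slope 1 or -1. Substitution carries this relation to the second curve, where it says that \<open>m\<close> divides the
  slope of a distance function, which is 1 or -1 (\<open>slope_unit\<close>). Hence \<open>u\<close> changes along a path by at most its
  length, that is, \<open>dist (\<phi> x) (\<phi> y) \<le> r * dist x y\<close> (\<open>cdist_phi_le\<close>), and the situation is symmetric.

  \<^emph>\<open>Chip-firing moves and degree.\<close> As \<open>\<phi>\<close> multiplies distances by \<open>r\<close>, the formula for \<open>\<psi>\<close> turns the chip-firing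
  move at \<open>x\<close> into the one at \<open>\<phi> x\<close> (\<open>psi_CF_point\<close>, \<open>corresponding_infinite_phi\<close>). When \<open>r = 1\<close>, cutting all edges
  in the middle gives a loopless model of the first curve whose image under \<open>\<phi>\<close> is a loopless model of the second;
  between these models \<open>\<phi>\<close> is an isomorphism of graphs, so all its degrees are one (\<open>local_degree_one\<close>).
\<close>

section \<open>Germs of piecewise affine functions\<close>

text \<open>
  The set \<open>K\<close> restricts the slope: it is the set of all integers for a rational function
  and \<open>{1, -1}\<close> for the distance to a point.
\<close>
definition affine_germ :: "int set \<Rightarrow> real filter \<Rightarrow> (real \<Rightarrow> ereal) \<Rightarrow> bool" where
  "affine_germ K F h \<longleftrightarrow> (\<exists>m\<in>K. \<exists>c::real. eventually (\<lambda>u. h u = ereal (of_int m * u + c)) F)"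

text \<open>
  The one-sided neighbourhoods of the points of \<open>[0, L]\<close>, from within the interval. For functions on a compact
  interval, being piecewise affine is a condition on each of these filters separately.
\<close>
definition edge_filters :: "ereal \<Rightarrow> real filter set" where
  "edge_filters L = {at_right t | t. 0 \<le> t \<and> ereal t < L} \<union> {at_left t | t. 0 < t \<and> ereal t \<le> L}
     \<union> {F. F = at_top \<and> L = \<infinity>}"

text \<open>
  A one-sided neighbourhood can be shrunk to an interval that avoids finitely many given points: break points,
  a fibre of a chart, or a change of sign.
\<close>
lemma edge_filter_interval:
  assumes F: "F \<in> edge_filters L" and S: "finite S" and "0 < L"
  obtains a b where "0 \<le> a" "a < b" "b \<le> L" "\<forall>u\<in>S. \<not> (a < ereal u \<and> ereal u < b)"
    "eventually (\<lambda>u. a < ereal u \<and> ereal u < b) F"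
proof -
  consider (r) t where "F = at_right t" "0 \<le> t" "ereal t < L"
    | (l) t where "F = at_left t" "0 < t" "ereal t \<le> L" | (i) "F = at_top" "L = \<infinity>"
    using F by (auto simp: edge_filters_def)
  then show ?thesis
  proof cases
    case r
    define B where "B = insert L (ereal ` {u\<in>S. u > t})"
    have B: "finite B" "B \<noteq> {}" using S by (auto simp: B_def)
    have tB: "ereal t < Min B" using B r by (subst Min_gr_iff) (auto simp: B_def)
    then obtain b where b: "t < b" "ereal b < Min B"
      by (metis ereal_dense2 less_ereal.simps(1))
    have "eventually (\<lambda>u. t < u \<and> u < b) (at_right t)"
      using b(1) eventually_at_right by blast
    then have ev: "eventually (\<lambda>u. ereal t < ereal u \<and> ereal u < Min B) F"
      unfolding r(1) by (rule eventually_mono) (use b in \<open>auto intro: less_trans[of _ "ereal b"]\<close>)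
    show ?thesis
      by (rule that[OF _ tB _ _ ev])
        (use r B in \<open>auto simp: B_def Min_le_iff\<close>)
  next
    case l
    define B where "B = insert 0 (ereal ` {u\<in>S. u < t})"
    have B: "finite B" "B \<noteq> {}" using S by (auto simp: B_def)
    have tB: "Max B < ereal t" using B l by (subst Max_less_iff) (auto simp: B_def)
    then obtain a where a: "a < t" "Max B < ereal a"
      by (metis ereal_dense2 less_ereal.simps(1))
    have "eventually (\<lambda>u. a < u \<and> u < t) (at_left t)"
      using a(1) eventually_at_left by blast
    then have ev: "eventually (\<lambda>u. Max B < ereal u \<and> ereal u < t) F"
      unfolding l(1) by (rule eventually_mono) (use a in \<open>auto intro: less_trans[of _ "ereal a"]\<close>)
    show ?thesis
      by (rule that[OF _ tB _ _ ev])
        (use l B in \<open>auto simp: B_def Max_ge_iff\<close>)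
  next
    case i
    define B where "B = insert 0 S"
    have B: "finite B" "B \<noteq> {}" using S by (auto simp: B_def)
    have ev: "eventually (\<lambda>u. ereal (Max B) < ereal u \<and> ereal u < \<infinity>) F"
      unfolding i(1) by (simp add: eventually_gt_at_top)
    show ?thesis
      by (rule that[OF _ _ _ _ ev]) (use i B in \<open>auto simp: B_def Max_ge_iff\<close>)
  qed
qed

lemma edge_filter_not_bot: "F \<in> edge_filters L \<Longrightarrow> F \<noteq> bot"
  unfolding edge_filters_def
  by (elim UnE CollectE exE conjE) simp_all

lemma affine_sign_interval:
  fixes k d :: real and a b :: ereal
  assumes *: "a < ereal (- d / k) \<Longrightarrow> ereal (- d / k) < b \<Longrightarrow> False"
  shows "(\<forall>u. a < ereal u \<longrightarrow> ereal u < b \<longrightarrow> k * u + d \<le> 0) \<or> (\<forall>u. a < ereal u \<longrightarrow> ereal u < b \<longrightarrow> 0 \<le> k * u + d)"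
proof -
  consider "k = 0" | "b \<le> ereal (- d / k)" "k \<noteq> 0" | "ereal (- d / k) \<le> a" "k \<noteq> 0"
    using * by force
  then show ?thesis
  proof cases
    case 1 then show ?thesis by auto
  next
    case 2
    have "u < - d / k" if "ereal u < b" for u using 2 that by (metis less_ereal.simps(1) order_less_le_trans)
    then show ?thesis using 2(2) by (cases "k > 0") (fastforce simp: field_simps)+
  next
    case 3
    have "u > - d / k" if "ereal u > a" for u using 3 that by (metis less_ereal.simps(1) order_le_less_trans)
    then show ?thesis using 3(2) by (cases "k > 0") (fastforce simp: field_simps)+
  qed
qed

text \<open>
  Two affine functions with different slopes meet only once, so in a small one-sided neighbourhood one of them is
  the larger throughout.
\<close>
lemma affine_germ_max:
  assumes F: "F \<in> edge_filters L" "0 < L" and f: "affine_germ K F f" and g: "affine_germ K F g"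
  shows "affine_germ K F (\<lambda>u. max (f u) (g u))"
proof -
  obtain m c where f: "m \<in> K" "eventually (\<lambda>u. f u = ereal (of_int m * u + c)) F"
    using f by (auto simp: affine_germ_def)
  obtain m' c' where g: "m' \<in> K" "eventually (\<lambda>u. g u = ereal (of_int m' * u + c')) F"
    using g by (auto simp: affine_germ_def)
  define S where "S = {- (c - c') / (of_int m - of_int m')}"
  have "finite S" by (simp add: S_def)
  from edge_filter_interval[OF F(1) this F(2)] obtain a b where ab: "\<forall>u\<in>S. \<not> (a < ereal u \<and> ereal u < b)"
    and ev: "eventually (\<lambda>u. a < ereal u \<and> ereal u < b) F"
    by blast
  consider "\<forall>u. a < ereal u \<longrightarrow> ereal u < b \<longrightarrow> (of_int m - of_int m') * u + (c - c') \<le> 0"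
    | "\<forall>u. a < ereal u \<longrightarrow> ereal u < b \<longrightarrow> 0 \<le> (of_int m - of_int m') * u + (c - c')"
    using ab affine_sign_interval[of a "c - c'" "of_int m - of_int m'" b] unfolding S_def by blast
  then show ?thesis
  proof cases
    case 1
    have "eventually (\<lambda>u. max (f u) (g u) = ereal (of_int m' * u + c')) F"
      using f(2) g(2) ev by eventually_elim (use 1 in \<open>auto simp: algebra_simps max_def\<close>)
    then show ?thesis using g(1) by (auto simp: affine_germ_def)
  next
    case 2
    have "eventually (\<lambda>u. max (f u) (g u) = ereal (of_int m * u + c)) F"
      using f(2) g(2) ev by eventually_elim (use 2 in \<open>force simp: algebra_simps max_def\<close>)
    then show ?thesis using f(1) by (auto simp: affine_germ_def)
  qed
qed

lemma affine_germ_uminus: "affine_germ K F f \<Longrightarrow> affine_germ (uminus ` K) F (\<lambda>u. - f u)"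
  unfolding affine_germ_def by (elim bexE exE, rule_tac x="-m" in bexI, rule_tac x="-c" in exI)
    (auto elim!: eventually_mono)

lemma affine_germ_min:
  assumes F: "F \<in> edge_filters L" "0 < L" and f: "affine_germ K F f" and g: "affine_germ K F g"
  shows "affine_germ K F (\<lambda>u. min (f u) (g u))"
proof -
  have "affine_germ (uminus ` K) F (\<lambda>u. max (- f u) (- g u))"
    by (intro affine_germ_max[OF F] affine_germ_uminus f g)
  moreover have "- max (- x) (- y) = min x y" for x y :: ereal
    by (auto simp: max_def min_def)
  ultimately show ?thesis
    using affine_germ_uminus[of "uminus ` K" F "\<lambda>u. max (- f u) (- g u)"] by (simp add: image_image)
qed

lemma affine_germ_const: "0 \<in> K \<Longrightarrow> affine_germ K F (\<lambda>u. ereal c)"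
  unfolding affine_germ_def by (rule bexI[of _ 0], rule exI[of _ c]) auto

lemma affine_germ_add:
  assumes "affine_germ UNIV F f" "affine_germ UNIV F g"
  shows "affine_germ UNIV F (\<lambda>u. f u + g u)"
proof -
  obtain m c m' c' where f: "eventually (\<lambda>u. f u = ereal (of_int m * u + c)) F"
    and g: "eventually (\<lambda>u. g u = ereal (of_int m' * u + c')) F"
    using assms by (auto simp: affine_germ_def)
  have "eventually (\<lambda>u. f u + g u = ereal (of_int (m + m') * u + (c + c'))) F"
    using f g by eventually_elim (simp add: algebra_simps)
  then show ?thesis unfolding affine_germ_def by blast
qed

lemma affine_germ_mono: "affine_germ K F h \<Longrightarrow> K \<subseteq> K' \<Longrightarrow> affine_germ K' F h"
  by (auto simp: affine_germ_def)

lemma affine_germ_cong: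
  "affine_germ K F h \<Longrightarrow> eventually (\<lambda>u. h u = h' u) F \<Longrightarrow> affine_germ K F h'"
  unfolding affine_germ_def by (fastforce elim: eventually_elim2)

text \<open>
  The slope and the intercept at a point are a locally constant function of the point, and intervals are connected.
\<close>
lemma locally_affine_imp_affine:
  fixes h :: "real \<Rightarrow> ereal"
  assumes "\<And>u. a < ereal u \<Longrightarrow> ereal u < b \<Longrightarrow> \<exists>(m::int) (c::real). eventually (\<lambda>v. h v = ereal (of_int m * v + c)) (nhds u)"
  shows "\<exists>(m::int) (c::real). \<forall>t. a < ereal t \<and> ereal t < b \<longrightarrow> h t = ereal (of_int m * t + c)"
proof (cases "\<exists>u. a < ereal u \<and> ereal u < b")
  case True
  then obtain u0 where u0: "a < ereal u0" "ereal u0 < b" by blast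
  define I where "I = {u. a < ereal u \<and> ereal u < b}"
  have op: "open I" unfolding I_def
    by (intro open_Collect_conj open_Collect_less continuous_intros)
  have I: "is_interval I" unfolding is_interval_1 I_def
  proof safe
    fix x y z assume "a < ereal x" "x \<le> z" "z \<le> y" "ereal y < b"
    then show "a < ereal z" "ereal z < b"
      using less_le_trans[of a "ereal x" "ereal z"] le_less_trans[of "ereal z" "ereal y" b] by auto
  qed
  then have conn: "connected I" using is_interval_connected by blast
  define P where "P u p \<longleftrightarrow> eventually (\<lambda>v. h v = ereal (of_int (fst p) * v + snd p)) (nhds u)"
    for u and p :: "int \<times> real"
  have P: "\<exists>p. P u p" if "u \<in> I" for u using assms[of u] that by (auto simp: P_def I_def)
  have uniq: "p = q" if "P u p" "P u q" for u p q
  proof -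
    have "eventually (\<lambda>v. of_int (fst p) * v + snd p = of_int (fst q) * v + snd q) (nhds u)"
      using that[unfolded P_def] by eventually_elim simp
    then obtain e where e: "e > 0" "\<And>v. dist v u < e \<Longrightarrow> of_int (fst p) * v + snd p = of_int (fst q) * v + snd q"
      by (auto simp: eventually_nhds_metric)
    have 1: "of_int (fst p) * u + snd p = of_int (fst q) * u + snd q" using e(2)[of u] e(1) by simp
    have "of_int (fst p) * (u + e/2) + snd p = of_int (fst q) * (u + e/2) + snd q"
      using e(2)[of "u + e/2"] e(1) by (simp add: dist_real_def)
    moreover have "(of_int (fst p) - of_int (fst q)) * (e/2) = (of_int (fst p) * (u + e/2) + snd p) - (of_int (fst p) * u + snd p)
        - ((of_int (fst q) * (u + e/2) + snd q) - (of_int (fst q) * u + snd q))" by (simp add: algebra_simps)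
    ultimately have "(of_int (fst p) - of_int (fst q)) * (e/2) = (0::real)" using 1 by linarith
    then have "fst p = fst q" using e(1) by simp
    with 1 show ?thesis by (simp add: prod_eq_iff)
  qed
  define D where "D u = (SOME p. P u p)" for u
  have D: "P u (D u)" if "u \<in> I" for u using P[OF that] unfolding D_def by (rule someI_ex)
  have loc: "eventually (\<lambda>v. D u = D v) (at u within I)" if u: "u \<in> I" for u
  proof -
    have "eventually (\<lambda>v. P v (D u)) (nhds u)"
      using D[OF u] unfolding P_def by (simp add: eventually_eventually)
    then have "eventually (\<lambda>v. P v (D u)) (at u within I)"
      unfolding at_within_def by (rule filter_leD[rotated]) simp
    moreover have "eventually (\<lambda>v. v \<in> I) (at u within I)"
      by (simp add: eventually_at_filter)
    ultimately show ?thesis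
      by eventually_elim (use uniq D in blast)
  qed
  have Dc: "D u = D u0" if "u \<in> I" for u
    using connected_local_const[OF conn that, of u0 D] u0 loc unfolding I_def by blast
  have "h u = ereal (of_int (fst (D u0)) * u + snd (D u0))" if "u \<in> I" for u
    using eventually_nhds_x_imp_x[OF D[OF that, unfolded P_def]] by (simp only: Dc[OF that])
  then show ?thesis unfolding I_def by blast
qed blast

lemma locally_affine_of_germ:
  assumes "open U" "\<And>v. v \<in> U \<Longrightarrow> h v = ereal (of_int m * v + c)" "u \<in> U"
  shows "\<exists>(m::int) (c::real). eventually (\<lambda>v. h v = ereal (of_int m * v + c)) (nhds u)"
  using eventually_nhds_in_open[OF assms(1,3)]
  by (intro exI[of _ m] exI[of _ c]) (rule eventually_mono, assumption, rule assms(2))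

text \<open>
  From germs to pieces: \<open>[0, L]\<close> is compact, so finitely many two-sided neighbourhoods, on each of which the
  function is affine to the left and to the right of a centre, cover it; the centres serve as break points.
  With this, closure of the rational functions under maxima and sums is a statement about a single germ.
\<close>
lemma piecewise_affine_iff_germs:
  assumes L: "0 < (L::ereal)"
  shows "(\<exists>S. finite S \<and>
        (\<forall>a b. 0 \<le> a \<and> a < b \<and> b \<le> L \<and> {a<..<b} \<inter> S = {} \<longrightarrow>
           (\<exists>(m::int) (c::real). \<forall>t::real. a < ereal t \<and> ereal t < b \<longrightarrow>
              h t = ereal (of_int m * t + c)))) \<longleftrightarrow> (\<forall>F\<in>edge_filters L. affine_germ UNIV F h)"
  (is "?P \<longleftrightarrow> ?G")
proof
  assume ?P
  then obtain S where S: "finite S" "\<forall>a b. 0 \<le> a \<and> a < b \<and> b \<le> L \<and> {a<..<b} \<inter> S = {} \<longrightarrow>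
           (\<exists>(m::int) (c::real). \<forall>t::real. a < ereal t \<and> ereal t < b \<longrightarrow> h t = ereal (of_int m * t + c))"
    by (elim exE conjE)
  show ?G
  proof
    fix F assume F: "F \<in> edge_filters L"
    have "finite (ereal -` S)" using S(1) by (intro finite_vimageI) auto
    from edge_filter_interval[OF F this L] obtain a b where ab: "0 \<le> a" "a < b" "b \<le> L"
      "\<forall>u\<in>ereal -` S. \<not> (a < ereal u \<and> ereal u < b)"
      and ev: "eventually (\<lambda>u. a < ereal u \<and> ereal u < b) F" by blast
    have "x \<notin> S" if "a < x" "x < b" for x
      using that ab by (cases x) auto
    then have "{a<..<b} \<inter> S = {}" by auto
    with S(2)[rule_format, of a b] ab(1-3) obtain m :: int and c :: real where "\<forall>t::real. a < ereal t \<and> ereal t < b \<longrightarrow> h t = ereal (of_int m * t + c)"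
      by blast
    with ev have "eventually (\<lambda>u. h u = ereal (of_int m * u + c)) F" by (auto elim!: eventually_mono)
    then show "affine_germ UNIV F h" by (auto simp: affine_germ_def)
  qed
next
  assume G: ?G
  define A where "A u \<longleftrightarrow> (\<exists>(m::int) (c::real). eventually (\<lambda>v. h v = ereal (of_int m * v + c)) (nhds u))" for u
  note loc = locally_affine_of_germ[of _ h, folded A_def]
  have "\<exists>N. open N \<and> p \<in> N \<and> (\<forall>u. ereal u \<in> N \<longrightarrow> ereal u \<noteq> p \<longrightarrow> 0 \<le> u \<longrightarrow> ereal u \<le> L \<longrightarrow> A u)"
    if p: "p \<in> {0..L}" for p :: ereal
  proof (cases p)
    case (real t)
    have R: "\<exists>b>t. \<forall>u. t < u \<longrightarrow> u < b \<longrightarrow> ereal u \<le> L \<longrightarrow> A u"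
    proof (cases "ereal t < L")
      case True
      then have "affine_germ UNIV (at_right t) h" using G p real by (auto simp: edge_filters_def)
      then obtain m :: int and c where "eventually (\<lambda>u. h u = ereal (of_int m * u + c)) (at_right t)"
        by (auto simp: affine_germ_def)
      then obtain b where b: "b > t" "\<And>u. t < u \<Longrightarrow> u < b \<Longrightarrow> h u = ereal (of_int m * u + c)"
        by (auto simp: eventually_at_right_field)
      then have "A u" if "t < u" "u < b" for u
        using that by (intro loc[of "{t<..<b}"]) auto
      then show ?thesis using b(1) by blast
    next
      case False
      then have "\<not> ereal u \<le> L" if "t < u" for u
        using that by (meson ereal_less_eq(3) less_le_not_le linorder_not_less order_trans)
      then show ?thesis by (intro exI[of _ "t+1"]) auto
    qed
    have Lf: "\<exists>b<t. \<forall>u. u < t \<longrightarrow> b < u \<longrightarrow> 0 \<le> u \<longrightarrow> A u"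
    proof (cases "0 < t")
      case True
      then have "affine_germ UNIV (at_left t) h" using G p real by (auto simp: edge_filters_def)
      then obtain m :: int and c where "eventually (\<lambda>u. h u = ereal (of_int m * u + c)) (at_left t)"
        by (auto simp: affine_germ_def)
      then obtain b where b: "b < t" "\<And>u. b < u \<Longrightarrow> u < t \<Longrightarrow> h u = ereal (of_int m * u + c)"
        by (auto simp: eventually_at_left_field)
      then have "A u" if "u < t" "b < u" for u
        using that by (intro loc[of "{b<..<t}"]) auto
      then show ?thesis using b(1) by blast
    next
      case False
      then show ?thesis by (intro exI[of _ "t-1"]) auto
    qed
    obtain b where b: "b > t" "\<And>u. t < u \<Longrightarrow> u < b \<Longrightarrow> ereal u \<le> L \<Longrightarrow> A u" using R by blast
    obtain a where a: "a < t" "\<And>u. u < t \<Longrightarrow> a < u \<Longrightarrow> 0 \<le> u \<Longrightarrow> A u" using Lf by blast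
    have "A u" if "ereal u \<in> {ereal a<..<ereal b}" "ereal u \<noteq> p" "0 \<le> u" "ereal u \<le> L" for u
      using a(2)[of u] b(2)[of u] that real by (cases "u < t") auto
    then show ?thesis using a(1) b(1) real by (intro exI[of _ "{ereal a<..<ereal b}"]) auto
  next
    case PInf
    then have "affine_germ UNIV at_top h" using G p by (auto simp: edge_filters_def)
    then obtain m :: int and c where "eventually (\<lambda>u. h u = ereal (of_int m * u + c)) at_top"
      by (auto simp: affine_germ_def)
    then obtain b where b: "\<And>u. b < u \<Longrightarrow> h u = ereal (of_int m * u + c)"
      by (auto simp: eventually_at_top_dense)
    then have "A u" if "b < u" for u
      using that by (intro loc[of "{b<..}"]) auto
    then show ?thesis using PInf by (intro exI[of _ "{ereal b<..}"]) auto
  qed (use p in auto)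
  then have "\<forall>p\<in>{0..L}. \<exists>N. open N \<and> p \<in> N \<and>
    (\<forall>u. ereal u \<in> N \<longrightarrow> ereal u \<noteq> p \<longrightarrow> 0 \<le> u \<longrightarrow> ereal u \<le> L \<longrightarrow> A u)" ..
  from bchoice[OF this] obtain N where N: "\<forall>p\<in>{0..L}. open (N p) \<and> p \<in> N p \<and>
    (\<forall>u. ereal u \<in> N p \<longrightarrow> ereal u \<noteq> p \<longrightarrow> 0 \<le> u \<longrightarrow> ereal u \<le> L \<longrightarrow> A u)" ..
  have "compact {0..L}" by (simp add: compact_eq_closed)
  moreover have "open (N p)" if "p \<in> {0..L}" for p using N that by simp
  moreover have "{0..L} \<subseteq> (\<Union>p\<in>{0..L}. N p)"
  proof
    fix p assume "p \<in> {0..L}"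
    then show "p \<in> (\<Union>p\<in>{0..L}. N p)" using N by blast
  qed
  ultimately obtain S where S: "S \<subseteq> {0..L}" "finite S" "{0..L} \<subseteq> (\<Union>p\<in>S. N p)"
    by (rule compactE_image)
  have X: "\<exists>(m::int) (c::real). \<forall>t. a < ereal t \<and> ereal t < b \<longrightarrow> h t = ereal (of_int m * t + c)"
    if ab: "0 \<le> a" "b \<le> L" "{a<..<b} \<inter> S = {}" for a b
  proof (rule locally_affine_imp_affine, fold A_def)
    fix u assume u: "a < ereal u" "ereal u < b"
    have uL: "ereal u \<in> {0..L}" using u ab(1,2) le_less_trans[of 0 a "ereal u"] less_le_trans[of "ereal u" b L] by auto
    then obtain p where p: "p \<in> S" "ereal u \<in> N p" using S(3) by blast
    moreover have "ereal u \<noteq> p" using p(1) ab(3) u by auto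
    moreover have "0 \<le> u" "ereal u \<le> L" "p \<in> {0..L}" using uL S(1) p(1) by auto
    ultimately show "A u" using N p(2) by blast
  qed
  show ?P
  proof (rule exI[of _ S], intro conjI allI impI)
    fix a b assume "0 \<le> a \<and> a < b \<and> b \<le> L \<and> {a<..<b} \<inter> S = {}"
    then show "\<exists>(m::int) (c::real). \<forall>t. a < ereal t \<and> ereal t < b \<longrightarrow> h t = ereal (of_int m * t + c)"
      by (elim conjE) (rule X)
  qed (rule S(2))
qed

section \<open>Combinatorics and topology of a tropical curve\<close>

locale curve =
  fixes \<Gamma> :: "'a curve"
  assumes tropical: "tropical_curve \<Gamma>"
begin

abbreviation "E \<equiv> edges \<Gamma>"
abbreviation "V \<equiv> verts \<Gamma>"
abbreviation "L \<equiv> len \<Gamma>"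
abbreviation "ch \<equiv> chart \<Gamma>"
abbreviation "top_curve \<equiv> curve_topology \<Gamma>"

lemma graph: "edge_weighted_graph \<Gamma>" and multigraph: "multigraph \<Gamma>"
  using tropical by (auto simp: tropical_curve_def edge_weighted_graph_def)

lemma finite_E: "finite E" and finite_V: "finite V" and V_nonempty: "V \<noteq> {}"
  using multigraph by (auto simp: multigraph_def)

lemma len_pos: "e \<in> E \<Longrightarrow> 0 < L e"
  using graph by (auto simp: edge_weighted_graph_def)

lemma chart_image: "e \<in> E \<Longrightarrow> ch e ` {0..L e} = e"
  and ends_eq: "e \<in> E \<Longrightarrow> ends \<Gamma> e = {ch e 0, ch e (L e)}"
  and leaf_inf: "e \<in> E \<Longrightarrow> L e = \<infinity> \<Longrightarrow> leaf_end \<Gamma> (ch e \<infinity>)"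
  and inj_interior: "e \<in> E \<Longrightarrow> inj_on (ch e) {0<..<L e}"
  using tropical unfolding tropical_curve_def by blast+

lemma interior_not_vertex: "e \<in> E \<Longrightarrow> t \<in> {0<..<L e} \<Longrightarrow> ch e t \<notin> V"
  using tropical unfolding tropical_curve_def by blast

lemma edges_meet: "e \<in> E \<Longrightarrow> e' \<in> E \<Longrightarrow> e \<noteq> e' \<Longrightarrow> e \<inter> e' \<subseteq> V"
  using tropical unfolding tropical_curve_def by blast

lemma chart_end_vertex: "e \<in> E \<Longrightarrow> ch e 0 \<in> V" "e \<in> E \<Longrightarrow> ch e (L e) \<in> V"
proof -
  have "e \<in> E \<Longrightarrow> ends \<Gamma> e \<subseteq> V" using multigraph by (auto simp: multigraph_def)
  then show "e \<in> E \<Longrightarrow> ch e 0 \<in> V" "e \<in> E \<Longrightarrow> ch e (L e) \<in> V" by (auto simp: ends_eq)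
qed

lemma chart_in_edge: "e \<in> E \<Longrightarrow> t \<in> {0..L e} \<Longrightarrow> ch e t \<in> e"
  using chart_image by blast

lemma chart_in_points: "e \<in> E \<Longrightarrow> t \<in> {0..L e} \<Longrightarrow> ch e t \<in> points \<Gamma>"
  using chart_in_edge by (auto simp: points_def)

lemma interior_unique:
  assumes "e \<in> E" "s \<in> {0<..<L e}" "e' \<in> E" "t \<in> {0..L e'}" "ch e s = ch e' t"
  shows "e' = e \<and> t = s"
proof -
  have nv: "ch e s \<notin> V" using interior_not_vertex assms by blast
  have "ch e s \<in> e" using assms by (intro chart_in_edge) auto
  moreover have "ch e s \<in> e'" using assms chart_in_edge by metis
  ultimately have ee: "e' = e" using nv edges_meet[of e e'] assms by blast
  have "t \<noteq> 0" "t \<noteq> L e" using nv assms chart_end_vertex ee by auto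
  then have "t \<in> {0<..<L e}" using assms ee by (auto simp: order_less_le)
  then show ?thesis using ee assms inj_interior[of e] by (auto dest: inj_onD)
qed

lemma vertex_coordinate: "e \<in> E \<Longrightarrow> t \<in> {0..L e} \<Longrightarrow> ch e t \<in> V \<Longrightarrow> t = 0 \<or> t = L e"
  using interior_not_vertex[of e t] by (auto simp: order_less_le)

text \<open>
  A point at infinity is a leaf end. Its valence one leaves room for neither a second edge nor a loop.
\<close>
lemma infinity_unique:
  assumes "e \<in> E" "L e = \<infinity>" "e' \<in> E" "t \<in> {0..L e'}" "ch e' t = ch e \<infinity>"
  shows "e' = e \<and> t = \<infinity>"
proof -
  let ?v = "ch e \<infinity>"
  have lf: "leaf_end \<Gamma> ?v" using leaf_inf assms by blast
  let ?A = "{e \<in> E. ?v \<in> ends \<Gamma> e}" and ?B = "{e \<in> E. ends \<Gamma> e = {?v}}"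
  have one: "card ?A + card ?B = 1" using lf by (auto simp: leaf_end_def vertex_valence_def)
  have fin: "finite ?A" "finite ?B" using finite_E by auto
  have eA: "e \<in> ?A" using assms ends_eq[of e] by auto
  then have "card ?A \<noteq> 0" using fin by auto
  with one have A1: "card ?A = 1" and "card ?B = 0" by auto
  then have B0: "?B = {}" using fin by auto
  have "?v \<in> V" using lf by (simp add: leaf_end_def)
  then have t: "t = 0 \<or> t = L e'" using vertex_coordinate[OF assms(3,4)] assms(5) by simp
  then have "ch e' t \<in> ends \<Gamma> e'" unfolding ends_eq[OF assms(3)] by blast
  then have "e' \<in> ?A" using assms(3,5) by simp
  then have ee: "e' = e" using A1 eA by (metis card_1_singletonE singletonD)
  have "t \<noteq> 0"
  proof
    assume "t = 0"
    then have "ch e 0 = ch e \<infinity>" using assms(5) ee by simp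
    then have "e \<in> ?B" using assms(1) ends_eq[OF assms(1)] assms(2) by simp
    with B0 show False by blast
  qed
  then show ?thesis using t ee assms by simp
qed

lemma inf_pointE:
  assumes "x \<in> inf_points \<Gamma>" obtains e where "e \<in> E" "L e = \<infinity>" "x = ch e \<infinity>"
  using assms unfolding inf_points_def by blast

lemma inf_pointI: "e \<in> E \<Longrightarrow> L e = \<infinity> \<Longrightarrow> ch e \<infinity> \<in> inf_points \<Gamma>"
  unfolding inf_points_def by blast

lemma inf_points_chart:
  assumes "e \<in> E" "t \<in> {0..L e}" shows "ch e t \<in> inf_points \<Gamma> \<longleftrightarrow> t = \<infinity>"
proof
  assume "ch e t \<in> inf_points \<Gamma>"
  then obtain e' where "e' \<in> E" "L e' = \<infinity>" "ch e t = ch e' \<infinity>" by (rule inf_pointE)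
  then show "t = \<infinity>" using infinity_unique assms by blast
next
  assume "t = \<infinity>"
  then show "ch e t \<in> inf_points \<Gamma>" using assms inf_pointI[of e] by simp
qed

lemma inf_points_subset: "inf_points \<Gamma> \<subseteq> V"
proof
  fix x assume "x \<in> inf_points \<Gamma>"
  then obtain e where "e \<in> E" "L e = \<infinity>" "x = ch e \<infinity>" by (rule inf_pointE)
  then show "x \<in> V" using chart_end_vertex(2)[of e] by simp
qed

lemma V_subset: "V \<subseteq> points \<Gamma>" and inf_subset: "inf_points \<Gamma> \<subseteq> points \<Gamma>"
  and fin_subset: "fin_points \<Gamma> \<subseteq> points \<Gamma>"
  using inf_points_subset by (auto simp: points_def fin_points_def)

lemma fin_chart: "e \<in> E \<Longrightarrow> t \<in> {0..L e} \<Longrightarrow> ch e t \<in> fin_points \<Gamma> \<longleftrightarrow> t \<noteq> \<infinity>"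
  using inf_points_chart chart_in_points by (auto simp: fin_points_def)

lemma fin_chart_real: "e \<in> E \<Longrightarrow> 0 \<le> t \<Longrightarrow> ereal t \<le> L e \<Longrightarrow> ch e (ereal t) \<in> fin_points \<Gamma>"
  by (subst fin_chart) auto

lemma points_cases:
  assumes "x \<in> points \<Gamma>"
  obtains "x \<in> V" | e t where "e \<in> E" "t \<in> {0<..<L e}" "x = ch e t"
proof (cases "x \<in> V")
  case False
  then obtain e where e: "e \<in> E" "x \<in> e" using assms by (auto simp: points_def)
  then obtain t where t: "t \<in> {0..L e}" "x = ch e t" using chart_image by blast
  then have "t \<in> {0<..<L e}" using False chart_end_vertex e by (auto simp: order_less_le)
  then show ?thesis using that e t by blast
qed (use that in blast)

lemma connected_graph:
  assumes "u \<in> V" "v \<in> V" shows "(u, v) \<in> {(a, b). \<exists>e\<in>E. ends \<Gamma> e = {a, b}}\<^sup>*"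
proof -
  have "\<forall>u\<in>V. \<forall>v\<in>V. (u, v) \<in> {(a, b). \<exists>e\<in>E. ends \<Gamma> e = {a, b}}\<^sup>*"
    using multigraph unfolding multigraph_def by (elim conjE)
  then show ?thesis using assms by simp
qed

lemma vertex_in_edge:
  assumes "v \<in> V" "\<not> is_singleton (points \<Gamma>)"
  obtains e where "e \<in> E" "v \<in> ends \<Gamma> e"
proof -
  have step: "\<exists>e\<in>E. v \<in> ends \<Gamma> e" if "u \<in> V" "u \<noteq> v" for u
  proof -
    from connected_graph[OF assms(1) that(1)] show ?thesis
    proof (cases rule: converse_rtranclE)
      case base
      then show ?thesis using that(2) by simp
    next
      case (step w)
      then show ?thesis by auto
    qed
  qed
  have "\<exists>e\<in>E. v \<in> ends \<Gamma> e"
  proof (cases "E = {}")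
    case True
    then have "points \<Gamma> = V" by (simp add: points_def)
    then obtain u where "u \<in> V" "u \<noteq> v" using assms unfolding is_singleton_def by blast
    then show ?thesis by (rule step)
  next
    case False
    then obtain e where e: "e \<in> E" by blast
    show ?thesis
    proof (cases "ch e 0 = v")
      case True then show ?thesis using e ends_eq[OF e] by blast
    next
      case False
      with chart_end_vertex(1)[OF e] show ?thesis by (rule step)
    qed
  qed
  then show ?thesis using that by blast
qed

lemma fin_points_nonempty: "fin_points \<Gamma> \<noteq> {}"
proof (cases "E = {}")
  case True
  then show ?thesis using V_nonempty by (auto simp: fin_points_def points_def inf_points_def)
next
  case False
  then obtain e where "e \<in> E" by blast
  then have "ch e 0 \<in> fin_points \<Gamma>" by (subst fin_chart) (auto simp: len_pos less_imp_le)
  then show ?thesis by blast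
qed

lemma topspace_curve: "topspace top_curve = points \<Gamma>"
proof
  show "topspace top_curve \<subseteq> points \<Gamma>"
    using openin_topspace[of top_curve] unfolding openin_curve_topology by simp
  have "{t \<in> {0..L e}. ch e t \<in> points \<Gamma>} = {0..L e}" if "e \<in> E" for e
    using chart_in_points[OF that] by auto
  then have "openin top_curve (points \<Gamma>)" by (simp add: openin_curve_topology)
  then show "points \<Gamma> \<subseteq> topspace top_curve" by (rule openin_subset)
qed

lemma continuous_chart:
  assumes "e \<in> E" shows "continuous_map (top_of_set {0..L e}) top_curve (ch e)"
  unfolding continuous_map_def openin_curve_topology topspace_curve
  using chart_in_points[OF assms] assms by simp

lemma continuous_map_curve_iff:
  "continuous_map top_curve Y f \<longleftrightarrow> f \<in> points \<Gamma> \<rightarrow> topspace Y \<and>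
     (\<forall>e\<in>E. continuous_map (top_of_set {0..L e}) Y (f \<circ> ch e))"
proof (intro iffI conjI ballI; (elim conjE)?)
  fix e assume "continuous_map top_curve Y f" "e \<in> E"
  then show "continuous_map (top_of_set {0..L e}) Y (f \<circ> ch e)"
    using continuous_map_compose[OF continuous_chart] by blast
next
  assume "continuous_map top_curve Y f"
  then show "f \<in> points \<Gamma> \<rightarrow> topspace Y" by (simp add: continuous_map_def topspace_curve)
next
  assume f: "f \<in> points \<Gamma> \<rightarrow> topspace Y" and c: "\<forall>e\<in>E. continuous_map (top_of_set {0..L e}) Y (f \<circ> ch e)"
  show "continuous_map top_curve Y f"
    unfolding continuous_map_def topspace_curve
  proof (intro conjI allI impI f)
    fix U assume U: "openin Y U"
    show "openin top_curve {x \<in> points \<Gamma>. f x \<in> U}"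
      unfolding openin_curve_topology
    proof (intro conjI ballI)
      fix e assume e: "e \<in> E"
      have "{t \<in> {0..L e}. ch e t \<in> {x \<in> points \<Gamma>. f x \<in> U}} = {t \<in> topspace (top_of_set {0..L e}). (f \<circ> ch e) t \<in> U}"
        using chart_in_points[OF e] by auto
      then show "openin (top_of_set {0..L e}) {t \<in> {0..L e}. ch e t \<in> {x \<in> points \<Gamma>. f x \<in> U}}"
        using openin_continuous_map_preimage[OF c[rule_format, OF e] U] by simp
    qed auto
  qed
qed

lemma continuous_curve_euclidean:
  "continuous_map top_curve euclidean f \<longleftrightarrow> (\<forall>e\<in>E. continuous_on {0..L e} (\<lambda>t. f (ch e t)))"
  by (simp add: continuous_map_curve_iff comp_def)

lemma compact_curve: "compact_space top_curve"
proof -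
  have "compactin top_curve (ch e ` {0..L e})" if "e \<in> E" for e
    by (rule image_compactin[OF _ continuous_chart[OF that]]) (simp add: compactin_subtopology compact_eq_closed)
  then have "compactin top_curve (\<Union>e\<in>E. ch e ` {0..L e})"
    by (intro compactin_Union) (auto simp: finite_E)
  moreover have "compactin top_curve V"
    by (rule finite_imp_compactin) (auto simp: topspace_curve finite_V V_subset)
  ultimately have "compactin top_curve (V \<union> (\<Union>e\<in>E. ch e ` {0..L e}))" by (intro compactin_Un)
  moreover have "V \<union> (\<Union>e\<in>E. ch e ` {0..L e}) = points \<Gamma>" by (auto simp: points_def chart_image)
  ultimately show ?thesis by (simp add: compact_space_def topspace_curve)
qed

text \<open>
  The finite points are dense, as a point at infinity is the limit along its edge.
\<close>
lemma continuous_eqI: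
  fixes f g :: "'a \<Rightarrow> 'b::t2_space"
  assumes "continuous_map top_curve euclidean f" "continuous_map top_curve euclidean g"
    and eq: "\<And>x. x \<in> fin_points \<Gamma> \<Longrightarrow> f x = g x" and x: "x \<in> points \<Gamma>"
  shows "f x = g x"
proof (cases "x \<in> inf_points \<Gamma>")
  case True
  then obtain e where e: "e \<in> E" "L e = \<infinity>" "x = ch e \<infinity>" by (rule inf_pointE)
  have lim: "(\<lambda>n. ereal (real n)) \<longlonglongrightarrow> \<infinity>" by (rule tendsto_PInfty_eq_at_top[THEN iffD2]) (rule filterlim_real_sequentially)
  have lim_h: "(\<lambda>n. h (ch e (ereal (real n)))) \<longlonglongrightarrow> h x" if "continuous_map top_curve euclidean h" for h :: "'a \<Rightarrow> 'b"
  proof -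
    have "continuous_on {0..\<infinity>} (\<lambda>t. h (ch e t))" using that[unfolded continuous_curve_euclidean, rule_format, OF e(1)] by (simp add: e(2))
    from continuous_on_tendsto_compose[OF this lim] show ?thesis using e by simp
  qed
  have "f (ch e (ereal (real n))) = g (ch e (ereal (real n)))" for n
    by (rule eq[OF fin_chart_real[OF e(1)]]) (simp_all add: e(2))
  then have "(\<lambda>n. f (ch e (ereal (real n)))) \<longlonglongrightarrow> g x" using lim_h[OF assms(2)] by simp
  with lim_h[OF assms(1)] show ?thesis by (rule LIMSEQ_unique)
qed (use x eq in \<open>auto simp: fin_points_def\<close>)

section \<open>The path distance\<close>

lemma path_nonneg: "path_length \<Gamma> x y d \<Longrightarrow> 0 \<le> d"
proof (induction rule: path_length.induct)
  case (segment x e s d t)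
  then show ?case using abs_ereal_pos[of "s - t"] by simp
qed simp

lemma path_trans:
  assumes "path_length \<Gamma> y z d'" "path_length \<Gamma> x y d" shows "path_length \<Gamma> x z (d + d')"
  using assms
proof (induction rule: path_length.induct)
  case (segment y e s d' t)
  then show ?case using path_length.segment[of \<Gamma> x e s "d + d'" t] by (simp add: add.assoc)
qed simp

lemma path_segment:
  "e \<in> E \<Longrightarrow> s \<in> {0..L e} \<Longrightarrow> t \<in> {0..L e} \<Longrightarrow> path_length \<Gamma> (ch e s) (ch e t) \<bar>s - t\<bar>"
  using path_length.segment[of \<Gamma> "ch e s" e s 0 t] path_length.const[of "ch e s" \<Gamma>] chart_in_points by simp

lemma abs_minus_commute_ereal: "\<bar>s - t\<bar> = \<bar>t - s\<bar>" for s t :: ereal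
  by (cases s; cases t) auto

lemma path_sym: "path_length \<Gamma> x y d \<Longrightarrow> path_length \<Gamma> y x d"
proof (induction rule: path_length.induct)
  case (segment x e s d t)
  then show ?case using path_trans[OF segment.IH path_segment[of e t s]]
    by (simp add: add.commute abs_minus_commute_ereal)
qed (rule path_length.const)

lemma cdist_le: "path_length \<Gamma> x y d \<Longrightarrow> cdist \<Gamma> x y \<le> d"
  unfolding cdist_def by (rule Inf_lower) simp

lemma cdist_nonneg: "0 \<le> cdist \<Gamma> x y"
  unfolding cdist_def by (rule Inf_greatest) (auto dest: path_nonneg)

lemma cdist_self: "x \<in> points \<Gamma> \<Longrightarrow> cdist \<Gamma> x x = 0"
  using cdist_le[OF path_length.const[of x]] cdist_nonneg[of x x] by auto

lemma cdist_sym: "cdist \<Gamma> x y = cdist \<Gamma> y x"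
proof -
  have "{d. path_length \<Gamma> x y d} = {d. path_length \<Gamma> y x d}" using path_sym by blast
  then show ?thesis unfolding cdist_def by (rule arg_cong)
qed

lemma cdist_segment_le:
  assumes "e \<in> E" "s \<in> {0..L e}" "t \<in> {0..L e}"
  shows "cdist \<Gamma> x (ch e t) \<le> cdist \<Gamma> x (ch e s) + \<bar>s - t\<bar>"
proof (cases "\<bar>s - t\<bar>")
  case (real c)
  have "cdist \<Gamma> x (ch e t) - c \<le> Inf {d. path_length \<Gamma> x (ch e s) d}"
  proof (rule Inf_greatest)
    fix d assume "d \<in> {d. path_length \<Gamma> x (ch e s) d}"
    then have "cdist \<Gamma> x (ch e t) \<le> d + \<bar>s - t\<bar>"
      using path_length.segment[of \<Gamma> x e s d t] assms cdist_le by blast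
    then show "cdist \<Gamma> x (ch e t) - c \<le> d" using real by (simp add: ereal_minus_le)
  qed
  then show ?thesis using real by (simp add: ereal_minus_le cdist_def)
qed (use cdist_nonneg[of x "ch e s"] in auto)

lemma lipschitz_path:
  assumes F: "\<And>e s t. e \<in> E \<Longrightarrow> s \<in> {0..L e} \<Longrightarrow> t \<in> {0..L e} \<Longrightarrow> F (ch e t) \<le> F (ch e s) + \<bar>s - t\<bar>"
    and p: "path_length \<Gamma> x y d"
  shows "F y \<le> F x + d"
  using p
proof (induction rule: path_length.induct)
  case (segment x e s d t)
  have "F (ch e t) \<le> F (ch e s) + \<bar>s - t\<bar>" using F segment by blast
  also have "\<dots> \<le> F x + d + \<bar>s - t\<bar>" using segment.IH by (rule add_right_mono)
  finally show ?case by (simp add: add.assoc)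
qed simp

text \<open>
  The way in which distances are bounded from below: along every segment the function \<open>F\<close> grows by at most the
  length of the segment.
\<close>
lemma lipschitz_cdist:
  assumes F: "\<And>e s t. e \<in> E \<Longrightarrow> s \<in> {0..L e} \<Longrightarrow> t \<in> {0..L e} \<Longrightarrow> F (ch e t) \<le> F (ch e s) + \<bar>s - t\<bar>"
    and "F x = 0"
  shows "F y \<le> cdist \<Gamma> x y"
  unfolding cdist_def by (rule Inf_greatest) (use lipschitz_path[of F, OF F] assms(2) in force)

text \<open>
  A path of finite length consists of segments with real coordinates, so properties of finite points propagate
  along it.
\<close>
lemma path_invariant:
  assumes P: "\<And>e s t. e \<in> E \<Longrightarrow> 0 \<le> s \<Longrightarrow> ereal s \<le> L e \<Longrightarrow> 0 \<le> t \<Longrightarrow> ereal t \<le> L e \<Longrightarrow>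
      P (ch e (ereal s)) \<Longrightarrow> P (ch e (ereal t))"
    and p: "path_length \<Gamma> x y d" "d < \<infinity>" "P x"
  shows "P y"
  using p
proof (induction rule: path_length.induct)
  case (segment x e s d t)
  have "d < \<infinity>" "\<bar>s - t\<bar> < \<infinity>" using segment.prems path_nonneg[OF segment.hyps(1)]
    by (auto intro: ccontr)
  moreover then obtain s' t' where "s = ereal s'" "t = ereal t'" by (cases s; cases t) auto
  ultimately show ?case using segment P[of e s' t'] by auto
qed

text \<open>
  The graph is connected, but a walk in it may visit a vertex at infinity, which has infinite distance from all
  other points. As such a vertex is a leaf end, the walk can only turn back there.
\<close>
lemma fin_points_connected:
  assumes "x \<in> fin_points \<Gamma>" "y \<in> fin_points \<Gamma>"
  shows "\<exists>d. path_length \<Gamma> x y d \<and> d < \<infinity>"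
proof -
  define N where "N x y \<longleftrightarrow> (\<exists>d. path_length \<Gamma> x y d \<and> d < \<infinity>)" for x y
  have N_sym: "N x y \<Longrightarrow> N y x" for x y using path_sym by (auto simp: N_def)
  have N_trans: "N x y \<Longrightarrow> N y z \<Longrightarrow> N x z" for x y z
    unfolding N_def by (metis path_trans ereal_plus_eq_PInfty less_irrefl order_less_le top_ereal_def top.not_eq_extremum)
  have N_seg: "N (ch e s) (ch e t)" if "e \<in> E" "s \<in> {0..L e}" "t \<in> {0..L e}" "s \<noteq> \<infinity>" "t \<noteq> \<infinity>" for e s t
    unfolding N_def using path_segment[OF that(1-3)] that by (intro exI[of _ "\<bar>s - t\<bar>"]) (cases s; cases t; auto)
  \<comment> \<open>a vertex at infinity is represented by the finite end of its only edge\<close>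
  define B where "B v w \<longleftrightarrow> (v \<in> fin_points \<Gamma> \<and> w = v) \<or> (\<exists>e\<in>E. L e = \<infinity> \<and> v = ch e \<infinity> \<and> w = ch e 0)" for v w
  have B_edge: "\<exists>s. s \<in> {0..L e} \<and> s \<noteq> \<infinity> \<and> w = ch e s" if "B (ch e t) w" "e \<in> E" "t \<in> {0..L e}" for e t w
    using that unfolding B_def
  proof (elim disjE)
    assume "ch e t \<in> fin_points \<Gamma> \<and> w = ch e t"
    then show ?thesis using that fin_chart by (intro exI[of _ t]) auto
  next
    assume "\<exists>e'\<in>E. L e' = \<infinity> \<and> ch e t = ch e' \<infinity> \<and> w = ch e' 0"
    then obtain e' where e': "e' \<in> E" "L e' = \<infinity>" "ch e t = ch e' \<infinity>" "w = ch e' 0" by blast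
    then have "e = e'" using infinity_unique that by blast
    then show ?thesis using e' by (intro exI[of _ 0]) auto
  qed
  have walk: "\<forall>w. B v w \<longrightarrow> N u0 w" if u0: "u0 \<in> fin_points \<Gamma>" "u0 \<in> V" and r: "(u0, v) \<in> {(a, b). \<exists>e\<in>E. ends \<Gamma> e = {a, b}}\<^sup>*" for u0 v
    using r
  proof (induction rule: rtrancl_induct)
    case base
    have "B u0 w \<Longrightarrow> w = u0" for w using u0 inf_points_def[of \<Gamma>] by (auto simp: B_def fin_points_def)
    moreover have "N u0 u0" using u0 path_length.const[of u0] V_subset unfolding N_def
      by (intro exI[of _ 0]) auto
    ultimately show ?case by blast
  next
    case (step v v')
    then obtain e where e: "e \<in> E" "ends \<Gamma> e = {v, v'}" by auto
    then have "v \<in> {ch e 0, ch e (L e)}" "v' \<in> {ch e 0, ch e (L e)}" using ends_eq by auto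
    then obtain t t' where t: "t \<in> {0..L e}" "v = ch e t" "t' \<in> {0..L e}" "v' = ch e t'"
      using len_pos[OF e(1)] by (metis atLeastAtMost_iff insert_iff less_imp_le order_refl singletonD)
    have "\<exists>w. B v w"
    proof (cases "v \<in> fin_points \<Gamma>")
      case False
      then have "v \<in> inf_points \<Gamma>" using t chart_in_points e by (auto simp: fin_points_def)
      then show ?thesis by (elim inf_pointE) (auto simp: B_def)
    qed (auto simp: B_def)
    then obtain w where w: "B v w" by blast
    then obtain s where s: "s \<in> {0..L e}" "s \<noteq> \<infinity>" "w = ch e s" using B_edge e t by blast
    have Nw: "N u0 w" using step.IH w by blast
    show ?case
    proof (intro allI impI)
      fix w' assume "B v' w'"
      then obtain s' where s': "s' \<in> {0..L e}" "s' \<noteq> \<infinity>" "w' = ch e s'" using B_edge e t by blast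
      show "N u0 w'" using N_trans[OF Nw] N_seg[OF e(1) s(1) s'(1) s(2) s'(2)] s s' by auto
    qed
  qed
  have to_vertex: "\<exists>v. v \<in> V \<and> v \<in> fin_points \<Gamma> \<and> N x v" if x: "x \<in> fin_points \<Gamma>" for x
  proof -
    have "x \<in> points \<Gamma>" using x fin_subset by blast
    then show ?thesis
    proof (cases rule: points_cases)
      case 1
      then show ?thesis using x path_length.const[of x] V_subset unfolding N_def
        by (intro exI[of _ x] conjI exI[of _ 0]) auto
    next
      case (2 e t)
      then have "N (ch e t) (ch e 0)" by (intro N_seg) auto
      moreover have "ch e 0 \<in> fin_points \<Gamma>" using 2 len_pos[of e] by (subst fin_chart) auto
      ultimately show ?thesis using 2 chart_end_vertex by blast
    qed
  qed
  obtain u v where u: "u \<in> V" "u \<in> fin_points \<Gamma>" "N x u" and v: "v \<in> V" "v \<in> fin_points \<Gamma>" "N y v"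
    using to_vertex assms by metis
  have "N u v" using walk[OF u(2,1) connected_graph[OF u(1) v(1)]] v(2) by (auto simp: B_def)
  then have "N x y" using u(3) v(3) N_trans N_sym by blast
  then show ?thesis by (simp add: N_def)
qed

lemma cdist_finite: "x \<in> fin_points \<Gamma> \<Longrightarrow> y \<in> fin_points \<Gamma> \<Longrightarrow> cdist \<Gamma> x y < \<infinity>"
  using fin_points_connected cdist_le by (metis order_le_less_trans)

lemma cdist_realE:
  assumes "x \<in> fin_points \<Gamma>" "y \<in> fin_points \<Gamma>"
  obtains d where "0 \<le> d" "cdist \<Gamma> x y = ereal d"
  using cdist_finite[OF assms] cdist_nonneg[of x y] that by (cases "cdist \<Gamma> x y") auto

lemma path_from_infinity:
  assumes "path_length \<Gamma> x y d" "x \<in> inf_points \<Gamma>" shows "y = x \<or> d = \<infinity>"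
  using assms
proof (induction rule: path_length.induct)
  case (segment x e s d t)
  then show ?case
  proof (cases "d = \<infinity>")
    case False
    then have "ch e s \<in> inf_points \<Gamma>" using segment by metis
    then have "s = \<infinity>" using inf_points_chart segment by blast
    then have "\<bar>s - t\<bar> = \<infinity>" by (cases t) auto
    then show ?thesis using path_nonneg[OF segment.hyps(1)] by auto
  qed simp
qed simp

lemma cdist_infinity:
  assumes "x \<in> points \<Gamma>" "y \<in> points \<Gamma>" "x \<in> inf_points \<Gamma> \<or> y \<in> inf_points \<Gamma>" "x \<noteq> y"
  shows "cdist \<Gamma> x y = \<infinity>"
proof -
  have "d = \<infinity>" if "path_length \<Gamma> x y d" for d
    using path_from_infinity[OF that] path_from_infinity[OF path_sym[OF that]] assms by blast
  then have "{d. path_length \<Gamma> x y d} \<subseteq> {\<infinity>}" by blast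
  then show ?thesis unfolding cdist_def
    by (metis Inf_greatest singletonD subsetD top_ereal_def top.extremum_uniqueI order_refl)
qed

text \<open>
  The points \<open>a\<close>, \<open>z\<close> and the vertices have finitely many coordinates in the edges, so coordinates of such points in a
  common edge are equal or at least some \<open>\<rho> > 0\<close> apart. A path from \<open>a\<close> that is shorter than \<open>\<rho>\<close> is therefore no shorter
  than a segment of a single edge that starts at \<open>a\<close>.
\<close>
lemma cdist_positive:
  assumes a: "a \<in> points \<Gamma>" and z: "z \<in> points \<Gamma>" "z \<noteq> a"
  shows "0 < cdist \<Gamma> a z"
proof -
  define W where "W = insert a (insert z V)"
  define Q where "Q e = {s \<in> {0..L e}. ch e s \<in> W}" for e
  have finQ: "finite (Q e)" if "e \<in> E" for e
  proof -
    have "finite (ch e -` W \<inter> {0<..<L e})"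
      using finite_V inj_interior[OF that] by (intro finite_vimage_IntI) (auto simp: W_def)
    moreover have "Q e \<subseteq> {0, L e} \<union> (ch e -` W \<inter> {0<..<L e})" by (auto simp: Q_def order_less_le)
    ultimately show ?thesis by (meson finite.emptyI finite.insertI finite_UnI finite_subset)
  qed
  define D where "D = insert 1 (\<Union>e\<in>E. (\<lambda>(s, t). \<bar>s - t\<bar>) ` {p \<in> Q e \<times> Q e. fst p \<noteq> snd p})"
  have finD: "finite D" using finQ finite_E by (auto simp: D_def)
  have posD: "0 < d" if "d \<in> D" for d
  proof -
    have "0 < \<bar>s - t\<bar>" if "s \<noteq> t" for s t :: ereal using that by (cases s; cases t) auto
    then show ?thesis using that by (auto simp: D_def)
  qed
  define \<rho> where "\<rho> = Min D"
  have \<rho>: "0 < \<rho>" using finD posD by (subst \<rho>_def, subst Min_gr_iff) (auto simp: D_def)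
  have gap: "\<rho> \<le> \<bar>s - t\<bar>" if "e \<in> E" "s \<in> Q e" "t \<in> Q e" "s \<noteq> t" for e s t
    unfolding \<rho>_def using finD that by (intro Min_le) (force simp: D_def)+
  have inv: "x = a \<longrightarrow> \<rho> \<le> d \<or> y = a \<or> (\<exists>e s t. e \<in> E \<and> s \<in> {0..L e} \<and> t \<in> {0..L e} \<and> ch e s = a \<and> ch e t = y \<and> \<bar>s - t\<bar> \<le> d)"
    if "path_length \<Gamma> x y d" for x y d
    using that
  proof (induction rule: path_length.induct)
    case (segment x e s d t)
    have d0: "0 \<le> d" using path_nonneg segment by blast
    have mono: "d \<le> d + \<bar>s - t\<bar>" using ereal_le_add_self d0 by auto
    have start: "\<exists>e' s' t'. e' \<in> E \<and> s' \<in> {0..L e'} \<and> t' \<in> {0..L e'} \<and> ch e' s' = a \<and> ch e' t' = ch e t \<and> \<bar>s' - t'\<bar> \<le> d + \<bar>s - t\<bar>"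
      if "ch e s = a"
    proof -
      have "\<bar>s - t\<bar> \<le> d + \<bar>s - t\<bar>" using d0 by (metis add.commute ereal_le_add_self)
      then show ?thesis using that segment by blast
    qed
    show ?case
    proof
      assume xa: "x = a"
      from segment.IH xa consider "\<rho> \<le> d" | "ch e s = a" | e' s' t' where "d < \<rho>"
        "e' \<in> E" "s' \<in> {0..L e'}" "t' \<in> {0..L e'}" "ch e' s' = a" "ch e' t' = ch e s" "\<bar>s' - t'\<bar> \<le> d" by force
      then show "\<rho> \<le> d + \<bar>s - t\<bar> \<or> ch e t = a \<or> (\<exists>e' s' t'. e' \<in> E \<and> s' \<in> {0..L e'} \<and> t' \<in> {0..L e'} \<and>
          ch e' s' = a \<and> ch e' t' = ch e t \<and> \<bar>s' - t'\<bar> \<le> d + \<bar>s - t\<bar>)"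
      proof cases
        case 1 then show ?thesis using mono by auto
      next
        case 2 then show ?thesis using start by blast
      next
        case 3
        show ?thesis
        proof (cases "t' \<in> {0<..<L e'}")
          case True
          then have ee: "e = e'" "s = t'" using interior_unique[OF 3(2) True segment(2,3)] 3 by auto
          have "\<bar>s' - t\<bar> \<le> \<bar>s' - s\<bar> + \<bar>s - t\<bar>" by (cases s; cases s'; cases t) auto
          also have "\<dots> \<le> d + \<bar>s - t\<bar>" using 3 ee by (intro add_right_mono) auto
          finally show ?thesis using 3 ee segment by blast
        next
          case False
          then have "t' = 0 \<or> t' = L e'" using 3 by (auto simp: order_less_le)
          then have "ch e' t' \<in> V" using chart_end_vertex[OF 3(2)] by (elim disjE) simp_all
          then have Q: "s' \<in> Q e'" "t' \<in> Q e'" using 3(3,4,5) by (simp_all add: Q_def W_def)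
          have "s' = t'"
          proof (rule ccontr)
            assume "s' \<noteq> t'"
            then have "\<rho> \<le> \<bar>s' - t'\<bar>" by (rule gap[OF 3(2) Q])
            with 3(1,7) show False by auto
          qed
          then have "ch e s = a" using 3(5,6) by simp
          then show ?thesis using start by blast
        qed
      qed
    qed
  qed simp
  have "\<rho> \<le> d" if p: "path_length \<Gamma> a z d" for d
  proof -
    consider "\<rho> \<le> d" | e s t where "e \<in> E" "s \<in> {0..L e}" "t \<in> {0..L e}" "ch e s = a" "ch e t = z" "\<bar>s - t\<bar> \<le> d"
      using inv[OF p] z(2) by blast
    then show ?thesis
    proof cases
      case 2
      then have "s \<in> Q e" "t \<in> Q e" "s \<noteq> t" using z by (auto simp: Q_def W_def)
      then show ?thesis using gap[OF 2(1)] 2 order_trans by blast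
    qed
  qed
  then have "\<rho> \<le> cdist \<Gamma> a z" unfolding cdist_def by (intro Inf_greatest) simp
  then show ?thesis using \<rho> by auto
qed

lemma cdist_eq_0_iff: "x \<in> points \<Gamma> \<Longrightarrow> y \<in> points \<Gamma> \<Longrightarrow> cdist \<Gamma> x y = 0 \<longleftrightarrow> x = y"
  using cdist_positive[of x y] cdist_self by force

text \<open>
  A path from \<open>a\<close> to a point of the edge \<open>e\<close> either enters \<open>e\<close> for the last time through one of its ends, or never leaves
  \<open>e\<close>. The function \<open>X\<close> bounds the length in the second case: it is the distance of coordinates if \<open>a\<close> lies in the
  interior of \<open>e\<close>, and can be taken to be infinite otherwise.
\<close>
lemma path_edge_bound:
  assumes e: "e \<in> E" and a: "a \<in> fin_points \<Gamma>"
    and X0: "\<And>t. t \<in> {0<..<L e} \<Longrightarrow> ch e t = a \<Longrightarrow> X t \<le> 0"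
    and X: "\<And>s t. s \<in> {0..L e} \<Longrightarrow> t \<in> {0..L e} \<Longrightarrow> X t \<le> X s + \<bar>s - t\<bar>"
    and p: "path_length \<Gamma> a y d" and yt: "y = ch e t" "t \<in> {0..L e}"
  shows "min (cdist \<Gamma> a (ch e 0) + t) (min (cdist \<Gamma> a (ch e (L e)) + (L e - t)) (X t)) \<le> d"
proof -
  define M where "M t = min (cdist \<Gamma> a (ch e 0) + t) (min (cdist \<Gamma> a (ch e (L e)) + (L e - t)) (X t))" for t
  have M_lip: "M t \<le> M s + \<bar>s - t\<bar>" if st: "s \<in> {0..L e}" "t \<in> {0..L e}" for s t
  proof -
    have 1: "c + t \<le> c + s + \<bar>s - t\<bar>" if "0 \<le> c" for c
      using that st by (cases s; cases t; cases c) auto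
    have 2: "c + (L e - t) \<le> c + (L e - s) + \<bar>s - t\<bar>" if "0 \<le> c" for c
      using that st by (cases s; cases t; cases c; cases "L e") auto
    have 3: "min x (min y z) \<le> min x' (min y' z') + w" if "x \<le> x' + w" "y \<le> y' + w" "z \<le> z' + w" for x y z x' y' z' w :: ereal
      using that by (auto simp: min_def)
    show ?thesis unfolding M_def by (intro 3 1 2 X st cdist_nonneg)
  qed
  have ends: "M t \<le> cdist \<Gamma> a (ch e t)" if "t = 0 \<or> t = L e" for t
    using that
  proof
    assume "t = 0" then show ?thesis by (simp add: M_def)
  next
    assume t: "t = L e"
    show ?thesis
    proof (cases "L e")
      case (real l) then show ?thesis using t by (simp add: M_def min_le_iff_disj)
    next
      case PInf
      have "ch e \<infinity> \<in> inf_points \<Gamma>" using PInf e by (auto simp: inf_points_def)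
      then have "cdist \<Gamma> a (ch e (L e)) = \<infinity>"
        using a inf_subset fin_subset PInf by (intro cdist_infinity) (auto simp: fin_points_def)
      then show ?thesis using t by simp
    qed (use len_pos[OF e] in auto)
  qed
  have "x = a \<longrightarrow> (\<forall>t \<in> {0..L e}. y = ch e t \<longrightarrow> M t \<le> d)" if "path_length \<Gamma> x y d" for x y d
    using that
  proof (induction rule: path_length.induct)
    case (const x)
    show ?case
    proof safe
      fix t assume t: "t \<in> {0..L e}" "a = ch e t"
      show "M t \<le> 0"
      proof (cases "t \<in> {0<..<L e}")
        case True
        then show ?thesis using X0[OF True] t by (auto simp: M_def min_le_iff_disj)
      next
        case False
        then have "t = 0 \<or> t = L e" using t by (auto simp: order_less_le)
        from ends[OF this] show ?thesis using t(2)[symmetric] a fin_subset by (auto simp: cdist_self)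
      qed
    qed
  next
    case (segment x e' s d t')
    show ?case
    proof safe
      fix t assume xa: "x = a" and t: "t \<in> {0..L e}" "ch e' t' = ch e t"
      show "M t \<le> d + \<bar>s - t'\<bar>"
      proof (cases "t \<in> {0<..<L e}")
        case True
        then have ee: "e' = e" "t' = t" using interior_unique[OF e True segment(2,4)] t(2) by auto
        then have "M s \<le> d" using segment xa by auto
        then show ?thesis using M_lip[of s t] segment(3) t(1) ee add_right_mono[of "M s" d "\<bar>s - t\<bar>"] by auto
      next
        case False
        then have "t = 0 \<or> t = L e" using t by (auto simp: order_less_le)
        from ends[OF this] have "M t \<le> cdist \<Gamma> a (ch e' t')" using t by simp
        also have "\<dots> \<le> d + \<bar>s - t'\<bar>" using path_length.segment[OF segment.hyps] xa by (intro cdist_le) simp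
        finally show ?thesis .
      qed
    qed
  qed
  from this[OF p] show ?thesis using yt by (auto simp: M_def)
qed

lemma cdist_chart_le:
  assumes "e \<in> E" "t \<in> {0..L e}"
  shows "cdist \<Gamma> a (ch e t) \<le> cdist \<Gamma> a (ch e 0) + t"
    "cdist \<Gamma> a (ch e t) \<le> cdist \<Gamma> a (ch e (L e)) + (L e - t)"
proof -
  have "\<bar>0 - t\<bar> = t" "\<bar>L e - t\<bar> = L e - t" using assms by (cases t; cases "L e"; auto)+
  then show "cdist \<Gamma> a (ch e t) \<le> cdist \<Gamma> a (ch e 0) + t"
    "cdist \<Gamma> a (ch e t) \<le> cdist \<Gamma> a (ch e (L e)) + (L e - t)"
    using cdist_segment_le[OF assms(1) _ assms(2), of 0 a] cdist_segment_le[OF assms(1) _ assms(2), of "L e" a]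
      len_pos[OF assms(1)] by auto
qed

lemma cdist_outside:
  assumes e: "e \<in> E" and a: "a \<in> fin_points \<Gamma>" "a \<notin> ch e ` {0<..<L e}" and t: "t \<in> {0..L e}"
  shows "cdist \<Gamma> a (ch e t) = min (cdist \<Gamma> a (ch e 0) + t) (cdist \<Gamma> a (ch e (L e)) + (L e - t))"
proof (rule antisym)
  show "cdist \<Gamma> a (ch e t) \<le> min (cdist \<Gamma> a (ch e 0) + t) (cdist \<Gamma> a (ch e (L e)) + (L e - t))"
    using cdist_chart_le[OF e t] by simp
  have "min (cdist \<Gamma> a (ch e 0) + t) (min (cdist \<Gamma> a (ch e (L e)) + (L e - t)) \<infinity>) \<le> d"
    if "path_length \<Gamma> a (ch e t) d" for d
    by (rule path_edge_bound[OF e a(1) _ _ that refl t]) (use a(2) in auto)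
  then show "min (cdist \<Gamma> a (ch e 0) + t) (cdist \<Gamma> a (ch e (L e)) + (L e - t)) \<le> cdist \<Gamma> a (ch e t)"
    unfolding cdist_def[of _ a "ch e t"] by (intro Inf_greatest) simp
qed

lemma cdist_same_edge:
  assumes e: "e \<in> E" and s: "s \<in> {0<..<L e}" and t: "t \<in> {0..L e}" and a: "a = ch e s"
  shows "cdist \<Gamma> a (ch e t) =
    min (cdist \<Gamma> a (ch e 0) + t) (min (cdist \<Gamma> a (ch e (L e)) + (L e - t)) \<bar>s - t\<bar>)"
proof (rule antisym)
  have s': "s \<in> {0..L e}" using s by auto
  have af: "a \<in> fin_points \<Gamma>" unfolding a using s by (subst fin_chart[OF e s']) auto
  then have "cdist \<Gamma> a a = 0" using fin_subset by (intro cdist_self) auto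
  then have "cdist \<Gamma> a (ch e t) \<le> \<bar>s - t\<bar>" using cdist_segment_le[OF e s' t, of a] a by simp
  then show "cdist \<Gamma> a (ch e t) \<le> min (cdist \<Gamma> a (ch e 0) + t) (min (cdist \<Gamma> a (ch e (L e)) + (L e - t)) \<bar>s - t\<bar>)"
    using cdist_chart_le[OF e t] by simp
  have "min (cdist \<Gamma> a (ch e 0) + t) (min (cdist \<Gamma> a (ch e (L e)) + (L e - t)) \<bar>s - t\<bar>) \<le> d"
    if "path_length \<Gamma> a (ch e t) d" for d
  proof (rule path_edge_bound[OF e af _ _ that refl t])
    fix t' assume t': "t' \<in> {0<..<L e}" "ch e t' = a"
    then have "t' = s" using interior_unique[OF e s e, of t'] a by (simp add: less_imp_le)
    then show "\<bar>s - t'\<bar> \<le> 0" using s by (cases s) auto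
  next
    fix u v assume "u \<in> {0..L e}" "v \<in> {0..L e}"
    show "\<bar>s - v\<bar> \<le> \<bar>s - u\<bar> + \<bar>u - v\<bar>" using s by (cases s; cases u; cases v) auto
  qed
  then show "min (cdist \<Gamma> a (ch e 0) + t) (min (cdist \<Gamma> a (ch e (L e)) + (L e - t)) \<bar>s - t\<bar>) \<le> cdist \<Gamma> a (ch e t)"
    unfolding cdist_def[of _ a "ch e t"] by (intro Inf_greatest) simp
qed
end

section \<open>Rational functions\<close>

lemma edge_filter_inside:
  assumes "F \<in> edge_filters L" "0 < L" shows "eventually (\<lambda>u. 0 < u \<and> ereal u < L) F"
proof -
  obtain a b where ab: "0 \<le> a" "a < b" "b \<le> L" "\<forall>u\<in>{}. \<not> (a < ereal u \<and> ereal u < b)"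
    "eventually (\<lambda>u. a < ereal u \<and> ereal u < b) F"
    by (rule edge_filter_interval[OF assms(1) finite.emptyI assms(2)])
  from ab(5) show ?thesis
  proof eventually_elim
    case (elim u)
    then show ?case using le_less_trans[OF ab(1), of "ereal u"] less_le_trans[OF _ ab(3), of "ereal u"] by simp
  qed
qed

context curve begin

text \<open>
  The nonzero elements of the semifield of rational functions.
\<close>
definition rat :: "('a \<Rightarrow> ereal) \<Rightarrow> bool" where
  "rat f \<longleftrightarrow> f \<in> extensional (points \<Gamma>) \<and> continuous_map top_curve euclidean f \<and>
      piecewise_affine \<Gamma> f \<and> (\<forall>x\<in>points \<Gamma>. \<bar>f x\<bar> = \<infinity> \<longrightarrow> x \<in> inf_points \<Gamma>)"

text \<open>
  On these functions the product of the semifield is the pointwise sum, without extension to points at infinity.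
\<close>
definition bounded_rat :: "('a \<Rightarrow> ereal) \<Rightarrow> bool" where
  "bounded_rat f \<longleftrightarrow> rat f \<and> (\<exists>c::real. \<forall>x\<in>points \<Gamma>. - ereal c \<le> f x \<and> f x \<le> ereal c)"

lemma bounded_rat_finite: "bounded_rat f \<Longrightarrow> x \<in> points \<Gamma> \<Longrightarrow> \<bar>f x\<bar> \<noteq> \<infinity>"
  by (cases "f x") (auto simp: bounded_rat_def)

lemma bounded_rat_rat: "bounded_rat f \<Longrightarrow> rat f"
  by (simp add: bounded_rat_def)

lemma rational_function_iff: "rational_function \<Gamma> f \<longleftrightarrow> f = const_fun \<Gamma> (-\<infinity>) \<or> rat f"
  by (simp add: rational_function_def rat_def)

lemma piecewise_affine_germs:
  "piecewise_affine \<Gamma> f \<longleftrightarrow> (\<forall>e\<in>E. \<forall>F\<in>edge_filters (L e). affine_germ UNIV F (\<lambda>u. f (ch e (ereal u))))"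
  unfolding piecewise_affine_def
  by (intro ball_cong refl piecewise_affine_iff_germs[of _ "\<lambda>u. f (ch _ (ereal u))"] len_pos)

lemma rat_finite: "rat f \<Longrightarrow> x \<in> fin_points \<Gamma> \<Longrightarrow> \<bar>f x\<bar> \<noteq> \<infinity>"
  by (auto simp: rat_def fin_points_def)

lemma rat_extensional: "rat f \<Longrightarrow> f \<in> extensional (points \<Gamma>)"
  by (simp add: rat_def)

lemma rat_continuous: "rat f \<Longrightarrow> continuous_map top_curve euclidean f"
  by (simp add: rat_def)

lemma rat_chart: "rat f \<Longrightarrow> e \<in> E \<Longrightarrow> continuous_on {0..L e} (\<lambda>t. f (ch e t))"
  using rat_continuous[of f] unfolding continuous_curve_euclidean by simp

lemma rat_germ: "rat f \<Longrightarrow> e \<in> E \<Longrightarrow> F \<in> edge_filters (L e) \<Longrightarrow> affine_germ UNIV F (\<lambda>u. f (ch e (ereal u)))"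
  unfolding rat_def piecewise_affine_germs by simp

text \<open>
  Functions are extensional, while a germ may be given by coordinates outside the edge; restriction to the curve does
  not affect it since eventually the coordinates are inside.
\<close>
lemma rat_restrictI:
  assumes c: "\<And>e. e \<in> E \<Longrightarrow> continuous_on {0..L e} (\<lambda>t. f (ch e t))"
    and g: "\<And>e F. e \<in> E \<Longrightarrow> F \<in> edge_filters (L e) \<Longrightarrow> affine_germ UNIV F (\<lambda>u. f (ch e (ereal u)))"
    and fin: "\<And>x. x \<in> fin_points \<Gamma> \<Longrightarrow> \<bar>f x\<bar> \<noteq> \<infinity>"
  shows "rat (restrict f (points \<Gamma>))"
proof -
  have "continuous_map top_curve euclidean (restrict f (points \<Gamma>))"
    unfolding continuous_curve_euclidean
  proof
    fix e assume e: "e \<in> E"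
    show "continuous_on {0..L e} (\<lambda>t. restrict f (points \<Gamma>) (ch e t))"
      by (rule continuous_on_eq[OF c[OF e]]) (use chart_in_points[OF e] in simp)
  qed
  moreover have "piecewise_affine \<Gamma> (restrict f (points \<Gamma>))"
    unfolding piecewise_affine_germs
  proof (intro ballI)
    fix e F assume e: "e \<in> E" and F: "F \<in> edge_filters (L e)"
    have "eventually (\<lambda>u. f (ch e (ereal u)) = restrict f (points \<Gamma>) (ch e (ereal u))) F"
      using edge_filter_inside[OF F len_pos[OF e]]
      by (rule eventually_mono) (use chart_in_points[OF e] in \<open>simp add: less_imp_le\<close>)
    with g[OF e F] show "affine_germ UNIV F (\<lambda>u. restrict f (points \<Gamma>) (ch e (ereal u)))"
      by (rule affine_germ_cong)
  qed
  moreover have "x \<in> inf_points \<Gamma>" if "x \<in> points \<Gamma>" "\<bar>restrict f (points \<Gamma>) x\<bar> = \<infinity>" for x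
    using that fin[of x] unfolding fin_points_def by auto
  ultimately show ?thesis unfolding rat_def by simp
qed

lemma rat_eqI:
  assumes "rat f" "rat g" "\<And>x. x \<in> points \<Gamma> \<Longrightarrow> f x = g x" shows "f = g"
  using assms unfolding rat_def by (auto intro: extensionalityI)

lemma const_fun_restrict: "const_fun \<Gamma> c = restrict (\<lambda>x. c) (points \<Gamma>)"
  by (simp add: const_fun_def)

lemma rat_const: "rat (const_fun \<Gamma> (ereal c))"
  unfolding const_fun_restrict by (rule rat_restrictI) (auto intro: affine_germ_const)

lemma bounded_rat_const: "bounded_rat (const_fun \<Gamma> (ereal c))"
  using rat_const by (auto simp: bounded_rat_def const_fun_def intro!: exI[of _ "\<bar>c\<bar>"])

lemma rat_max:
  assumes "rat f" "rat g" shows "rat (\<lambda>x\<in>points \<Gamma>. max (f x) (g x))"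
  using assms
  by (intro rat_restrictI continuous_on_max rat_chart affine_germ_max len_pos rat_germ)
    (auto simp: max_def len_pos dest: rat_finite)

lemma rat_min:
  assumes "rat f" "rat g" shows "rat (\<lambda>x\<in>points \<Gamma>. min (f x) (g x))"
  using assms
  by (intro rat_restrictI continuous_on_min rat_chart affine_germ_min len_pos rat_germ)
    (auto simp: min_def len_pos dest: rat_finite)

lemma rat_uminus:
  assumes "rat f" shows "rat (\<lambda>x\<in>points \<Gamma>. - f x)"
proof (rule rat_restrictI)
  fix e assume e: "e \<in> E"
  show "continuous_on {0..L e} (\<lambda>t. - f (ch e t))"
    by (rule continuous_on_compose2[OF continuous_uminus_ereal[of UNIV] rat_chart[OF assms e]]) simp
  fix F assume F: "F \<in> edge_filters (L e)"
  show "affine_germ UNIV F (\<lambda>u. - f (ch e (ereal u)))"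
    by (rule affine_germ_mono[OF affine_germ_uminus[OF rat_germ[OF assms e F]]]) simp
qed (use rat_finite[OF assms] in simp)

lemma continuous_on_add_ereal:
  fixes f g :: "'c::topological_space \<Rightarrow> ereal"
  assumes "continuous_on A f" "continuous_on A g" "\<And>x. x \<in> A \<Longrightarrow> \<bar>f x\<bar> \<noteq> \<infinity>" "\<And>x. x \<in> A \<Longrightarrow> \<bar>g x\<bar> \<noteq> \<infinity>"
  shows "continuous_on A (\<lambda>x. f x + g x)"
  unfolding continuous_on_def
proof
  fix x assume x: "x \<in> A"
  show "((\<lambda>x. f x + g x) \<longlongrightarrow> f x + g x) (at x within A)"
    by (rule tendsto_add_ereal[OF assms(3)[OF x] assms(4)[OF x]])
      (use assms(1,2) x in \<open>simp_all add: continuous_on_def\<close>)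
qed

lemma bounded_rat_add:
  assumes f: "bounded_rat f" and g: "bounded_rat g" shows "bounded_rat (\<lambda>x\<in>points \<Gamma>. f x + g x)"
proof -
  have f': "rat f" "\<And>x. x \<in> points \<Gamma> \<Longrightarrow> \<bar>f x\<bar> \<noteq> \<infinity>" and g': "rat g" "\<And>x. x \<in> points \<Gamma> \<Longrightarrow> \<bar>g x\<bar> \<noteq> \<infinity>"
    using f g bounded_rat_rat bounded_rat_finite by auto
  have fin: "\<bar>f x + g x\<bar> \<noteq> \<infinity>" if "x \<in> points \<Gamma>" for x
    using f'(2)[OF that] g'(2)[OF that] by (cases "f x"; cases "g x") auto
  have "rat (\<lambda>x\<in>points \<Gamma>. f x + g x)"
  proof (rule rat_restrictI)
    fix e assume e: "e \<in> E"
    show "continuous_on {0..L e} (\<lambda>t. f (ch e t) + g (ch e t))"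
      by (intro continuous_on_add_ereal rat_chart f' g' e chart_in_points)
    fix F assume F: "F \<in> edge_filters (L e)"
    show "affine_germ UNIV F (\<lambda>u. f (ch e (ereal u)) + g (ch e (ereal u)))"
      by (intro affine_germ_add rat_germ f' g' e F)
  next
    fix x assume "x \<in> fin_points \<Gamma>"
    then show "\<bar>f x + g x\<bar> \<noteq> \<infinity>" by (intro fin subsetD[OF fin_subset])
  qed
  moreover obtain c where c: "\<forall>x\<in>points \<Gamma>. - ereal c \<le> f x \<and> f x \<le> ereal c" using f by (auto simp: bounded_rat_def)
  moreover obtain d where d: "\<forall>x\<in>points \<Gamma>. - ereal d \<le> g x \<and> g x \<le> ereal d" using g by (auto simp: bounded_rat_def)
  moreover have "- ereal (c + d) \<le> f x + g x \<and> f x + g x \<le> ereal (c + d)" if x: "x \<in> points \<Gamma>" for x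
    using bspec[OF c x] bspec[OF d x] by (cases "f x"; cases "g x") auto
  ultimately show ?thesis unfolding bounded_rat_def by (intro conjI exI[of _ "c + d"]) auto
qed

lemma bounded_rat_max:
  assumes f: "bounded_rat f" and g: "bounded_rat g" shows "bounded_rat (\<lambda>x\<in>points \<Gamma>. max (f x) (g x))"
proof -
  obtain c where c: "\<forall>x\<in>points \<Gamma>. - ereal c \<le> f x \<and> f x \<le> ereal c" using f by (auto simp: bounded_rat_def)
  obtain d where d: "\<forall>x\<in>points \<Gamma>. - ereal d \<le> g x \<and> g x \<le> ereal d" using g by (auto simp: bounded_rat_def)
  have "- ereal (max c d) \<le> max (f x) (g x) \<and> max (f x) (g x) \<le> ereal (max c d)" if x: "x \<in> points \<Gamma>" for x
    using bspec[OF c x] bspec[OF d x] by (cases "f x"; cases "g x") (auto simp: max_def)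
  then show ?thesis using rat_max[OF bounded_rat_rat[OF f] bounded_rat_rat[OF g]]
    unfolding bounded_rat_def by (intro conjI exI[of _ "max c d"]) simp_all
qed

lemma bounded_rat_uminus:
  assumes f: "bounded_rat f" shows "bounded_rat (\<lambda>x\<in>points \<Gamma>. - f x)"
proof -
  obtain c where c: "\<forall>x\<in>points \<Gamma>. - ereal c \<le> f x \<and> f x \<le> ereal c" using f by (auto simp: bounded_rat_def)
  have "- ereal c \<le> - f x \<and> - f x \<le> ereal c" if x: "x \<in> points \<Gamma>" for x
    using bspec[OF c x] by (cases "f x") auto
  then show ?thesis using rat_uminus[OF bounded_rat_rat[OF f]]
    unfolding bounded_rat_def by (intro conjI exI[of _ c]) simp_all
qed

lemma bounded_rat_abs_diff:
  assumes f: "bounded_rat f" shows "bounded_rat (\<lambda>x\<in>points \<Gamma>. \<bar>f x - ereal c\<bar>)"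
proof -
  let ?d = "\<lambda>x\<in>points \<Gamma>. f x + const_fun \<Gamma> (ereal (- c)) x"
  have "bounded_rat (\<lambda>x\<in>points \<Gamma>. max (?d x) ((\<lambda>x\<in>points \<Gamma>. - ?d x) x))"
    by (intro bounded_rat_max bounded_rat_uminus bounded_rat_add f bounded_rat_const)
  moreover have "max (?d x) ((\<lambda>x\<in>points \<Gamma>. - ?d x) x) = \<bar>f x - ereal c\<bar>" if "x \<in> points \<Gamma>" for x
    using that bounded_rat_finite[OF f that] by (cases "f x") (auto simp: const_fun_def max_def)
  then have "(\<lambda>x\<in>points \<Gamma>. max (?d x) ((\<lambda>x\<in>points \<Gamma>. - ?d x) x)) = (\<lambda>x\<in>points \<Gamma>. \<bar>f x - ereal c\<bar>)"
    by (rule restrict_ext)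
  ultimately show ?thesis by simp
qed

lemma bottom_not_rat: "\<not> rat (const_fun \<Gamma> (-\<infinity>))"
proof
  assume r: "rat (const_fun \<Gamma> (-\<infinity>))"
  obtain x where x: "x \<in> fin_points \<Gamma>" using fin_points_nonempty by blast
  then have "const_fun \<Gamma> (-\<infinity>) x = -\<infinity>" using fin_subset by (auto simp: const_fun_def)
  with rat_finite[OF r x] show False by simp
qed

text \<open>
  The continuous extension to the points at infinity is unique because the finite points are dense.
\<close>
lemma trop_mult_eqI:
  assumes f: "rat f" and g: "rat g" and h: "h \<in> extensional (points \<Gamma>)" "continuous_map top_curve euclidean h"
    "\<And>x. x \<in> fin_points \<Gamma> \<Longrightarrow> h x = f x + g x"
  shows "trop_mult \<Gamma> f g = h"
proof -
  have nb: "f \<noteq> const_fun \<Gamma> (-\<infinity>)" "g \<noteq> const_fun \<Gamma> (-\<infinity>)" using f g bottom_not_rat by auto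
  have "(THE h. h \<in> extensional (points \<Gamma>) \<and> continuous_map top_curve euclidean h \<and>
             (\<forall>x\<in>fin_points \<Gamma>. h x = f x + g x)) = h"
  proof (rule the_equality)
    fix h' assume h': "h' \<in> extensional (points \<Gamma>) \<and> continuous_map top_curve euclidean h' \<and>
             (\<forall>x\<in>fin_points \<Gamma>. h' x = f x + g x)"
    show "h' = h"
    proof (rule extensionalityI)
      fix x assume x: "x \<in> points \<Gamma>"
      show "h' x = h x"
      proof (rule continuous_eqI[OF _ h(2) _ x])
        fix y assume "y \<in> fin_points \<Gamma>"
        then show "h' y = h y" using h' h(3) by simp
      qed (use h' in simp)
    qed (use h(1) h' in simp_all)
  qed (use h in simp)
  then show ?thesis using nb by (simp add: trop_mult_def)
qed

lemma trop_mult_bounded: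
  assumes "bounded_rat f" "bounded_rat g" shows "trop_mult \<Gamma> f g = (\<lambda>x\<in>points \<Gamma>. f x + g x)"
proof -
  have r: "rat (\<lambda>x\<in>points \<Gamma>. f x + g x)" by (rule bounded_rat_rat[OF bounded_rat_add[OF assms]])
  show ?thesis
  proof (rule trop_mult_eqI[OF bounded_rat_rat[OF assms(1)] bounded_rat_rat[OF assms(2)] rat_extensional[OF r] rat_continuous[OF r]])
    fix x assume "x \<in> fin_points \<Gamma>"
    then show "(\<lambda>x\<in>points \<Gamma>. f x + g x) x = f x + g x" using subsetD[OF fin_subset] by simp
  qed
qed

lemma trop_mult_self:
  assumes "rat f" shows "trop_mult \<Gamma> f f = (\<lambda>x\<in>points \<Gamma>. f x * 2)"
proof (rule trop_mult_eqI[OF assms assms])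
  show "continuous_map top_curve euclidean (\<lambda>x\<in>points \<Gamma>. f x * 2)"
    unfolding continuous_curve_euclidean
  proof
    fix e assume e: "e \<in> E"
    have "continuous_on UNIV (\<lambda>a. a * ereal 2)"
      using tendsto_cmult_ereal[of "ereal 2" "\<lambda>x. x"] by (force simp: continuous_on_def mult_ac)
    then have "continuous_on {0..L e} (\<lambda>t. f (ch e t) * ereal 2)"
      by (rule continuous_on_compose2[OF _ rat_chart[OF assms e]]) simp
    then show "continuous_on {0..L e} (\<lambda>t. (\<lambda>x\<in>points \<Gamma>. f x * 2) (ch e t))"
      by (rule continuous_on_eq) (use chart_in_points[OF e] in simp)
  qed
  fix x assume x: "x \<in> fin_points \<Gamma>"
  then have "\<bar>f x\<bar> \<noteq> \<infinity>" "x \<in> points \<Gamma>" using rat_finite[OF assms] fin_subset by auto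
  then show "(\<lambda>x\<in>points \<Gamma>. f x * 2) x = f x + f x" by (cases "f x") auto
qed simp

text \<open>
  The intervals are all those on which \<open>f\<close> is affine, so the condition does not refer to a choice of pieces.
\<close>
definition slopes_in :: "int set \<Rightarrow> ('a \<Rightarrow> ereal) \<Rightarrow> bool" where
  "slopes_in M f \<longleftrightarrow> (\<forall>e\<in>E. \<forall>a b m c. 0 \<le> a \<and> a < b \<and> ereal b \<le> L e \<and>
      (\<forall>t. a < t \<and> t < b \<longrightarrow> f (ch e (ereal t)) = ereal (of_int m * t + c)) \<longrightarrow> m \<in> M)"

text \<open>
  Along an edge a rational function is the integral of its slope, which is defined outside finitely many points.
\<close>
lemma slope_lipschitz:
  assumes f: "rat f" and e: "e \<in> E" and K: "0 \<le> K" and slope: "slopes_in M f"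
    and M: "\<forall>m\<in>M. \<bar>real_of_int m\<bar> \<le> K"
    and st: "0 \<le> s" "s \<le> t" "ereal t \<le> L e"
  shows "\<bar>real_of_ereal (f (ch e (ereal t))) - real_of_ereal (f (ch e (ereal s)))\<bar> \<le> K * (t - s)"
proof -
  define h where "h u = real_of_ereal (f (ch e (ereal u)))" for u
  have sub: "0 \<le> u \<and> ereal u \<le> L e" if "u \<in> {s..t}" for u
    using that st order_trans[of "ereal u" "ereal t" "L e"] by simp
  have "continuous_on {s..t} (\<lambda>u. f (ch e (ereal u)))"
    by (rule continuous_on_compose2[OF rat_chart[OF f e]]) (use sub in \<open>auto intro!: continuous_intros\<close>)
  moreover have "\<bar>f (ch e (ereal u))\<bar> \<noteq> \<infinity>" if "u \<in> {s..t}" for u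
    using rat_finite[OF f fin_chart_real[OF e]] sub[OF that] by simp
  ultimately have cont: "continuous_on {s..t} h"
    unfolding h_def using continuous_on_iff_real[of "{s..t}" "\<lambda>u. f (ch e (ereal u))"] by (simp add: comp_def)
  have "piecewise_affine \<Gamma> f" using f by (simp add: rat_def)
  from bspec[OF this[unfolded piecewise_affine_def] e] obtain S where S: "finite S" "\<forall>a b. 0 \<le> a \<and> a < b \<and> b \<le> L e \<and> {a<..<b} \<inter> S = {} \<longrightarrow>
           (\<exists>(m::int) (c::real). \<forall>t::real. a < ereal t \<and> ereal t < b \<longrightarrow> f (ch e (ereal t)) = ereal (of_int m * t + c))"
    by (elim exE conjE)
  define T where "T = ereal -` S"
  have T: "finite T" unfolding T_def using S(1) by (intro finite_vimageI) auto
  have "\<exists>D. (h has_vector_derivative D) (at x) \<and> \<bar>D\<bar> \<le> K" if x: "x \<in> {s<..<t} - T" for x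
  proof -
    have "open ({s<..<t} - T)" using T by (intro open_Diff finite_imp_closed) auto
    then obtain d where d: "0 < d" "ball x d \<subseteq> {s<..<t} - T" using x by (meson open_contains_ball)
    define a b where "a = x - d/2" and "b = x + d/2"
    have ab: "{a..b} \<subseteq> {s<..<t} - T"
      using d by (auto simp: a_def b_def dist_real_def subset_eq)
    have axb: "a < x" "x < b" "a \<in> {a..b}" "b \<in> {a..b}" using d(1) by (auto simp: a_def b_def)
    have "a \<in> {s..t}" "b \<in> {s..t}" using subsetD[OF ab axb(3)] subsetD[OF ab axb(4)] by auto
    from sub[OF this(1)] sub[OF this(2)] have ab0: "0 \<le> a" "ereal b \<le> L e" by simp_all
    have "{ereal a<..<ereal b} \<inter> S = {}"
    proof safe
      fix y assume "y \<in> S" "y \<in> {ereal a<..<ereal b}"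
      moreover then obtain r where "y = ereal r" by (cases y) auto
      ultimately have "r \<in> {a..b}" "r \<in> T" by (auto simp: T_def)
      then show "y \<in> {}" using ab by blast
    qed
    then have "0 \<le> ereal a \<and> ereal a < ereal b \<and> ereal b \<le> L e \<and> {ereal a<..<ereal b} \<inter> S = {}"
      using ab0 axb by simp
    from S(2)[rule_format, OF this]
    obtain m :: int and c where mc: "\<forall>u. ereal a < ereal u \<and> ereal u < ereal b \<longrightarrow> f (ch e (ereal u)) = ereal (of_int m * u + c)"
      by (elim exE)
    then have "0 \<le> a \<and> a < b \<and> ereal b \<le> L e \<and>
      (\<forall>t. a < t \<and> t < b \<longrightarrow> f (ch e (ereal t)) = ereal (of_int m * t + c))"
      using axb ab0 by simp
    then have "m \<in> M" by (rule slope[unfolded slopes_in_def, rule_format, OF e])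
    then have mK: "\<bar>real_of_int m\<bar> \<le> K" using M by simp
    have "(h has_vector_derivative of_int m) (at x)"
    proof (rule has_vector_derivative_transform_within_open[of "\<lambda>u. of_int m * u + c" _ _ "{a<..<b}"])
      show "((\<lambda>u. of_int m * u + c) has_vector_derivative of_int m) (at x)"
        by (auto intro!: derivative_eq_intros simp: has_real_derivative_iff_has_vector_derivative[symmetric])
    next
      fix u assume "u \<in> {a<..<b}"
      then show "of_int m * u + c = h u" using mc by (simp add: h_def)
    qed (use axb in simp_all)
    with mK show ?thesis by (intro exI[of _ "of_int m"] conjI)
  qed
  then have "\<forall>x\<in>{s<..<t} - T. \<exists>D. (h has_vector_derivative D) (at x) \<and> \<bar>D\<bar> \<le> K" by (rule ballI)
  from bchoice[OF this] obtain h' where h': "\<forall>x\<in>{s<..<t} - T. (h has_vector_derivative h' x) (at x) \<and> \<bar>h' x\<bar> \<le> K"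
    by (elim exE)
  have hi: "(h' has_integral (h t - h s)) {s..t}"
    by (rule fundamental_theorem_of_calculus_interior_strong[OF T st(2) _ cont]) (use h' in simp)
  have "norm (h t - h s) \<le> K * Henstock_Kurzweil_Integration.content {s..t}"
    by (rule has_integral_bound_real[where S = "T \<union> {s, t}", OF K _ hi]) (use T h' in auto)
  then show ?thesis using st by (simp add: h_def)
qed

text \<open>
  The slope bound makes \<open>f\<close> 1-Lipschitz along segments. Setting \<open>F\<close> to infinity at points at infinity turns this into
  the hypothesis of \<open>lipschitz_cdist\<close>, as segments that reach such a point have infinite length.
\<close>
lemma rat_lipschitz_cdist:
  assumes f: "rat f" and x: "x \<in> fin_points \<Gamma>" and y: "y \<in> fin_points \<Gamma>"
    and slope: "slopes_in {-1, 1} f"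
  shows "f x - f y \<le> cdist \<Gamma> x y"
proof -
  define F where "F z = (if z \<in> fin_points \<Gamma> then f x - f z else \<infinity>)" for z
  have "F (ch e t) \<le> F (ch e s) + \<bar>s - t\<bar>" if e: "e \<in> E" and s: "s \<in> {0..L e}" and t: "t \<in> {0..L e}" for e s t
  proof (cases "s = \<infinity> \<or> t = \<infinity>")
    case True
    then have "\<bar>s - t\<bar> = \<infinity>" by (cases s; cases t) auto
    then show ?thesis by simp
  next
    case False
    then obtain s' t' where st: "s = ereal s'" "t = ereal t'" using s t by (cases s; cases t) auto
    have fin: "ch e s \<in> fin_points \<Gamma>" "ch e t \<in> fin_points \<Gamma>"
      using fin_chart[OF e s] fin_chart[OF e t] False by auto
    obtain u where u: "f (ch e s) = ereal u" using rat_finite[OF f fin(1)] by (cases "f (ch e s)") auto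
    obtain v where v: "f (ch e t) = ereal v" using rat_finite[OF f fin(2)] by (cases "f (ch e t)") auto
    obtain w where w: "f x = ereal w" using rat_finite[OF f x] by (cases "f x") auto
    note uvw = u v w
    have lip: "\<bar>real_of_ereal (f (ch e (ereal q))) - real_of_ereal (f (ch e (ereal p)))\<bar> \<le> 1 * (q - p)"
      if "0 \<le> p" "p \<le> q" "ereal q \<le> L e" for p q
      by (rule slope_lipschitz[OF f e zero_le_one slope _ that]) simp
    have "\<bar>v - u\<bar> \<le> \<bar>s' - t'\<bar>"
    proof (cases "s' \<le> t'")
      case True
      then show ?thesis using lip[of s' t'] s t uvw unfolding st by simp
    next
      case False
      then show ?thesis using lip[of t' s'] s t uvw unfolding st by simp
    qed
    then show ?thesis using fin uvw st by (simp add: F_def)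
  qed
  moreover have "F x = 0" using x rat_finite[OF f x] by (auto simp: F_def)
  ultimately have "F y \<le> cdist \<Gamma> x y" by (rule lipschitz_cdist)
  then show ?thesis using y by (simp add: F_def)
qed

lemma rat_locally_constant:
  assumes f: "rat f"
    and slope: "slopes_in {0} f"
  shows "\<exists>c. f = const_fun \<Gamma> (ereal c)"
proof -
  obtain x where x: "x \<in> fin_points \<Gamma>" using fin_points_nonempty by blast
  obtain c where c: "f x = ereal c" using rat_finite[OF f x] by (cases "f x") auto
  define P where "P z \<longleftrightarrow> f z = ereal c" for z
  have step: "P (ch e (ereal t))" if e: "e \<in> E" and s: "0 \<le> s" "ereal s \<le> L e" and t: "0 \<le> t" "ereal t \<le> L e"
    and P: "P (ch e (ereal s))" for e s t
  proof -
    have lip: "\<bar>real_of_ereal (f (ch e (ereal q))) - real_of_ereal (f (ch e (ereal p)))\<bar> \<le> 0 * (q - p)"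
      if "0 \<le> p" "p \<le> q" "ereal q \<le> L e" for p q
      by (rule slope_lipschitz[OF f e order_refl slope _ that]) simp
    have fin: "\<bar>f (ch e (ereal t))\<bar> \<noteq> \<infinity>" using rat_finite[OF f fin_chart_real[OF e t]] .
    have "real_of_ereal (f (ch e (ereal t))) = real_of_ereal (f (ch e (ereal s)))"
      using lip[of s t] lip[of t s] s t by (cases "s \<le> t") auto
    then show ?thesis using P fin by (cases "f (ch e (ereal t))") (auto simp: P_def)
  qed
  have fc: "f y = ereal c" if y: "y \<in> fin_points \<Gamma>" for y
  proof -
    obtain d where d: "path_length \<Gamma> x y d" "d < \<infinity>" using fin_points_connected[OF x y] by blast
    have "P y" by (rule path_invariant[of P, OF step d]) (use c in \<open>simp_all add: P_def\<close>)
    then show ?thesis by (simp add: P_def)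
  qed
  have "f y = const_fun \<Gamma> (ereal c) y" if "y \<in> points \<Gamma>" for y
  proof (rule continuous_eqI[OF rat_continuous[OF f] rat_continuous[OF rat_const] _ that])
    fix z assume "z \<in> fin_points \<Gamma>"
    then show "f z = const_fun \<Gamma> (ereal c) z" using fc subsetD[OF fin_subset] by (simp add: const_fun_def)
  qed
  then have "f = const_fun \<Gamma> (ereal c)" by (rule rat_eqI[OF f rat_const])
  then show ?thesis ..
qed

section \<open>The distance to a finite point as a rational function\<close>

lemma cdist_chart_continuous:
  assumes e: "e \<in> E" and a: "a \<in> fin_points \<Gamma>"
  shows "continuous_on {0..L e} (\<lambda>t. cdist \<Gamma> a (ch e t))"
proof -
  have "ch e 0 \<in> fin_points \<Gamma>" using len_pos[OF e] by (subst fin_chart[OF e]) auto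
  then obtain d0 where d0: "cdist \<Gamma> a (ch e 0) = ereal d0" using cdist_realE[OF a] by blast
  have c0: "continuous_on {0..L e} (\<lambda>t. cdist \<Gamma> a (ch e 0) + t)"
    unfolding d0 continuous_on_def
    by (auto intro!: tendsto_add_ereal_general2)
  have c1: "continuous_on {0..L e} (\<lambda>t. cdist \<Gamma> a (ch e (L e)) + (L e - t))"
  proof (cases "L e")
    case (real l)
    have "ch e (L e) \<in> fin_points \<Gamma>" using len_pos[OF e] real by (subst fin_chart[OF e]) auto
    then obtain d1 where d1: "cdist \<Gamma> a (ch e (L e)) = ereal d1" using cdist_realE[OF a] by blast
    have "ereal d1 + (ereal l - t) = ereal (d1 + l) + - t" for t by (cases t) auto
    moreover have "continuous_on {0..ereal l} (\<lambda>t. ereal (d1 + l) + - t)"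
      unfolding continuous_on_def by (auto intro!: tendsto_add_ereal_general2 tendsto_uminus_ereal)
    ultimately have "continuous_on {0..ereal l} (\<lambda>t. ereal d1 + (ereal l - t))" by presburger
    then show ?thesis using d1 real by simp
  next
    case PInf
    then have "(\<lambda>t. cdist \<Gamma> a (ch e (L e)) + (L e - t)) = (\<lambda>t. \<infinity>)" by auto
    then show ?thesis by (simp only: continuous_on_const)
  qed (use len_pos[OF e] in auto)
  show ?thesis
  proof (cases "a \<in> ch e ` {0<..<L e}")
    case False
    have "continuous_on {0..L e} (\<lambda>t. min (cdist \<Gamma> a (ch e 0) + t) (cdist \<Gamma> a (ch e (L e)) + (L e - t)))"
      by (intro continuous_on_min c0 c1)
    then show ?thesis by (rule continuous_on_eq) (use cdist_outside[OF e a False] in simp)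
  next
    case True
    then obtain s where s: "s \<in> {0<..<L e}" "a = ch e s" by blast
    then obtain r where r: "s = ereal r" by (cases s) auto
    have "continuous_on {0..L e} (\<lambda>t. s + - t)"
      unfolding r continuous_on_def by (auto intro!: tendsto_add_ereal_general2 tendsto_uminus_ereal)
    then have "continuous_on {0..L e} (\<lambda>t. \<bar>s - t\<bar>)"
      unfolding minus_ereal_def by (rule continuous_on_compose_ereal_abs)
    then have "continuous_on {0..L e} (\<lambda>t. min (cdist \<Gamma> a (ch e 0) + t) (min (cdist \<Gamma> a (ch e (L e)) + (L e - t)) \<bar>s - t\<bar>))"
      by (intro continuous_on_min c0 c1)
    then show ?thesis by (rule continuous_on_eq) (use cdist_same_edge[OF e s(1) _ s(2)] in simp)
  qed
qed

lemma affine_germ_abs_diff: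
  assumes F: "F \<in> edge_filters l" and l: "0 < l"
  shows "affine_germ {1, -1} F (\<lambda>u. \<bar>ereal r - ereal u\<bar>)"
proof -
  have "\<bar>ereal r - ereal u\<bar> = max (ereal (u - r)) (ereal (r - u))" for u by (simp add: max_def)
  moreover have "affine_germ {1, -1} F (\<lambda>u. max (ereal (u - r)) (ereal (r - u)))"
  proof (rule affine_germ_max[OF F l])
    show "affine_germ {1, -1} F (\<lambda>u. ereal (u - r))"
      unfolding affine_germ_def by (intro bexI[of _ 1] exI[of _ "- r"]) auto
    show "affine_germ {1, -1} F (\<lambda>u. ereal (r - u))"
      unfolding affine_germ_def by (intro bexI[of _ "-1"] exI[of _ r]) auto
  qed
  ultimately show ?thesis by presburger
qed

text \<open>
  In terms of the coordinate, the distance is the minimum of at most three functions with slopes 1 and -1.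
\<close>
lemma cdist_chart_germ:
  assumes e: "e \<in> E" and a: "a \<in> fin_points \<Gamma>" and F: "F \<in> edge_filters (L e)"
  shows "affine_germ {1, -1} F (\<lambda>u. cdist \<Gamma> a (ch e (ereal u)))"
proof -
  note lp = len_pos[OF e]
  have "ch e 0 \<in> fin_points \<Gamma>" using lp by (subst fin_chart[OF e]) auto
  then obtain d0 where d0: "cdist \<Gamma> a (ch e 0) = ereal d0" using cdist_realE[OF a] by blast
  have g0: "affine_germ {1, -1} F (\<lambda>u. cdist \<Gamma> a (ch e 0) + ereal u)"
    unfolding affine_germ_def by (intro bexI[of _ 1] exI[of _ d0]) (auto simp: d0)
  have g1: "affine_germ {1, -1} F (\<lambda>u. min (cdist \<Gamma> a (ch e 0) + ereal u) (cdist \<Gamma> a (ch e (L e)) + (L e - ereal u)))"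
  proof (cases "L e")
    case (real l)
    have "ch e (L e) \<in> fin_points \<Gamma>" using lp real by (subst fin_chart[OF e]) auto
    then obtain d1 where d1: "cdist \<Gamma> a (ch e (L e)) = ereal d1" using cdist_realE[OF a] by blast
    have "affine_germ {1, -1} F (\<lambda>u. cdist \<Gamma> a (ch e (L e)) + (L e - ereal u))"
      unfolding affine_germ_def by (intro bexI[of _ "-1"] exI[of _ "d1 + l"]) (auto simp: d1[unfolded real] real)
    then show ?thesis by (intro affine_germ_max affine_germ_min[OF F lp] g0)
  next
    case PInf
    then have "(\<lambda>u. min (cdist \<Gamma> a (ch e 0) + ereal u) (cdist \<Gamma> a (ch e (L e)) + (L e - ereal u))) =
       (\<lambda>u. cdist \<Gamma> a (ch e 0) + ereal u)" by auto
    then show ?thesis using g0 by simp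
  qed (use lp in auto)
  have ins: "eventually (\<lambda>u. ereal u \<in> {0..L e}) F"
    using edge_filter_inside[OF F lp] by (rule eventually_mono) auto
  show ?thesis
  proof (cases "a \<in> ch e ` {0<..<L e}")
    case False
    show ?thesis by (rule affine_germ_cong[OF g1], rule eventually_mono[OF ins])
        (use cdist_outside[OF e a False] in simp)
  next
    case True
    then obtain s where s: "s \<in> {0<..<L e}" "a = ch e s" by blast
    then obtain r where r: "s = ereal r" by (cases s) auto
    have g: "affine_germ {1, -1} F (\<lambda>u. min (min (cdist \<Gamma> a (ch e 0) + ereal u) (cdist \<Gamma> a (ch e (L e)) + (L e - ereal u))) \<bar>s - ereal u\<bar>)"
      unfolding r by (intro affine_germ_min[OF F lp] g1 affine_germ_abs_diff[OF F lp])
    show ?thesis by (rule affine_germ_cong[OF g], rule eventually_mono[OF ins])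
       (use cdist_same_edge[OF e s(1) _ s(2)] in \<open>simp add: min.assoc\<close>)
  qed
qed

lemma rat_cdist:
  assumes "a \<in> fin_points \<Gamma>" shows "rat (\<lambda>x\<in>points \<Gamma>. cdist \<Gamma> a x)"
proof (rule rat_restrictI)
  fix e F assume e: "e \<in> E" and "F \<in> edge_filters (L e)"
  then show "affine_germ UNIV F (\<lambda>u. cdist \<Gamma> a (ch e (ereal u)))"
    using cdist_chart_germ[OF e assms] affine_germ_mono subset_UNIV by blast
next
  fix x assume "x \<in> fin_points \<Gamma>"
  then obtain d where "cdist \<Gamma> a x = ereal d" using cdist_realE[OF assms] by blast
  then show "\<bar>cdist \<Gamma> a x\<bar> \<noteq> \<infinity>" by simp
qed (rule cdist_chart_continuous[OF _ assms])

lemma CF_point: "CF \<Gamma> {a} l = (\<lambda>x\<in>points \<Gamma>. - min l (cdist \<Gamma> a x))"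
  unfolding CF_def by (simp add: cdist_sym[of _ a])

lemma rat_CF_inf:
  assumes "a \<in> fin_points \<Gamma>" shows "rat (CF \<Gamma> {a} \<infinity>)"
proof -
  have "CF \<Gamma> {a} \<infinity> = (\<lambda>x\<in>points \<Gamma>. - (\<lambda>x\<in>points \<Gamma>. cdist \<Gamma> a x) x)"
    by (rule ext) (simp add: CF_point)
  then show ?thesis using rat_uminus[OF rat_cdist[OF assms]] by simp
qed

lemma bounded_rat_CF:
  assumes "a \<in> fin_points \<Gamma>" "0 < \<epsilon>" shows "bounded_rat (CF \<Gamma> {a} (ereal \<epsilon>))"
proof -
  have "CF \<Gamma> {a} (ereal \<epsilon>) =
      (\<lambda>x\<in>points \<Gamma>. - (\<lambda>x\<in>points \<Gamma>. min (const_fun \<Gamma> (ereal \<epsilon>) x) ((\<lambda>x\<in>points \<Gamma>. cdist \<Gamma> a x) x)) x)"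
    by (rule ext) (simp add: CF_point const_fun_def)
  then have "rat (CF \<Gamma> {a} (ereal \<epsilon>))"
    using rat_uminus[OF rat_min[OF rat_const[of \<epsilon>] rat_cdist[OF assms(1)]]] by simp
  moreover have "- ereal \<epsilon> \<le> CF \<Gamma> {a} (ereal \<epsilon>) x \<and> CF \<Gamma> {a} (ereal \<epsilon>) x \<le> ereal \<epsilon>" if "x \<in> points \<Gamma>" for x
    using that cdist_nonneg[of a x] assms(2) by (cases "cdist \<Gamma> a x") (auto simp: CF_point min_def)
  ultimately show ?thesis unfolding bounded_rat_def by (intro conjI exI[of _ \<epsilon>]) simp_all
qed

end

section \<open>Neighbourhoods of a point at infinity\<close>

context curve begin

text \<open>
  The half-open segment from the coordinate \<open>s\<close> to the point at infinity of a ray \<open>e\<close>.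
\<close>
definition tail :: "'a set \<Rightarrow> real \<Rightarrow> 'a set" where
  "tail e s = ch e ` {ereal s<..\<infinity>}"

text \<open>
  The distance to the complement of the tail: every path out of the tail passes through its starting point
  (\<open>INF_tail_complement\<close>).
\<close>
definition tail_dist :: "'a set \<Rightarrow> real \<Rightarrow> 'a \<Rightarrow> ereal" where
  "tail_dist e s z = (if z \<in> tail e s then cdist \<Gamma> (ch e (ereal s)) z else 0)"

lemma tail_chart:
  assumes e: "e \<in> E" "L e = \<infinity>" and s: "0 \<le> s" and e': "e' \<in> E" and t: "t \<in> {0..L e'}"
  shows "ch e' t \<in> tail e s \<longleftrightarrow> e' = e \<and> ereal s < t"
proof
  assume "ch e' t \<in> tail e s"
  then obtain u where u: "ereal s < u" "ch e' t = ch e u" by (auto simp: tail_def)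
  have "e' = e \<and> t = u"
  proof (cases "u = \<infinity>")
    case True
    then show ?thesis using infinity_unique[OF e e' t] u by simp
  next
    case False
    then have "u \<in> {0<..<L e}" using u(1) s e(2) le_less_trans[of 0 "ereal s" u] by simp
    then show ?thesis using interior_unique[OF e(1) _ e' t] u(2) by simp
  qed
  then show "e' = e \<and> ereal s < t" using u(1) by simp
next
  assume "e' = e \<and> ereal s < t"
  then show "ch e' t \<in> tail e s" using t e(2) by (simp add: tail_def)
qed

lemma tail_subset:
  assumes e: "e \<in> E" "L e = \<infinity>" and s: "0 \<le> s"
  shows "tail e s \<subseteq> points \<Gamma>"
proof
  fix x assume "x \<in> tail e s"
  then obtain u where u: "ereal s < u" "x = ch e u" by (auto simp: tail_def)
  then have "u \<in> {0..L e}" using s e(2) le_less_trans[of 0 "ereal s" u] by simp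
  then show "x \<in> points \<Gamma>" using chart_in_points[OF e(1)] u(2) by simp
qed

lemma tail_start:
  assumes e: "e \<in> E" "L e = \<infinity>" and s: "0 \<le> s"
  shows "ch e (ereal s) \<in> fin_points \<Gamma>" "ch e (ereal s) \<notin> tail e s"
  using fin_chart_real[OF e(1) s] tail_chart[OF e s e(1), of "ereal s"] s e(2) by simp_all

lemma openin_tail:
  assumes e: "e \<in> E" "L e = \<infinity>" and s: "0 \<le> s"
  shows "openin top_curve (tail e s)"
  unfolding openin_curve_topology
proof (intro conjI ballI tail_subset[OF assms])
  fix e' assume e': "e' \<in> E"
  have "{t \<in> {0..L e'}. ch e' t \<in> tail e s} = {0..L e'} \<inter> (if e' = e then {ereal s<..} else {})"
    using tail_chart[OF assms e'] by auto
  then show "openin (top_of_set {0..L e'}) {t \<in> {0..L e'}. ch e' t \<in> tail e s}"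
    by (auto intro: openin_open_Int)
qed

lemma fibre_finite:
  assumes e: "e \<in> E" shows "finite {t \<in> {0..L e}. ch e t = x}"
proof -
  have "finite (ch e -` {x} \<inter> {0<..<L e})"
    using inj_interior[OF e] by (intro finite_vimage_IntI) auto
  moreover have "{t \<in> {0..L e}. ch e t = x} \<subseteq> {0, L e} \<union> (ch e -` {x} \<inter> {0<..<L e})"
    by (auto simp: order_less_le)
  ultimately show ?thesis by (meson finite.emptyI finite.insertI finite_UnI finite_subset)
qed

lemma openin_tail_outside:
  assumes e: "e \<in> E" "L e = \<infinity>" and s: "0 \<le> s"
  shows "openin top_curve (points \<Gamma> - tail e s - {ch e (ereal s)})"
  unfolding openin_curve_topology
proof (intro conjI ballI)
  fix e' assume e': "e' \<in> E"
  let ?S = "{t \<in> {0..L e'}. ch e' t \<in> points \<Gamma> - tail e s - {ch e (ereal s)}}"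
  show "openin (top_of_set {0..L e'}) ?S"
  proof (cases "e' = e")
    case True
    have "t \<in> ?S \<longleftrightarrow> t \<in> {0..L e'} \<inter> {..<ereal s}" for t
    proof
      assume t: "t \<in> ?S"
      then have "\<not> ereal s < t" "t \<noteq> ereal s" using tail_chart[OF assms e', of t] True by auto
      then show "t \<in> {0..L e'} \<inter> {..<ereal s}" using t by simp
    next
      assume t: "t \<in> {0..L e'} \<inter> {..<ereal s}"
      then have s0: "ereal s \<in> {0<..<L e}" using e(2) le_less_trans[of 0 t "ereal s"] by simp
      have "ch e' t \<noteq> ch e (ereal s)"
        using interior_unique[OF e(1) s0 e', of t] t by auto
      then show "t \<in> ?S" using t tail_chart[OF assms e', of t] chart_in_points[OF e', of t] by auto
    qed
    then have "?S = {0..L e'} \<inter> {..<ereal s}" by blast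
    then show ?thesis by (simp add: openin_open_Int)
  next
    case False
    have "?S = {0..L e'} \<inter> - {t \<in> {0..L e'}. ch e' t = ch e (ereal s)}"
      using False tail_chart[OF assms e'] chart_in_points[OF e'] by auto
    then show ?thesis
      using finite_imp_closed[OF fibre_finite[OF e']] by (simp only:) (intro openin_open_Int open_Compl)
  qed
qed blast

lemma connectedin_chart:
  assumes "e \<in> E" "connected S" "S \<subseteq> {0..L e}"
  shows "connectedin top_curve (ch e ` S)"
  by (rule connectedin_continuous_map_image[OF continuous_chart[OF assms(1)]])
    (use assms in \<open>simp add: connectedin_subtopology\<close>)

lemma connectedin_tail:
  assumes e: "e \<in> E" "L e = \<infinity>" and s: "0 \<le> s"
  shows "connectedin top_curve (tail e s)"
proof -
  have "{ereal s<..\<infinity>} \<subseteq> {0..L e}"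
  proof
    fix u assume "u \<in> {ereal s<..\<infinity>}"
    then show "u \<in> {0..L e}" using s e(2) le_less_trans[of 0 "ereal s" u] by simp
  qed
  then show ?thesis unfolding tail_def by (intro connectedin_chart e(1)) simp_all
qed

text \<open>
  Removing its starting point separates the tail from the rest of the curve.
\<close>
lemma connectedin_tail_cases:
  assumes e: "e \<in> E" "L e = \<infinity>" and s: "0 \<le> s"
    and C: "connectedin top_curve C" "ch e (ereal s) \<notin> C"
  shows "C \<subseteq> tail e s \<or> C \<inter> tail e s = {}"
proof (rule ccontr)
  assume "\<not> ?thesis"
  then have ne: "\<not> C \<subseteq> tail e s" "C \<inter> tail e s \<noteq> {}" by auto
  have Cp: "C \<subseteq> points \<Gamma>" using connectedin_subset_topspace[OF C(1)] topspace_curve by simp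
  let ?T = "tail e s" and ?R = "points \<Gamma> - tail e s - {ch e (ereal s)}"
  show False
  proof (rule connectedinD[OF C(1) openin_tail[OF e s] openin_tail_outside[OF e s]])
    show "C \<subseteq> ?T \<union> ?R" using Cp C(2) by blast
    show "?T \<inter> ?R \<inter> C = {}" by blast
    show "?T \<inter> C \<noteq> {}" using ne by blast
    show "?R \<inter> C \<noteq> {}" using ne Cp C(2) by blast
  qed
qed

lemma continuous_tail_dist:
  assumes e: "e \<in> E" "L e = \<infinity>" and s: "0 \<le> s"
  shows "continuous_map top_curve euclidean (tail_dist e s)"
  unfolding continuous_curve_euclidean
proof
  fix e' assume e': "e' \<in> E"
  let ?y = "ch e (ereal s)"
  show "continuous_on {0..L e'} (\<lambda>t. tail_dist e s (ch e' t))"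
  proof (cases "e' = e")
    case False
    have "continuous_on {0..L e'} (\<lambda>t. 0::ereal)" by (rule continuous_on_const)
    then show ?thesis
      by (rule continuous_on_eq) (use False tail_chart[OF assms e'] in \<open>simp add: tail_dist_def\<close>)
  next
    case True
    have self: "cdist \<Gamma> ?y ?y = 0" using tail_start[OF assms] fin_subset by (intro cdist_self) auto
    have "continuous_on ({0..ereal s} \<union> {ereal s..\<infinity>}) (\<lambda>t. if t \<le> ereal s then 0 else cdist \<Gamma> ?y (ch e t))"
    proof (rule continuous_on_cases)
      show "continuous_on {ereal s..\<infinity>} (\<lambda>t. cdist \<Gamma> ?y (ch e t))"
        by (rule continuous_on_subset[OF cdist_chart_continuous[OF e(1) tail_start(1)[OF assms]]])
          (use s e(2) in \<open>auto intro: order_trans\<close>)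
      show "\<forall>x. x \<in> {0..ereal s} \<and> \<not> x \<le> ereal s \<or> x \<in> {ereal s..\<infinity>} \<and> x \<le> ereal s \<longrightarrow> 0 = cdist \<Gamma> ?y (ch e x)"
        using self by auto
    qed simp_all
    moreover have "{0..ereal s} \<union> {ereal s..\<infinity>} = {0..L e'}"
      using s e(2) True by (simp add: ivl_disj_un)
    ultimately have "continuous_on {0..L e'} (\<lambda>t. if t \<le> ereal s then 0 else cdist \<Gamma> ?y (ch e t))" by simp
    then show ?thesis
    proof (rule continuous_on_eq)
      fix t assume "t \<in> {0..L e'}"
      then show "(if t \<le> ereal s then 0 else cdist \<Gamma> ?y (ch e t)) = tail_dist e s (ch e' t)"
        using tail_chart[OF assms e', of t] True by (simp add: tail_dist_def linorder_not_less[symmetric])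
    qed
  qed
qed

lemma tail_dist_lipschitz:
  assumes e: "e \<in> E" "L e = \<infinity>" and s: "0 \<le> s" and e': "e' \<in> E" and u: "u \<in> {0..L e'}" and v: "v \<in> {0..L e'}"
  shows "tail_dist e s (ch e' v) \<le> tail_dist e s (ch e' u) + \<bar>u - v\<bar>"
proof -
  let ?y = "ch e (ereal s)"
  note m = tail_chart[OF e s e' u] tail_chart[OF e s e' v]
  have ys: "cdist \<Gamma> ?y ?y = 0" using tail_start[OF e s] fin_subset by (intro cdist_self) auto
  consider "ch e' v \<notin> tail e s" | "ch e' v \<in> tail e s" "ch e' u \<in> tail e s"
    | "ch e' v \<in> tail e s" "ch e' u \<notin> tail e s" by blast
  then show ?thesis
  proof cases
    case 1
    then have "tail_dist e s (ch e' v) = 0" by (simp add: tail_dist_def)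
    moreover have "0 \<le> tail_dist e s (ch e' u)" by (simp add: tail_dist_def cdist_nonneg)
    ultimately show ?thesis by simp
  next
    case 2
    then show ?thesis using cdist_segment_le[OF e' u v, of ?y] by (simp add: tail_dist_def)
  next
    case 3
    then have v': "e' = e" "ereal s < v" "u \<le> ereal s" using m by auto
    have "ereal s \<in> {0..L e}" using s e(2) by simp
    then have "cdist \<Gamma> ?y (ch e' v) \<le> 0 + \<bar>ereal s - v\<bar>"
      using cdist_segment_le[OF e(1) _ , of "ereal s" v ?y] v v' ys by simp
    also have "\<dots> \<le> \<bar>u - v\<bar>" using v' u by (cases u; cases v) auto
    finally show ?thesis using 3 by (simp add: tail_dist_def)
  qed
qed

lemma INF_tail_complement:
  assumes e: "e \<in> E" "L e = \<infinity>" and s: "0 \<le> s" and z: "z \<in> points \<Gamma>"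
  shows "(INF w\<in>points \<Gamma> - tail e s. cdist \<Gamma> z w) = tail_dist e s z"
proof (rule antisym)
  let ?y = "ch e (ereal s)"
  have y: "?y \<in> points \<Gamma> - tail e s" using tail_start[OF e s] fin_subset by auto
  show "(INF w\<in>points \<Gamma> - tail e s. cdist \<Gamma> z w) \<le> tail_dist e s z"
  proof (cases "z \<in> tail e s")
    case True
    have "(INF w\<in>points \<Gamma> - tail e s. cdist \<Gamma> z w) \<le> cdist \<Gamma> z ?y" using y by (rule INF_lower)
    then show ?thesis using True by (simp add: tail_dist_def cdist_sym[of z])
  next
    case False
    have "(INF w\<in>points \<Gamma> - tail e s. cdist \<Gamma> z w) \<le> cdist \<Gamma> z z" using z False by (intro INF_lower) simp
    then show ?thesis using False z by (simp add: tail_dist_def cdist_self)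
  qed
  show "tail_dist e s z \<le> (INF w\<in>points \<Gamma> - tail e s. cdist \<Gamma> z w)"
  proof (rule INF_greatest)
    fix w assume "w \<in> points \<Gamma> - tail e s"
    then have "tail_dist e s w = 0" by (simp add: tail_dist_def)
    then have "tail_dist e s z \<le> cdist \<Gamma> w z"
      using tail_dist_lipschitz[OF e s] by (intro lipschitz_cdist[of "tail_dist e s"])
    then show "tail_dist e s z \<le> cdist \<Gamma> z w" by (simp add: cdist_sym)
  qed
qed

lemma tail_dist_infinite:
  assumes e: "e \<in> E" "L e = \<infinity>" and s: "0 \<le> s" and z: "z \<in> points \<Gamma>"
  shows "tail_dist e s z = \<infinity> \<longleftrightarrow> z = ch e \<infinity>"
proof
  assume *: "tail_dist e s z = \<infinity>"
  then have zt: "z \<in> tail e s" and zd: "cdist \<Gamma> (ch e (ereal s)) z = \<infinity>"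
    by (auto simp: tail_dist_def split: if_splits)
  have "z \<notin> fin_points \<Gamma>" using cdist_finite[OF tail_start(1)[OF e s], of z] zd by auto
  obtain u where u: "ereal s < u" "z = ch e u" using zt by (auto simp: tail_def)
  then have "u \<in> {0..L e}" using s e(2) le_less_trans[of 0 "ereal s" u] by simp
  then show "z = ch e \<infinity>" using fin_chart[OF e(1)] \<open>z \<notin> fin_points \<Gamma>\<close> u(2) by auto
next
  assume z: "z = ch e \<infinity>"
  have "cdist \<Gamma> (ch e (ereal s)) z = \<infinity>"
    using tail_start[OF e s] inf_pointI[OF e] fin_subset inf_subset
    by (intro cdist_infinity) (auto simp: z fin_points_def)
  moreover have "z \<in> tail e s" using z by (auto simp: tail_def)
  ultimately show "tail_dist e s z = \<infinity>" by (simp add: tail_dist_def)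
qed

lemma edge_at_infinity:
  assumes x: "x \<in> inf_points \<Gamma>" and e: "e \<in> E" "x \<in> e"
  shows "L e = \<infinity>" "x = ch e \<infinity>"
proof -
  obtain t where t: "t \<in> {0..L e}" "x = ch e t" using e chart_image by blast
  then have "t = \<infinity>" using inf_points_chart[OF e(1)] x by simp
  then show "L e = \<infinity>" "x = ch e \<infinity>" using t by auto
qed

lemma half_open_segment_tail:
  assumes e: "e \<in> E" "L e = \<infinity>" and s: "0 \<le> s"
  shows "half_open_segment \<Gamma> e (ch e (ereal s)) (ch e \<infinity>) = tail e s"
proof
  show "tail e s \<subseteq> half_open_segment \<Gamma> e (ch e (ereal s)) (ch e \<infinity>)"
  proof
    fix x assume "x \<in> tail e s"
    then obtain u where u: "ereal s < u" "x = ch e u" by (auto simp: tail_def)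
    show "x \<in> half_open_segment \<Gamma> e (ch e (ereal s)) (ch e \<infinity>)"
      unfolding half_open_segment_def
      by (rule CollectI, rule exI[of _ "ereal s"], rule exI[of _ u], rule exI[of _ \<infinity>]) (use u s e in simp)
  qed
  show "half_open_segment \<Gamma> e (ch e (ereal s)) (ch e \<infinity>) \<subseteq> tail e s"
  proof
    fix x assume "x \<in> half_open_segment \<Gamma> e (ch e (ereal s)) (ch e \<infinity>)"
    then obtain s' u t where st: "0 \<le> s'" "s' < u" "u \<le> t" "ch e s' = ch e (ereal s)" "x = ch e u"
      unfolding half_open_segment_def by blast
    have s': "s' \<in> {0..L e}" using st(1) e(2) by simp
    have "\<not> s' < ereal s"
    proof
      assume *: "s' < ereal s"
      then have "ereal s \<in> {0<..<L e}" using le_less_trans[OF st(1) *] e(2) by simp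
      from interior_unique[OF e(1) this e(1) s'] st(4) have "s' = ereal s" by simp
      with * show False by simp
    qed
    then have "ereal s < u" using st(2) by (meson le_less_trans not_less)
    then show "x \<in> tail e s" using st(5) by (simp add: tail_def)
  qed
qed

lemma finite_point_on_ray:
  assumes e: "e \<in> E" "L e = \<infinity>" and y: "y \<in> e" "y \<in> fin_points \<Gamma>"
  obtains s where "0 \<le> s" "y = ch e (ereal s)"
proof -
  obtain t where t: "t \<in> {0..L e}" "y = ch e t" using e y chart_image by blast
  then have "t \<noteq> \<infinity>" using fin_chart[OF e(1)] y by simp
  then show ?thesis using t that by (cases t) auto
qed

lemma tail_neighbourhood:
  assumes e: "e \<in> E" "L e = \<infinity>" and U: "openin top_curve U" "ch e \<infinity> \<in> U"
  obtains s where "0 \<le> s" "tail e s \<subseteq> U"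
proof -
  have "openin (top_of_set {0..L e}) {t \<in> {0..L e}. ch e t \<in> U}"
    using U(1) e(1) unfolding openin_curve_topology by simp
  then obtain W where "open W" "{t \<in> {0..L e}. ch e t \<in> U} = {0..L e} \<inter> W"
    unfolding openin_open by (elim exE conjE)
  then have W: "open W" "{t \<in> {0..\<infinity>}. ch e t \<in> U} = {0..\<infinity>} \<inter> W" unfolding e(2) .
  have "\<infinity> \<in> {t \<in> {0..\<infinity>}. ch e t \<in> U}" using U(2) by simp
  then have "\<infinity> \<in> W" using W(2) by blast
  then obtain r where r: "{ereal r<..} \<subseteq> W" using W(1) open_PInfty by metis
  have "tail e (max r 0) \<subseteq> U"
  proof
    fix x assume "x \<in> tail e (max r 0)"
    then obtain u where u: "ereal (max r 0) < u" "x = ch e u" by (auto simp: tail_def)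
    have "ereal r < u" using le_less_trans[OF _ u(1), of "ereal r"] by simp
    moreover have "ereal 0 \<le> ereal (max r 0)" by (simp only: ereal_less_eq(3) max.cobounded2)
    then have "0 \<le> u" using u(1) by (simp only: zero_ereal_def)
    ultimately have "u \<in> {0..\<infinity>} \<inter> W" using r by auto
    then show "x \<in> U" using W(2) u(2) by blast
  qed
  then show ?thesis by (intro that[of "max r 0"]) auto
qed

end

locale curve_model = curve \<Gamma> + M: curve M for \<Gamma> M :: "'a curve" +
  assumes model: "model_for \<Gamma> M"
begin

lemma same_points: "points M = points \<Gamma>"
  using model topspace_curve M.topspace_curve by (simp add: model_for_def)

lemma same_topology: "curve_topology M = curve_topology \<Gamma>"
  and same_inf: "inf_points M = inf_points \<Gamma>"
  and same_cdist: "x \<in> points \<Gamma> \<Longrightarrow> y \<in> points \<Gamma> \<Longrightarrow> cdist M x y = cdist \<Gamma> x y"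
  using model by (auto simp: model_for_def)

lemma same_fin: "fin_points M = fin_points \<Gamma>"
  by (simp add: fin_points_def same_points same_inf)

lemma CF_model: "A \<subseteq> points \<Gamma> \<Longrightarrow> CF \<Gamma> A l = CF M A l"
  unfolding CF_def same_points
  by (rule restrict_ext) (auto intro!: arg_cong[where f = "\<lambda>x. - min l x"] INF_cong simp: same_cdist subset_eq)

lemma CF_tail:
  assumes e: "e \<in> edges M" "len M e = \<infinity>" and s: "0 \<le> s"
  shows "CF \<Gamma> (points \<Gamma> - M.tail e s) \<infinity> = (\<lambda>x\<in>points \<Gamma>. - M.tail_dist e s x)"
proof -
  have "CF \<Gamma> (points \<Gamma> - M.tail e s) \<infinity> = CF M (points \<Gamma> - M.tail e s) \<infinity>" by (rule CF_model) blast
  also have "\<dots> = (\<lambda>x\<in>points \<Gamma>. - M.tail_dist e s x)"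
    unfolding CF_def same_points
    by (rule restrict_ext) (use M.INF_tail_complement[OF e s] same_points in simp)
  finally show ?thesis .
qed

text \<open>
  The tail belongs to an edge of the model \<open>M\<close>, whereas rationality refers to the edges of \<open>\<Gamma>\<close>, which may be cut up
  differently. An interval of an edge of \<open>\<Gamma>\<close> that avoids the starting point of the tail is connected, so it lies on one
  side of that point; there the function is the distance to this point, or zero.
\<close>
lemma rat_CF_tail:
  assumes e: "e \<in> edges M" "len M e = \<infinity>" and s: "0 \<le> s"
  shows "rat (CF \<Gamma> (points \<Gamma> - M.tail e s) \<infinity>)"
proof -
  let ?y = "chart M e (ereal s)"
  have y: "?y \<in> fin_points \<Gamma>" using M.tail_start(1)[OF e s] same_fin by simp
  have "rat (restrict (M.tail_dist e s) (points \<Gamma>))"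
  proof (rule rat_restrictI)
    fix e0 assume e0: "e0 \<in> E"
    have "continuous_map top_curve euclidean (M.tail_dist e s)"
      using M.continuous_tail_dist[OF e s] same_topology by simp
    then show "continuous_on {0..L e0} (\<lambda>t. M.tail_dist e s (ch e0 t))"
      using e0 unfolding continuous_curve_euclidean by simp
    fix F assume F: "F \<in> edge_filters (L e0)"
    define S where "S = ereal -` {t \<in> {0..L e0}. ch e0 t = ?y}"
    have "finite S" unfolding S_def by (intro finite_vimageI fibre_finite e0) simp
    from edge_filter_interval[OF F this len_pos[OF e0]] obtain a b where ab: "0 \<le> a" "a < b" "b \<le> L e0"
      "\<forall>u\<in>S. \<not> (a < ereal u \<and> ereal u < b)" "eventually (\<lambda>u. a < ereal u \<and> ereal u < b) F" by blast
    have sub: "{a<..<b} \<subseteq> {0..L e0}"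
      using ab(1,3) by (auto intro: less_imp_le le_less_trans less_le_trans)
    have C: "connectedin (curve_topology M) (ch e0 ` {a<..<b})"
      unfolding same_topology by (rule connectedin_chart[OF e0 _ sub]) simp
    have nC: "?y \<notin> ch e0 ` {a<..<b}"
    proof
      assume "?y \<in> ch e0 ` {a<..<b}"
      then obtain t where t: "a < t" "t < b" "ch e0 t = ?y" by auto
      then obtain r where r: "t = ereal r" using ab(1) by (cases t) auto
      have "t \<in> {0..L e0}" using t sub by auto
      then have "r \<in> S" using t(3) r by (simp add: S_def)
      then show False using ab(4) t r by blast
    qed
    from M.connectedin_tail_cases[OF e s C nC]
    show "affine_germ UNIV F (\<lambda>u. M.tail_dist e s (ch e0 (ereal u)))"
    proof
      assume *: "ch e0 ` {a<..<b} \<subseteq> M.tail e s"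
      have "affine_germ UNIV F (\<lambda>u. cdist \<Gamma> ?y (ch e0 (ereal u)))"
        by (rule affine_germ_mono[OF cdist_chart_germ[OF e0 y F]]) simp
      then show ?thesis
      proof (rule affine_germ_cong)
        show "eventually (\<lambda>u. cdist \<Gamma> ?y (ch e0 (ereal u)) = M.tail_dist e s (ch e0 (ereal u))) F"
          using ab(5)
        proof eventually_elim
          case (elim u)
          then have "ch e0 (ereal u) \<in> M.tail e s" using * by auto
          moreover have "ch e0 (ereal u) \<in> points \<Gamma>" using elim sub by (intro chart_in_points[OF e0]) auto
          ultimately show ?case using y fin_subset by (auto simp: M.tail_dist_def same_cdist)
        qed
      qed
    next
      assume *: "ch e0 ` {a<..<b} \<inter> M.tail e s = {}"
      have "affine_germ UNIV F (\<lambda>u. ereal 0)" by (rule affine_germ_const) simp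
      then show ?thesis
      proof (rule affine_germ_cong)
        show "eventually (\<lambda>u. ereal 0 = M.tail_dist e s (ch e0 (ereal u))) F"
          using ab(5)
        proof eventually_elim
          case (elim u)
          then have "ch e0 (ereal u) \<in> ch e0 ` {a<..<b}" by simp
          then have "ch e0 (ereal u) \<notin> M.tail e s" using * by blast
          then show ?case by (simp add: M.tail_dist_def)
        qed
      qed
    qed
  next
    fix x assume x: "x \<in> fin_points \<Gamma>"
    then have xp: "x \<in> points M" using fin_subset same_points by auto
    have "x \<noteq> chart M e \<infinity>" using x M.inf_pointI[OF e] same_inf by (auto simp: fin_points_def)
    then have "M.tail_dist e s x \<noteq> \<infinity>" using M.tail_dist_infinite[OF e s xp] by simp
    moreover have "0 \<le> M.tail_dist e s x" by (simp add: M.tail_dist_def M.cdist_nonneg)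
    ultimately show "\<bar>M.tail_dist e s x\<bar> \<noteq> \<infinity>" by (cases "M.tail_dist e s x") auto
  qed
  from rat_uminus[OF this] have "rat (\<lambda>x\<in>points \<Gamma>. - restrict (M.tail_dist e s) (points \<Gamma>) x)" .
  moreover have "(\<lambda>x\<in>points \<Gamma>. - restrict (M.tail_dist e s) (points \<Gamma>) x) = (\<lambda>x\<in>points \<Gamma>. - M.tail_dist e s x)"
    by (rule ext) simp
  ultimately show ?thesis using CF_tail[OF e s] by simp
qed

end

section \<open>Bounded rational functions separate points\<close>

lemma const_fun_apply [simp]: "x \<in> points \<Gamma> \<Longrightarrow> const_fun \<Gamma> c x = c"
  by (simp add: const_fun_def)

lemma curve_model_refl: "curve \<Gamma> \<Longrightarrow> curve_model \<Gamma> \<Gamma>"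
  unfolding curve_model_def curve_model_axioms_def model_for_def curve_def by simp

context curve begin

text \<open>
  A finite point \<open>a\<close> is the only zero of its chip-firing move. Two points at infinity are not told apart by distances to
  finite points, but one of them has a tail that does not contain the other.
\<close>
lemma bounded_rat_separates:
  assumes x: "x \<in> points \<Gamma>" and y: "y \<in> points \<Gamma>" and "x \<noteq> y"
  obtains f where "bounded_rat f" "f x \<noteq> f y"
proof -
  have sep: "CF \<Gamma> {a} (ereal 1) a \<noteq> CF \<Gamma> {a} (ereal 1) b" if "a \<in> fin_points \<Gamma>" "b \<in> points \<Gamma>" "b \<noteq> a" for a b
  proof -
    have a: "a \<in> points \<Gamma>" using that fin_subset by blast
    have "0 < cdist \<Gamma> a b" by (rule cdist_positive[OF a that(2,3)])
    then show ?thesis using a that(2) cdist_self[OF a] by (auto simp: CF_point min_def)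
  qed
  consider "x \<in> fin_points \<Gamma>" | "y \<in> fin_points \<Gamma>" | "x \<in> inf_points \<Gamma>" "y \<in> inf_points \<Gamma>"
    using x y by (auto simp: fin_points_def)
  then show ?thesis
  proof cases
    case 1
    then show ?thesis using that[OF bounded_rat_CF[OF 1, of 1]] sep[OF 1 y] assms(3) by simp
  next
    case 2
    then show ?thesis using that[OF bounded_rat_CF[OF 2, of 1]] sep[OF 2 x] assms(3) by simp
  next
    case 3
    interpret S: curve_model \<Gamma> \<Gamma> by (rule curve_model_refl) (unfold_locales)
    obtain e where e: "e \<in> E" "L e = \<infinity>" "x = ch e \<infinity>" using 3(1) by (rule inf_pointE)
    define f where "f = CF \<Gamma> (points \<Gamma> - tail e 0) \<infinity>"
    have f: "rat f" unfolding f_def by (rule S.rat_CF_tail[OF e(1,2) order_refl])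
    have fv: "f z = - tail_dist e 0 z" if "z \<in> points \<Gamma>" for z
      using S.CF_tail[OF e(1,2) order_refl] that by (simp add: f_def)
    define g where "g = (\<lambda>z\<in>points \<Gamma>. max (f z) (const_fun \<Gamma> (ereal (-1)) z))"
    have gv: "g z = max (- tail_dist e 0 z) (ereal (- 1))" if "z \<in> points \<Gamma>" for z
      using that fv by (simp add: g_def const_fun_def)
    have "bounded_rat g"
    proof -
      have "rat g" unfolding g_def by (rule rat_max[OF f rat_const])
      moreover have "- ereal 1 \<le> g z \<and> g z \<le> ereal 1" if "z \<in> points \<Gamma>" for z
      proof -
        have "0 \<le> tail_dist e 0 z" by (simp add: tail_dist_def cdist_nonneg)
        then show ?thesis using gv[OF that] by (cases "tail_dist e 0 z") (auto simp: max_def)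
      qed
      ultimately show ?thesis unfolding bounded_rat_def by (intro conjI exI[of _ 1]) simp_all
    qed
    moreover have "tail_dist e 0 x = \<infinity>" using tail_dist_infinite[OF e(1,2) order_refl x] e(3) by simp
    then have "g x = ereal (- 1)" using gv[OF x] by (simp add: max_def)
    moreover have "y \<notin> tail e 0"
    proof
      assume "y \<in> tail e 0"
      moreover obtain e' where e': "e' \<in> E" "L e' = \<infinity>" "y = ch e' \<infinity>" using 3(2) by (rule inf_pointE)
      ultimately have "e' = e" using tail_chart[OF e(1,2) order_refl e'(1), of \<infinity>] by simp
      then show False using e(3) e'(3) assms(3) by simp
    qed
    then have "g y = 0" using gv[OF y] by (simp add: tail_dist_def max_def)
    ultimately show ?thesis using that[of g] by simp
  qed
qed

end

section \<open>Semiring isomorphisms are scaled substitutions\<close>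

text \<open>
  On integers additivity suffices. For a real number \<open>x\<close>, enclose \<open>n * x\<close> between consecutive integers: the error is at
  most \<open>f 1\<close>, hence at most \<open>f 1 / n\<close> for \<open>x\<close> itself.
\<close>
lemma additive_mono_imp_linear:
  fixes f :: "real \<Rightarrow> real"
  assumes add: "\<And>x y. f (x + y) = f x + f y" and mono: "\<And>x y. x \<le> y \<Longrightarrow> f x \<le> f y"
  shows "f x = f 1 * x"
proof -
  have f0: "f 0 = 0" using add[of 0 0] by simp
  have minus: "f (- x) = - f x" for x using add[of x "- x"] f0 by simp
  have nat: "f (real n * x) = real n * f x" for n x
    by (induction n) (simp_all add: f0 add algebra_simps)
  have int: "f (of_int k) = f 1 * of_int k" for k
  proof (cases "0 \<le> k")
    case True
    then show ?thesis using nat[of "nat k" 1] by (simp add: mult.commute)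
  next
    case False
    then show ?thesis using nat[of "nat (- k)" 1] minus[of "of_int k"] by (simp add: mult.commute)
  qed
  have f1: "0 \<le> f 1" using mono[of 0 1] f0 by simp
  have "real n * \<bar>f x - f 1 * x\<bar> \<le> f 1" for n
  proof -
    define k where "k = \<lfloor>real n * x\<rfloor>"
    have k: "of_int k \<le> real n * x" "real n * x \<le> of_int (k + 1)"
      unfolding k_def by linarith+
    have "f 1 * of_int k \<le> real n * f x" "real n * f x \<le> f 1 * of_int (k + 1)"
      using mono[OF k(1)] mono[OF k(2)] unfolding int nat by auto
    moreover have "f 1 * of_int k \<le> f 1 * (real n * x)" "f 1 * (real n * x) \<le> f 1 * of_int (k + 1)"
      using k f1 by (auto intro: mult_left_mono)
    ultimately have "\<bar>real n * f x - f 1 * (real n * x)\<bar> \<le> f 1" by (simp add: algebra_simps abs_le_iff)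
    moreover have "real n * f x - f 1 * (real n * x) = real n * (f x - f 1 * x)" by (simp add: algebra_simps)
    ultimately show ?thesis by (simp add: abs_mult)
  qed
  moreover have "\<exists>n. f 1 < real n * \<bar>f x - f 1 * x\<bar>" if "f x \<noteq> f 1 * x"
    using reals_Archimedean3[of "\<bar>f x - f 1 * x\<bar>"] that by simp
  ultimately show ?thesis by (meson not_less)
qed

text \<open>
  An extended real is determined by its truncations, which is how statements on bounded functions pass to
  unbounded ones.
\<close>
lemma ereal_truncation_eqI:
  fixes a b :: ereal
  assumes "\<And>c. 0 < c \<Longrightarrow> min (max a (ereal (- c))) (ereal c) = min (max b (ereal (- c))) (ereal c)"
  shows "a = b"
proof -
  have fin: "min (max (ereal p) (ereal (- c))) (ereal c) = ereal p" if "\<bar>p\<bar> < c" for p c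
    using that by (auto simp: min_def max_def)
  have inf: "min (max \<infinity> (ereal (- c))) (ereal c) = ereal c" "min (max (- \<infinity>) (ereal (- c))) (ereal c) = ereal (- c)"
    if "0 < c" for c using that by (auto simp: min_def max_def)
  have pos: "0 < \<bar>p\<bar> + 1" for p :: real by linarith
  show ?thesis
  proof (cases a; cases b)
    fix p q assume "a = ereal p" "b = ereal q"
    then show ?thesis using assms[of "\<bar>p\<bar> + \<bar>q\<bar> + 1"] fin[of p "\<bar>p\<bar> + \<bar>q\<bar> + 1"] fin[of q "\<bar>p\<bar> + \<bar>q\<bar> + 1"] by simp
  next
    fix p assume "a = ereal p" "b = \<infinity>"
    then show ?thesis using assms[OF pos[of p]] fin[of p "\<bar>p\<bar> + 1"] inf[OF pos[of p]] by auto
  next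
    fix p assume "a = ereal p" "b = - \<infinity>"
    then show ?thesis using assms[OF pos[of p]] fin[of p "\<bar>p\<bar> + 1"] inf[OF pos[of p]] by auto
  next
    fix q assume "a = \<infinity>" "b = ereal q"
    then show ?thesis using assms[OF pos[of q]] fin[of q "\<bar>q\<bar> + 1"] inf[OF pos[of q]] by auto
  next
    fix q assume "a = - \<infinity>" "b = ereal q"
    then show ?thesis using assms[OF pos[of q]] fin[of q "\<bar>q\<bar> + 1"] inf[OF pos[of q]] by auto
  qed (use assms[of 1] inf[of 1] in simp_all)
qed

lemma affine_slope_unique:
  assumes F: "F \<in> edge_filters l" "0 < l"
    and ev: "eventually (\<lambda>u. p * u + q = p' * u + q') F"
  shows "p = (p' :: real)"
proof (rule ccontr)
  assume ne: "p \<noteq> p'"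
  have "finite {(q' - q) / (p - p')}" by simp
  from edge_filter_interval[OF F(1) this F(2)] obtain a b where ab: "0 \<le> a" "a < b" "b \<le> l"
    "\<forall>u\<in>{(q' - q) / (p - p')}. \<not> (a < ereal u \<and> ereal u < b)"
    "eventually (\<lambda>u. a < ereal u \<and> ereal u < b) F" by blast
  have "eventually (\<lambda>u. False) F" using ev ab(5)
  proof eventually_elim
    case (elim u)
    then have "u = (q' - q) / (p - p')" using ne by (simp add: field_simps)
    then show ?case using ab(4) elim(2) by simp
  qed
  then show False using edge_filter_not_bot[OF F(1)] by simp
qed

text \<open>
  The product is taken of bounded functions only, where it is the pointwise sum. The three conditions then pass to the
  inverse map (\<open>inverse_iso\<close>) by pointwise computations.
\<close>
locale rat_iso = A: curve \<Gamma>\<^sub>1 + B: curve \<Gamma>\<^sub>2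
  for \<Gamma>\<^sub>1 :: "'a curve" and \<Gamma>\<^sub>2 :: "'b curve" +
  fixes \<psi> :: "('a \<Rightarrow> ereal) \<Rightarrow> ('b \<Rightarrow> ereal)"
  assumes bij: "bij_betw \<psi> {f. A.rat f} {g. B.rat g}"
    and psi_add: "A.rat f \<Longrightarrow> A.rat g \<Longrightarrow> \<psi> (trop_add \<Gamma>\<^sub>1 f g) = trop_add \<Gamma>\<^sub>2 (\<psi> f) (\<psi> g)"
    and psi_mult: "A.bounded_rat f \<Longrightarrow> A.bounded_rat g \<Longrightarrow>
      \<psi> (trop_mult \<Gamma>\<^sub>1 f g) = trop_mult \<Gamma>\<^sub>2 (\<psi> f) (\<psi> g)"
begin

lemma psi_rat: "A.rat f \<Longrightarrow> B.rat (\<psi> f)"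
  using bij by (auto simp: bij_betw_def)

lemma psi_inj: "A.rat f \<Longrightarrow> A.rat g \<Longrightarrow> \<psi> f = \<psi> g \<Longrightarrow> f = g"
  using bij by (auto simp: bij_betw_def dest: inj_onD)

lemma psi_surj:
  assumes g: "B.rat g" obtains f where "A.rat f" "\<psi> f = g"
proof -
  have "g \<in> \<psi> ` {f. A.rat f}" using bij g by (simp add: bij_betw_def)
  then show ?thesis using that by blast
qed

lemma psi_max:
  assumes "A.rat f" "A.rat g" "x \<in> points \<Gamma>\<^sub>2"
  shows "\<psi> (\<lambda>x\<in>points \<Gamma>\<^sub>1. max (f x) (g x)) x = max (\<psi> f x) (\<psi> g x)"
  using psi_add[OF assms(1,2)] assms(3) by (simp add: trop_add_def)

lemma psi_le_iff:
  assumes f: "A.rat f" and g: "A.rat g"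
  shows "(\<forall>x\<in>points \<Gamma>\<^sub>2. \<psi> f x \<le> \<psi> g x) \<longleftrightarrow> (\<forall>x\<in>points \<Gamma>\<^sub>1. f x \<le> g x)"
proof -
  have m: "A.rat (trop_add \<Gamma>\<^sub>1 f g)" "B.rat (trop_add \<Gamma>\<^sub>2 (\<psi> f) (\<psi> g))"
    unfolding trop_add_def using f g by (auto intro: A.rat_max B.rat_max psi_rat)
  have "(\<forall>x\<in>points \<Gamma>\<^sub>1. f x \<le> g x) \<longleftrightarrow> trop_add \<Gamma>\<^sub>1 f g = g"
  proof
    assume "\<forall>x\<in>points \<Gamma>\<^sub>1. f x \<le> g x"
    then show "trop_add \<Gamma>\<^sub>1 f g = g" by (intro A.rat_eqI m g) (simp add: trop_add_def max_def)
  next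
    assume *: "trop_add \<Gamma>\<^sub>1 f g = g"
    have "max (f x) (g x) = g x" if "x \<in> points \<Gamma>\<^sub>1" for x
      using fun_cong[OF *, of x] that by (simp add: trop_add_def)
    then show "\<forall>x\<in>points \<Gamma>\<^sub>1. f x \<le> g x" by (metis max.cobounded1)
  qed
  moreover have "(\<forall>x\<in>points \<Gamma>\<^sub>2. \<psi> f x \<le> \<psi> g x) \<longleftrightarrow> trop_add \<Gamma>\<^sub>2 (\<psi> f) (\<psi> g) = \<psi> g"
  proof
    assume "\<forall>x\<in>points \<Gamma>\<^sub>2. \<psi> f x \<le> \<psi> g x"
    then show "trop_add \<Gamma>\<^sub>2 (\<psi> f) (\<psi> g) = \<psi> g" by (intro B.rat_eqI m psi_rat g) (simp add: trop_add_def max_def)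
  next
    assume *: "trop_add \<Gamma>\<^sub>2 (\<psi> f) (\<psi> g) = \<psi> g"
    have "max (\<psi> f x) (\<psi> g x) = \<psi> g x" if "x \<in> points \<Gamma>\<^sub>2" for x
      using fun_cong[OF *, of x] that by (simp add: trop_add_def)
    then show "\<forall>x\<in>points \<Gamma>\<^sub>2. \<psi> f x \<le> \<psi> g x" by (metis max.cobounded1)
  qed
  ultimately show ?thesis using psi_add[OF f g] psi_inj[OF m(1) g] by metis
qed

text \<open>
  A minimum is a greatest lower bound, and \<open>\<psi>\<close> is an order isomorphism.
\<close>
lemma psi_min:
  assumes f: "A.rat f" and g: "A.rat g" and x: "x \<in> points \<Gamma>\<^sub>2"
  shows "\<psi> (\<lambda>x\<in>points \<Gamma>\<^sub>1. min (f x) (g x)) x = min (\<psi> f x) (\<psi> g x)"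
proof (rule antisym)
  let ?m = "\<lambda>x\<in>points \<Gamma>\<^sub>1. min (f x) (g x)"
  have m: "A.rat ?m" by (rule A.rat_min[OF f g])
  have "\<psi> ?m x \<le> \<psi> f x" "\<psi> ?m x \<le> \<psi> g x"
    using psi_le_iff[OF m f] psi_le_iff[OF m g] x by simp_all
  then show "\<psi> ?m x \<le> min (\<psi> f x) (\<psi> g x)" by simp
  have "B.rat (\<lambda>x\<in>points \<Gamma>\<^sub>2. min (\<psi> f x) (\<psi> g x))" by (intro B.rat_min psi_rat f g)
  then obtain h where h: "A.rat h" "\<psi> h = (\<lambda>x\<in>points \<Gamma>\<^sub>2. min (\<psi> f x) (\<psi> g x))" by (rule psi_surj)
  have "\<forall>x\<in>points \<Gamma>\<^sub>1. h x \<le> f x" "\<forall>x\<in>points \<Gamma>\<^sub>1. h x \<le> g x"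
    using psi_le_iff[OF h(1) f] psi_le_iff[OF h(1) g] h(2) by simp_all
  then have "\<forall>x\<in>points \<Gamma>\<^sub>1. h x \<le> ?m x" by simp
  then have "\<forall>x\<in>points \<Gamma>\<^sub>2. \<psi> h x \<le> \<psi> ?m x" using psi_le_iff[OF h(1) m] by simp
  then show "min (\<psi> f x) (\<psi> g x) \<le> \<psi> ?m x" using h(2) x by simp
qed

text \<open>
  The image of the constant \<open>t\<close> is \<open>2 ^ k\<close> times the image of the constant \<open>t / 2 ^ k\<close>, for every \<open>k\<close>. So its integer slopes
  are divisible by all powers of 2.
\<close>
lemma psi_const: "\<exists>c. \<psi> (const_fun \<Gamma>\<^sub>1 (ereal t)) = const_fun \<Gamma>\<^sub>2 (ereal c)"
proof -
  define G where "G k = \<psi> (const_fun \<Gamma>\<^sub>1 (ereal (t / 2 ^ k)))" for k :: nat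
  have G: "B.rat (G k)" for k unfolding G_def by (intro psi_rat A.rat_const)
  have step: "G k x = G (Suc k) x * 2" if "x \<in> points \<Gamma>\<^sub>2" for k x
  proof -
    let ?c = "const_fun \<Gamma>\<^sub>1 (ereal (t / 2 ^ Suc k))"
    have "trop_mult \<Gamma>\<^sub>1 ?c ?c = const_fun \<Gamma>\<^sub>1 (ereal (t / 2 ^ k))"
      unfolding A.trop_mult_self[OF A.rat_const] by (rule ext) (simp add: const_fun_def)
    then have "G k = trop_mult \<Gamma>\<^sub>2 (G (Suc k)) (G (Suc k))"
      unfolding G_def using psi_mult[OF A.bounded_rat_const A.bounded_rat_const, of "t / 2 ^ Suc k" "t / 2 ^ Suc k"] by simp
    then show ?thesis using B.trop_mult_self[OF G] that by simp
  qed
  have pow: "G 0 x = G k x * ereal (2 ^ k)" if "x \<in> points \<Gamma>\<^sub>2" for k x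
  proof (induction k)
    case (Suc k)
    have "ereal 2 * ereal (2 ^ k) = ereal (2 ^ Suc k)" by simp
    then show ?case using Suc step[OF that, of k] by (simp add: mult.assoc)
  qed simp
  have "B.slopes_in {0} (G 0)"
    unfolding B.slopes_in_def
  proof (intro ballI allI impI; elim conjE)
    fix e a b m c assume e: "e \<in> B.E" and ab: "0 \<le> a" "a < b" "ereal b \<le> B.L e"
      and aff: "\<forall>t. a < t \<and> t < b \<longrightarrow> G 0 (B.ch e (ereal t)) = ereal (of_int m * t + c)"
    obtain k :: nat where "\<bar>real_of_int m\<bar> < 2 ^ k" using real_arch_pow[of 2] by auto
    then have "real_of_int \<bar>m\<bar> < real_of_int (2 ^ k)" by simp
    then have k: "\<bar>m\<bar> < 2 ^ k" by (simp only: of_int_less_iff)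
    have "ereal a < B.L e" using ab(2,3) by (meson ereal_less_eq(3) less_ereal.simps(1) less_le_trans)
    then have F: "at_right a \<in> edge_filters (B.L e)" using ab(1) by (auto simp: edge_filters_def)
    obtain m' c' where g: "eventually (\<lambda>u. G k (B.ch e (ereal u)) = ereal (of_int m' * u + c')) (at_right a)"
      using B.rat_germ[OF G[of k] e F] by (auto simp: affine_germ_def)
    have "eventually (\<lambda>u. u \<in> {a<..<b}) (at_right a)" using ab(2) by (rule eventually_at_right_real)
    then have "eventually (\<lambda>u. of_int m * u + c = (of_int m' * 2 ^ k) * u + c' * 2 ^ k) (at_right a)"
      using g edge_filter_inside[OF F B.len_pos[OF e]]
    proof eventually_elim
      case (elim u)
      then have "B.ch e (ereal u) \<in> points \<Gamma>\<^sub>2" by (intro B.chart_in_points[OF e]) (simp add: less_imp_le)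
      from pow[OF this, of k] elim aff show ?case by (simp add: algebra_simps)
    qed
    then have "real_of_int m = of_int m' * 2 ^ k"
      by (rule affine_slope_unique[OF F B.len_pos[OF e]])
    then have "real_of_int m = real_of_int (m' * 2 ^ k)" by simp
    then have m: "m = m' * 2 ^ k" by (simp only: of_int_eq_iff)
    have "m = 0"
    proof (rule ccontr)
      assume "m \<noteq> 0"
      moreover have "2 ^ k dvd \<bar>m\<bar>" by (simp add: m)
      ultimately show False using k zdvd_imp_le[of "2 ^ k" "\<bar>m\<bar>"] by simp
    qed
    then show "m \<in> {0}" by simp
  qed
  then have "\<exists>c. G 0 = const_fun \<Gamma>\<^sub>2 (ereal c)" by (rule B.rat_locally_constant[OF G])
  then show ?thesis by (simp add: G_def)
qed

definition scale :: real where
  "scale = (THE r. \<psi> (const_fun \<Gamma>\<^sub>1 1) = const_fun \<Gamma>\<^sub>2 (ereal r))"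

lemma const_fun_inj:
  assumes "const_fun \<Gamma>\<^sub>2 s = const_fun \<Gamma>\<^sub>2 t" shows "s = t"
proof -
  obtain x where "x \<in> points \<Gamma>\<^sub>2" using B.fin_points_nonempty B.fin_subset by blast
  then show ?thesis using fun_cong[OF assms, of x] by (simp add: const_fun_def)
qed

lemma psi_const_scale: "\<psi> (const_fun \<Gamma>\<^sub>1 (ereal t)) = const_fun \<Gamma>\<^sub>2 (ereal (scale * t))"
  and scale_pos: "0 < scale"
proof -
  have "\<forall>t. \<exists>c. \<psi> (const_fun \<Gamma>\<^sub>1 (ereal t)) = const_fun \<Gamma>\<^sub>2 (ereal c)" using psi_const by simp
  from choice[OF this] obtain \<rho> where \<rho>: "\<And>t. \<psi> (const_fun \<Gamma>\<^sub>1 (ereal t)) = const_fun \<Gamma>\<^sub>2 (ereal (\<rho> t))" by blast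
  obtain y where y: "y \<in> points \<Gamma>\<^sub>2" using B.fin_points_nonempty B.fin_subset by blast
  have add: "\<rho> (s + t) = \<rho> s + \<rho> t" for s t
  proof -
    have "trop_mult \<Gamma>\<^sub>1 (const_fun \<Gamma>\<^sub>1 (ereal s)) (const_fun \<Gamma>\<^sub>1 (ereal t)) = const_fun \<Gamma>\<^sub>1 (ereal (s + t))"
      unfolding A.trop_mult_bounded[OF A.bounded_rat_const A.bounded_rat_const]
      by (rule ext) (simp add: const_fun_def)
    then have "const_fun \<Gamma>\<^sub>2 (ereal (\<rho> (s + t))) = trop_mult \<Gamma>\<^sub>2 (const_fun \<Gamma>\<^sub>2 (ereal (\<rho> s))) (const_fun \<Gamma>\<^sub>2 (ereal (\<rho> t)))"
      using psi_mult[OF A.bounded_rat_const A.bounded_rat_const, of s t] by (simp only: \<rho>)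
    also have "\<dots> = const_fun \<Gamma>\<^sub>2 (ereal (\<rho> s + \<rho> t))"
      unfolding B.trop_mult_bounded[OF B.bounded_rat_const B.bounded_rat_const]
      by (rule ext) (simp add: const_fun_def)
    finally show ?thesis by (auto dest: const_fun_inj)
  qed
  have mono: "\<rho> s \<le> \<rho> t" if "s \<le> t" for s t
  proof -
    have "\<forall>x\<in>points \<Gamma>\<^sub>2. \<psi> (const_fun \<Gamma>\<^sub>1 (ereal s)) x \<le> \<psi> (const_fun \<Gamma>\<^sub>1 (ereal t)) x"
      unfolding psi_le_iff[OF A.rat_const A.rat_const] using that by (simp add: const_fun_def)
    then have "const_fun \<Gamma>\<^sub>2 (ereal (\<rho> s)) y \<le> const_fun \<Gamma>\<^sub>2 (ereal (\<rho> t)) y" using y unfolding \<rho> by blast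
    then show ?thesis using y by simp
  qed
  have lin: "\<rho> t = \<rho> 1 * t" for t by (rule additive_mono_imp_linear[OF add mono])
  have "scale = \<rho> 1" unfolding scale_def
    using \<rho>[of 1] by (intro the_equality) (auto simp: one_ereal_def dest: const_fun_inj)
  then show "\<psi> (const_fun \<Gamma>\<^sub>1 (ereal t)) = const_fun \<Gamma>\<^sub>2 (ereal (scale * t))" using lin[of t] \<rho>[of t] by simp
  have "\<rho> 0 = 0" using lin[of 0] by simp
  moreover have "\<rho> 1 \<noteq> \<rho> 0"
  proof
    assume "\<rho> 1 = \<rho> 0"
    then have eq: "const_fun \<Gamma>\<^sub>1 (ereal 1) = const_fun \<Gamma>\<^sub>1 (ereal 0)"
      by (intro psi_inj A.rat_const) (simp add: \<rho>)
    obtain x where "x \<in> points \<Gamma>\<^sub>1" using A.fin_points_nonempty A.fin_subset by blast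
    then show False using fun_cong[OF eq, of x] by (simp add: const_fun_def)
  qed
  ultimately show "0 < scale" using mono[of 0 1] \<open>scale = \<rho> 1\<close> by simp
qed

lemma psi_bounded:
  assumes f: "A.bounded_rat f" shows "B.bounded_rat (\<psi> f)"
proof -
  obtain c where c: "\<forall>x\<in>points \<Gamma>\<^sub>1. - ereal c \<le> f x \<and> f x \<le> ereal c" using f by (auto simp: A.bounded_rat_def)
  have r: "A.rat f" using f by (rule A.bounded_rat_rat)
  have 1: "\<forall>x\<in>points \<Gamma>\<^sub>2. \<psi> (const_fun \<Gamma>\<^sub>1 (ereal (- c))) x \<le> \<psi> f x"
    unfolding psi_le_iff[OF A.rat_const r] using c by simp
  have 2: "\<forall>x\<in>points \<Gamma>\<^sub>2. \<psi> f x \<le> \<psi> (const_fun \<Gamma>\<^sub>1 (ereal c)) x"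
    unfolding psi_le_iff[OF r A.rat_const] using c by simp
  have "\<forall>x\<in>points \<Gamma>\<^sub>2. - ereal (scale * c) \<le> \<psi> f x \<and> \<psi> f x \<le> ereal (scale * c)"
    using 1 2 by (simp add: psi_const_scale)
  then show ?thesis using psi_rat[OF r] unfolding B.bounded_rat_def by (intro conjI exI)
qed

lemma psi_plus:
  assumes f: "A.bounded_rat f" and g: "A.bounded_rat g" and x: "x \<in> points \<Gamma>\<^sub>2"
  shows "\<psi> (\<lambda>x\<in>points \<Gamma>\<^sub>1. f x + g x) x = \<psi> f x + \<psi> g x"
proof -
  have "\<psi> (\<lambda>x\<in>points \<Gamma>\<^sub>1. f x + g x) = (\<lambda>x\<in>points \<Gamma>\<^sub>2. \<psi> f x + \<psi> g x)"
    using psi_mult[OF f g]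
    by (simp only: A.trop_mult_bounded[OF f g] B.trop_mult_bounded[OF psi_bounded[OF f] psi_bounded[OF g]])
  then show ?thesis using x by simp
qed

lemma psi_uminus:
  assumes f: "A.bounded_rat f" and x: "x \<in> points \<Gamma>\<^sub>2"
  shows "\<psi> (\<lambda>x\<in>points \<Gamma>\<^sub>1. - f x) x = - \<psi> f x"
proof -
  let ?g = "\<lambda>x\<in>points \<Gamma>\<^sub>1. - f x"
  have g: "A.bounded_rat ?g" by (rule A.bounded_rat_uminus[OF f])
  have "f y + ?g y = 0" if "y \<in> points \<Gamma>\<^sub>1" for y
    using A.bounded_rat_finite[OF f that] that by (cases "f y") auto
  then have "(\<lambda>x\<in>points \<Gamma>\<^sub>1. f x + ?g x) = const_fun \<Gamma>\<^sub>1 (ereal 0)"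
    unfolding const_fun_def zero_ereal_def[symmetric] by (intro restrict_ext)
  then have "\<psi> f x + \<psi> ?g x = const_fun \<Gamma>\<^sub>2 (ereal (scale * 0)) x"
    using psi_plus[OF f g x] by (simp only: psi_const_scale)
  then have "\<psi> f x + \<psi> ?g x = 0" using x by simp
  then show ?thesis
    using B.bounded_rat_finite[OF psi_bounded[OF f] x] B.bounded_rat_finite[OF psi_bounded[OF g] x]
    by (cases "\<psi> f x"; cases "\<psi> ?g x") auto
qed

lemma psi_abs_diff:
  assumes f: "A.bounded_rat f" and x: "x \<in> points \<Gamma>\<^sub>2"
  shows "\<psi> (\<lambda>x\<in>points \<Gamma>\<^sub>1. \<bar>f x - ereal c\<bar>) x = \<bar>\<psi> f x - ereal (scale * c)\<bar>"
proof -
  let ?d = "\<lambda>x\<in>points \<Gamma>\<^sub>1. f x + const_fun \<Gamma>\<^sub>1 (ereal (- c)) x"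
  let ?d' = "\<lambda>x\<in>points \<Gamma>\<^sub>1. - ?d x"
  have d: "A.bounded_rat ?d" by (rule A.bounded_rat_add[OF f A.bounded_rat_const])
  have d': "A.bounded_rat ?d'" by (rule A.bounded_rat_uminus[OF d])
  have "max (?d y) (?d' y) = \<bar>f y - ereal c\<bar>" if "y \<in> points \<Gamma>\<^sub>1" for y
    using that A.bounded_rat_finite[OF f that] by (cases "f y") (auto simp: const_fun_def max_def)
  then have eq: "(\<lambda>x\<in>points \<Gamma>\<^sub>1. \<bar>f x - ereal c\<bar>) = (\<lambda>x\<in>points \<Gamma>\<^sub>1. max (?d x) (?d' x))"
    by (intro restrict_ext) simp
  have dx: "\<psi> ?d x = \<psi> f x + ereal (scale * (- c))"
    unfolding psi_plus[OF f A.bounded_rat_const x] psi_const_scale using x by simp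
  show ?thesis
    unfolding eq psi_max[OF A.bounded_rat_rat[OF d] A.bounded_rat_rat[OF d'] x] psi_uminus[OF d x] dx
    using B.bounded_rat_finite[OF psi_bounded[OF f] x] by (cases "\<psi> f x") (auto simp: max_def algebra_simps abs_real_def)
qed

text \<open>
  Compactness argument: if no point \<open>x\<close> works, then each \<open>x\<close> has a bounded function \<open>f\<close> with \<open>\<psi> f x' = r * c\<close> and
  \<open>f x \<noteq> c\<close>. The function \<open>\<bar>f - c\<bar>\<close> is positive at \<open>x\<close> although \<open>\<psi>\<close> makes it vanish at \<open>x'\<close>. The maximum of finitely
  many such functions is bounded below by a positive constant \<open>\<delta>\<close> while it still vanishes at \<open>x'\<close> after \<open>\<psi>\<close>; but
  \<open>\<psi>\<close> preserves the order and maps \<open>\<delta>\<close> to \<open>r * \<delta>\<close>.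
\<close>
lemma psi_evaluation_bounded:
  assumes x': "x' \<in> points \<Gamma>\<^sub>2"
  shows "\<exists>x\<in>points \<Gamma>\<^sub>1. \<forall>f. A.bounded_rat f \<longrightarrow> \<psi> f x' = ereal scale * f x"
proof (rule ccontr)
  assume neg: "\<not> ?thesis"
  define \<U> where "\<U> = {U. \<exists>g \<delta>. A.bounded_rat g \<and> \<psi> g x' = 0 \<and> 0 < \<delta> \<and> U = {y \<in> points \<Gamma>\<^sub>1. ereal \<delta> < g y}}"
  have "\<forall>U\<in>\<U>. openin A.top_curve U"
  proof
    fix U assume "U \<in> \<U>"
    then obtain g \<delta> where g: "A.bounded_rat g" "\<psi> g x' = 0" "0 < \<delta>" "U = {y \<in> points \<Gamma>\<^sub>1. ereal \<delta> < g y}"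
      unfolding \<U>_def by (elim CollectE exE conjE)
    have "openin A.top_curve {y \<in> topspace A.top_curve. g y \<in> {ereal \<delta><..}}"
      by (rule openin_continuous_map_preimage[OF A.rat_continuous[OF A.bounded_rat_rat[OF g(1)]]]) simp
    then show "openin A.top_curve U" using g(4) by (simp add: A.topspace_curve)
  qed
  moreover have "topspace A.top_curve \<subseteq> \<Union>\<U>"
  proof
    fix x assume "x \<in> topspace A.top_curve"
    then have x: "x \<in> points \<Gamma>\<^sub>1" by (simp add: A.topspace_curve)
    then obtain f where f: "A.bounded_rat f" "\<psi> f x' \<noteq> ereal scale * f x" using neg by blast
    obtain v where v: "\<psi> f x' = ereal v" using B.bounded_rat_finite[OF psi_bounded[OF f(1)] x'] by (cases "\<psi> f x'") auto
    obtain w where w: "f x = ereal w" using A.bounded_rat_finite[OF f(1) x] by (cases "f x") auto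
    define c where "c = v / scale"
    have vc: "v = scale * c" and wc: "w \<noteq> c" using f(2) v w scale_pos by (auto simp: c_def)
    define g where "g = (\<lambda>x\<in>points \<Gamma>\<^sub>1. \<bar>f x - ereal c\<bar>)"
    have g: "A.bounded_rat g" unfolding g_def by (rule A.bounded_rat_abs_diff[OF f(1)])
    have g0: "\<psi> g x' = 0" unfolding g_def psi_abs_diff[OF f(1) x'] v vc by simp
    have gx: "g x = ereal \<bar>w - c\<bar>" using x w by (simp add: g_def)
    have "{y \<in> points \<Gamma>\<^sub>1. ereal (\<bar>w - c\<bar> / 2) < g y} \<in> \<U>"
      unfolding \<U>_def using g g0 wc
      by (intro CollectI exI[of _ g] exI[of _ "\<bar>w - c\<bar> / 2"]) simp
    moreover have "x \<in> {y \<in> points \<Gamma>\<^sub>1. ereal (\<bar>w - c\<bar> / 2) < g y}" using x gx wc by simp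
    ultimately show "x \<in> \<Union>\<U>" by (rule UnionI)
  qed
  ultimately obtain \<F> where F: "finite \<F>" "\<F> \<subseteq> \<U>" "topspace A.top_curve \<subseteq> \<Union>\<F>"
    using A.compact_curve[unfolded compact_space_alt, rule_format, of \<U>] by blast
  have "\<exists>g \<delta>. A.bounded_rat g \<and> \<psi> g x' = 0 \<and> 0 < \<delta> \<and> \<Union>\<F> \<subseteq> {y \<in> points \<Gamma>\<^sub>1. ereal \<delta> < g y}"
    using F(1,2)
  proof (induction \<F> rule: finite_induct)
    case empty
    have "\<psi> (const_fun \<Gamma>\<^sub>1 (ereal 0)) x' = 0" using x' by (simp add: psi_const_scale)
    then show ?case using A.bounded_rat_const[of 0] by (intro exI[of _ "const_fun \<Gamma>\<^sub>1 (ereal 0)"] exI[of _ 1]) simp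
  next
    case (insert U \<F>)
    then obtain g \<delta> where g: "A.bounded_rat g" "\<psi> g x' = 0" "0 < \<delta>" "\<Union>\<F> \<subseteq> {y \<in> points \<Gamma>\<^sub>1. ereal \<delta> < g y}"
      by auto
    have "U \<in> \<U>" using insert.prems by simp
    then obtain h \<epsilon> where h: "A.bounded_rat h" "\<psi> h x' = 0" "0 < \<epsilon>" "U = {y \<in> points \<Gamma>\<^sub>1. ereal \<epsilon> < h y}"
      unfolding \<U>_def by (elim CollectE exE conjE)
    let ?k = "\<lambda>x\<in>points \<Gamma>\<^sub>1. max (g x) (h x)"
    have k1: "A.bounded_rat ?k" by (rule A.bounded_rat_max[OF g(1) h(1)])
    have k2: "\<psi> ?k x' = 0"
      using psi_max[OF A.bounded_rat_rat[OF g(1)] A.bounded_rat_rat[OF h(1)] x'] g(2) h(2) by simp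
    have k3: "\<Union>(insert U \<F>) \<subseteq> {y \<in> points \<Gamma>\<^sub>1. ereal (min \<delta> \<epsilon>) < ?k y}"
    proof
      fix y assume "y \<in> \<Union>(insert U \<F>)"
      then have "y \<in> points \<Gamma>\<^sub>1 \<and> (ereal \<delta> < g y \<or> ereal \<epsilon> < h y)" using g(4) h(4) by blast
      then show "y \<in> {y \<in> points \<Gamma>\<^sub>1. ereal (min \<delta> \<epsilon>) < ?k y}"
        by (auto simp: less_max_iff_disj intro: le_less_trans[of _ "ereal \<delta>"] le_less_trans[of _ "ereal \<epsilon>"])
    qed
    show ?case
      by (rule exI[of _ ?k], rule exI[of _ "min \<delta> \<epsilon>"], intro conjI k1 k2 k3) (use g(3) h(3) in simp)
  qed
  then obtain g \<delta> where g: "A.bounded_rat g" "\<psi> g x' = 0" "0 < \<delta>" "\<Union>\<F> \<subseteq> {y \<in> points \<Gamma>\<^sub>1. ereal \<delta> < g y}"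
    by (elim exE conjE)
  have "ereal \<delta> \<le> g y" if "y \<in> points \<Gamma>\<^sub>1" for y
  proof -
    have "y \<in> \<Union>\<F>" using that subsetD[OF F(3)[unfolded A.topspace_curve]] by simp
    then have "y \<in> {y \<in> points \<Gamma>\<^sub>1. ereal \<delta> < g y}" by (rule subsetD[OF g(4)])
    then show ?thesis by (simp add: less_imp_le)
  qed
  then have "\<forall>y\<in>points \<Gamma>\<^sub>1. const_fun \<Gamma>\<^sub>1 (ereal \<delta>) y \<le> g y" by (simp add: const_fun_def)
  then have "\<forall>x\<in>points \<Gamma>\<^sub>2. \<psi> (const_fun \<Gamma>\<^sub>1 (ereal \<delta>)) x \<le> \<psi> g x"
    using psi_le_iff[OF A.rat_const A.bounded_rat_rat[OF g(1)]] by simp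
  then have "ereal (scale * \<delta>) \<le> 0" using x' g(2) by (auto simp: psi_const_scale)
  then show False using scale_pos g(3) by (simp add: not_le mult_le_0_iff)
qed

text \<open>
  Truncating with constants from both sides commutes with \<open>\<psi>\<close>, since \<open>\<psi>\<close> preserves maxima and minima.
\<close>
lemma psi_evaluation:
  assumes x': "x' \<in> points \<Gamma>\<^sub>2"
  shows "\<exists>x\<in>points \<Gamma>\<^sub>1. \<forall>f. A.rat f \<longrightarrow> \<psi> f x' = ereal scale * f x"
proof -
  obtain x where x: "x \<in> points \<Gamma>\<^sub>1" "\<And>f. A.bounded_rat f \<Longrightarrow> \<psi> f x' = ereal scale * f x"
    using psi_evaluation_bounded[OF x'] by blast
  have "\<psi> f x' = ereal scale * f x" if f: "A.rat f" for f
  proof -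
    have trunc: "min (max (\<psi> f x') (ereal (- (scale * c)))) (ereal (scale * c)) =
        min (max (ereal scale * f x) (ereal (- (scale * c)))) (ereal (scale * c))" if c: "0 < c" for c
    proof -
      let ?h = "\<lambda>x\<in>points \<Gamma>\<^sub>1. max (f x) (const_fun \<Gamma>\<^sub>1 (ereal (- c)) x)"
      let ?k = "\<lambda>x\<in>points \<Gamma>\<^sub>1. min (?h x) (const_fun \<Gamma>\<^sub>1 (ereal c) x)"
      have h: "A.rat ?h" by (rule A.rat_max[OF f A.rat_const])
      have k: "A.rat ?k" by (rule A.rat_min[OF h A.rat_const])
      have "- ereal c \<le> ?k y \<and> ?k y \<le> ereal c" if "y \<in> points \<Gamma>\<^sub>1" for y
        using that c by (cases "f y") (auto simp: const_fun_def min_def max_def)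
      then have "A.bounded_rat ?k" using k unfolding A.bounded_rat_def by (intro conjI exI[of _ c]) simp_all
      then have "\<psi> ?k x' = ereal scale * ?k x" by (rule x(2))
      moreover have "\<psi> ?k x' = min (max (\<psi> f x') (ereal (- (scale * c)))) (ereal (scale * c))"
        unfolding psi_min[OF h A.rat_const x'] psi_max[OF f A.rat_const x'] psi_const_scale
        using x' by simp
      moreover have "ereal scale * ?k x = min (max (ereal scale * f x) (ereal (- (scale * c)))) (ereal (scale * c))"
      proof (cases "f x")
        case (real r)
        have "scale * min (max r (- c)) c = min (max (scale * r) (- (scale * c))) (scale * c)"
          using scale_pos by (simp add: min_mult_distrib_left max_mult_distrib_left)
        then have "ereal (scale * min (max r (- c)) c) = ereal (min (max (scale * r) (- (scale * c))) (scale * c))" by simp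
        moreover have kx: "?k x = ereal (min (max r (- c)) c)" using x(1) real by simp
        have "ereal scale * ?k x = ereal (scale * min (max r (- c)) c)" by (simp only: kx times_ereal.simps(1))
        ultimately show ?thesis using real by simp
      qed (use x(1) scale_pos c in \<open>auto simp: min_def max_def\<close>)
      ultimately show ?thesis by simp
    qed
    have trunc': "min (max (\<psi> f x') (ereal (- c))) (ereal c) = min (max (ereal scale * f x) (ereal (- c))) (ereal c)"
      if "0 < c" for c
      using trunc[of "c / scale"] that scale_pos by simp
    show ?thesis by (rule ereal_truncation_eqI) (rule trunc')
  qed
  then show ?thesis using x(1) by blast
qed

lemma inverse_iso: "rat_iso \<Gamma>\<^sub>2 \<Gamma>\<^sub>1 (inv_into {f. A.rat f} \<psi>)"
proof
  let ?C = "{f. A.rat f}"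
  let ?i = "inv_into ?C \<psi>"
  have bi: "bij_betw ?i {g. B.rat g} ?C" using bij by (rule bij_betw_inv_into)
  then show "bij_betw ?i {g. B.rat g} ?C" .
  have inv1: "\<psi> (?i g) = g" if "B.rat g" for g
    using bij_betw_inv_into_right[OF bij, of g] that by simp
  have inv2: "?i (\<psi> f) = f" if "A.rat f" for f
    using bij_betw_inv_into_left[OF bij, of f] that by simp
  have i_rat: "A.rat (?i g)" if "B.rat g" for g
    using bi that by (auto simp: bij_betw_def)
  show "?i (trop_add \<Gamma>\<^sub>2 f g) = trop_add \<Gamma>\<^sub>1 (?i f) (?i g)" if f: "B.rat f" and g: "B.rat g" for f g
  proof -
    have "trop_add \<Gamma>\<^sub>2 f g = \<psi> (trop_add \<Gamma>\<^sub>1 (?i f) (?i g))"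
      using psi_add[OF i_rat[OF f] i_rat[OF g]] inv1 f g by simp
    moreover have "A.rat (trop_add \<Gamma>\<^sub>1 (?i f) (?i g))"
      unfolding trop_add_def by (intro A.rat_max i_rat f g)
    ultimately show ?thesis using inv2 by simp
  qed
  have i_bounded: "A.bounded_rat (?i g)" if g: "B.bounded_rat g" for g
  proof -
    have r: "B.rat g" using g by (rule B.bounded_rat_rat)
    obtain c where c: "\<forall>x\<in>points \<Gamma>\<^sub>2. - ereal c \<le> g x \<and> g x \<le> ereal c" using g by (auto simp: B.bounded_rat_def)
    have "scale * (c / scale) = c" "scale * (- (c / scale)) = - c" using scale_pos by simp_all
    note sc = psi_const_scale[of "c / scale", unfolded this(1)] psi_const_scale[of "- (c / scale)", unfolded this(2)]
    have "\<forall>x\<in>points \<Gamma>\<^sub>1. const_fun \<Gamma>\<^sub>1 (ereal (- (c / scale))) x \<le> ?i g x"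
      unfolding psi_le_iff[OF A.rat_const i_rat[OF r], symmetric] inv1[OF r] sc using c by simp
    moreover have "\<forall>x\<in>points \<Gamma>\<^sub>1. ?i g x \<le> const_fun \<Gamma>\<^sub>1 (ereal (c / scale)) x"
      unfolding psi_le_iff[OF i_rat[OF r] A.rat_const, symmetric] inv1[OF r] sc using c by simp
    ultimately have "\<forall>x\<in>points \<Gamma>\<^sub>1. - ereal (c / scale) \<le> ?i g x \<and> ?i g x \<le> ereal (c / scale)" by simp
    with i_rat[OF r] show ?thesis unfolding A.bounded_rat_def by (intro conjI exI)
  qed
  show "?i (trop_mult \<Gamma>\<^sub>2 f g) = trop_mult \<Gamma>\<^sub>1 (?i f) (?i g)" if f: "B.bounded_rat f" and g: "B.bounded_rat g" for f g
  proof -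
    have "trop_mult \<Gamma>\<^sub>2 f g = \<psi> (trop_mult \<Gamma>\<^sub>1 (?i f) (?i g))"
      using psi_mult[OF i_bounded[OF f] i_bounded[OF g]] inv1 B.bounded_rat_rat f g by simp
    moreover have "A.rat (trop_mult \<Gamma>\<^sub>1 (?i f) (?i g))"
      unfolding A.trop_mult_bounded[OF i_bounded[OF f] i_bounded[OF g]]
      by (intro A.bounded_rat_rat A.bounded_rat_add i_bounded f g)
    ultimately show ?thesis using inv2 by simp
  qed
qed

end

lemma semiring_iso_imp_rat_iso:
  assumes "curve \<Gamma>\<^sub>1" "curve \<Gamma>\<^sub>2" and iso: "\<psi> \<in> semiring_iso (Rat_semifield \<Gamma>\<^sub>1) (Rat_semifield \<Gamma>\<^sub>2)"
  shows "rat_iso \<Gamma>\<^sub>1 \<Gamma>\<^sub>2 \<psi>"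
proof -
  interpret A: curve \<Gamma>\<^sub>1 by fact
  interpret B: curve \<Gamma>\<^sub>2 by fact
  have bij: "bij_betw \<psi> {f. rational_function \<Gamma>\<^sub>1 f} {g. rational_function \<Gamma>\<^sub>2 g}"
    and hom: "\<psi> \<in> ring_hom (Rat_semifield \<Gamma>\<^sub>1) (Rat_semifield \<Gamma>\<^sub>2)"
    and zero: "\<psi> (const_fun \<Gamma>\<^sub>1 (-\<infinity>)) = const_fun \<Gamma>\<^sub>2 (-\<infinity>)"
    using iso by (simp_all add: semiring_iso_def semiring_hom_def Rat_semifield_def)
  have "{f. rational_function \<Gamma>\<^sub>1 f} - {const_fun \<Gamma>\<^sub>1 (-\<infinity>)} = {f. A.rat f}"
    using A.bottom_not_rat by (auto simp: A.rational_function_iff)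
  moreover have "{f. rational_function \<Gamma>\<^sub>2 f} - {const_fun \<Gamma>\<^sub>2 (-\<infinity>)} = {f. B.rat f}"
    using B.bottom_not_rat by (auto simp: B.rational_function_iff)
  moreover have "bij_betw \<psi> ({f. rational_function \<Gamma>\<^sub>1 f} - {const_fun \<Gamma>\<^sub>1 (-\<infinity>)})
      ({f. rational_function \<Gamma>\<^sub>2 f} - {const_fun \<Gamma>\<^sub>2 (-\<infinity>)})"
    using bij_betw_DiffI[OF bij, of "{const_fun \<Gamma>\<^sub>1 (-\<infinity>)}" "{const_fun \<Gamma>\<^sub>2 (-\<infinity>)}"] zero
    by (simp add: A.rational_function_iff B.rational_function_iff)
  ultimately have "bij_betw \<psi> {f. A.rat f} {g. B.rat g}" by simp
  moreover have "\<psi> (trop_add \<Gamma>\<^sub>1 f g) = trop_add \<Gamma>\<^sub>2 (\<psi> f) (\<psi> g)"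
    "\<psi> (trop_mult \<Gamma>\<^sub>1 f g) = trop_mult \<Gamma>\<^sub>2 (\<psi> f) (\<psi> g)" if "A.rat f" "A.rat g" for f g
    using ring_hom_add[OF hom, of f g] ring_hom_mult[OF hom, of f g] that
    by (simp_all add: Rat_semifield_def A.rational_function_iff)
  ultimately show ?thesis using A.bounded_rat_rat by unfold_locales simp_all
qed

text \<open>
  Evaluation points for \<open>\<psi>\<close> and for its inverse give maps in both directions. Composing the two evaluations, first for the
  constant 1 and then for functions that separate points, shows that the scales and the maps are mutually inverse.
\<close>
lemma (in rat_iso) psi_substitution:
  "\<exists>\<phi> \<theta>. (\<forall>x\<in>points \<Gamma>\<^sub>1. \<phi> x \<in> points \<Gamma>\<^sub>2 \<and> \<theta> (\<phi> x) = x) \<and>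
     (\<forall>y\<in>points \<Gamma>\<^sub>2. \<theta> y \<in> points \<Gamma>\<^sub>1 \<and> \<phi> (\<theta> y) = y) \<and>
     (\<forall>f. A.rat f \<longrightarrow> (\<forall>y\<in>points \<Gamma>\<^sub>2. \<psi> f y = ereal scale * f (\<theta> y)))"
proof -
  let ?i = "inv_into {f. A.rat f} \<psi>"
  interpret I: rat_iso \<Gamma>\<^sub>2 \<Gamma>\<^sub>1 ?i by (rule inverse_iso)
  have "\<forall>y\<in>points \<Gamma>\<^sub>2. \<exists>x. x \<in> points \<Gamma>\<^sub>1 \<and> (\<forall>f. A.rat f \<longrightarrow> \<psi> f y = ereal scale * f x)"
    using psi_evaluation by blast
  from bchoice[OF this] obtain \<theta> where \<theta>: "\<forall>y\<in>points \<Gamma>\<^sub>2. \<theta> y \<in> points \<Gamma>\<^sub>1 \<and> (\<forall>f. A.rat f \<longrightarrow> \<psi> f y = ereal scale * f (\<theta> y))" ..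
  have "\<forall>x\<in>points \<Gamma>\<^sub>1. \<exists>y. y \<in> points \<Gamma>\<^sub>2 \<and> (\<forall>g. B.rat g \<longrightarrow> ?i g x = ereal I.scale * g y)"
    using I.psi_evaluation by blast
  from bchoice[OF this] obtain \<phi> where \<phi>: "\<forall>x\<in>points \<Gamma>\<^sub>1. \<phi> x \<in> points \<Gamma>\<^sub>2 \<and> (\<forall>g. B.rat g \<longrightarrow> ?i g x = ereal I.scale * g (\<phi> x))" ..
  have inv1: "\<psi> (?i g) = g" if "B.rat g" for g
    using bij_betw_inv_into_right[OF bij, of g] that by simp
  have inv2: "?i (\<psi> f) = f" if "A.rat f" for f
    using bij_betw_inv_into_left[OF bij, of f] that by simp
  have fx: "f x = ereal (scale * I.scale) * f (\<theta> (\<phi> x))" if f: "A.rat f" and x: "x \<in> points \<Gamma>\<^sub>1" for f x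
  proof -
    have px: "\<phi> x \<in> points \<Gamma>\<^sub>2" using \<phi> x by simp
    have "?i (\<psi> f) x = ereal I.scale * \<psi> f (\<phi> x)"
      using conjunct2[OF bspec[OF \<phi> x]] psi_rat[OF f] by (elim allE impE)
    then have "f x = ereal I.scale * \<psi> f (\<phi> x)" by (simp only: inv2[OF f])
    also have "\<psi> f (\<phi> x) = ereal scale * f (\<theta> (\<phi> x))" using bspec[OF \<theta> px] f by simp
    finally show ?thesis
      by (simp only: mult.assoc[symmetric] times_ereal.simps(1) mult.commute[of I.scale scale])
  qed
  obtain x0 where "x0 \<in> fin_points \<Gamma>\<^sub>1" using A.fin_points_nonempty by (auto simp: ex_in_conv[symmetric])
  then have x0: "x0 \<in> points \<Gamma>\<^sub>1" by (rule subsetD[OF A.fin_subset])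
  have "\<theta> (\<phi> x0) \<in> points \<Gamma>\<^sub>1" using \<phi> \<theta> x0 by simp
  then have "ereal 1 = ereal (scale * I.scale) * ereal 1"
    using fx[OF A.rat_const[of 1] x0] x0 by (simp only: const_fun_apply)
  then have sc: "scale * I.scale = 1" by simp
  have 1: "\<theta> (\<phi> x) = x" if x: "x \<in> points \<Gamma>\<^sub>1" for x
  proof (rule ccontr)
    assume ne: "\<theta> (\<phi> x) \<noteq> x"
    have "\<theta> (\<phi> x) \<in> points \<Gamma>\<^sub>1" using \<phi> \<theta> x by simp
    then obtain f where f: "A.bounded_rat f" "f (\<theta> (\<phi> x)) \<noteq> f x"
      by (rule A.bounded_rat_separates[OF _ x ne])
    show False using fx[OF A.bounded_rat_rat[OF f(1)] x] sc f(2) by (simp add: one_ereal_def[symmetric])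
  qed
  have gy: "g y = ereal (scale * I.scale) * g (\<phi> (\<theta> y))" if g: "B.rat g" and y: "y \<in> points \<Gamma>\<^sub>2" for g y
  proof -
    have py: "\<theta> y \<in> points \<Gamma>\<^sub>1" using \<theta> y by simp
    have "\<psi> (?i g) y = ereal scale * ?i g (\<theta> y)"
      using conjunct2[OF bspec[OF \<theta> y]] I.psi_rat[OF g] by (elim allE impE)
    then have "g y = ereal scale * ?i g (\<theta> y)" by (simp only: inv1[OF g])
    also have "?i g (\<theta> y) = ereal I.scale * g (\<phi> (\<theta> y))" using bspec[OF \<phi> py] g by simp
    finally show ?thesis by (simp only: mult.assoc[symmetric] times_ereal.simps(1))
  qed
  have 2: "\<phi> (\<theta> y) = y" if y: "y \<in> points \<Gamma>\<^sub>2" for y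
  proof (rule ccontr)
    assume ne: "\<phi> (\<theta> y) \<noteq> y"
    have "\<phi> (\<theta> y) \<in> points \<Gamma>\<^sub>2" using \<phi> \<theta> y by simp
    then obtain g where g: "B.bounded_rat g" "g (\<phi> (\<theta> y)) \<noteq> g y"
      by (rule B.bounded_rat_separates[OF _ y ne])
    show False using gy[OF B.bounded_rat_rat[OF g(1)] y] sc g(2) by (simp add: one_ereal_def[symmetric])
  qed
  show ?thesis
    by (rule exI[of _ \<phi>], rule exI[of _ \<theta>]) (use \<phi> \<theta> 1 2 in simp)
qed

section \<open>The induced map is an expansive homeomorphism\<close>

text \<open>
  The assumptions are symmetric: exchanging the curves replaces \<open>r\<close> by \<open>1 / r\<close> (\<open>inverse_pair\<close>), so an assertion about
  \<open>\<phi>\<close> holds for \<open>\<theta>\<close> as well.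
\<close>
locale scaled_pair = A: curve \<Gamma>\<^sub>1 + B: curve \<Gamma>\<^sub>2
  for \<Gamma>\<^sub>1 :: "'a curve" and \<Gamma>\<^sub>2 :: "'b curve" +
  fixes r :: real and \<phi> :: "'a \<Rightarrow> 'b" and \<theta> :: "'b \<Rightarrow> 'a"
  assumes r_pos: "0 < r"
    and phi_mem: "x \<in> points \<Gamma>\<^sub>1 \<Longrightarrow> \<phi> x \<in> points \<Gamma>\<^sub>2"
    and theta_mem: "y \<in> points \<Gamma>\<^sub>2 \<Longrightarrow> \<theta> y \<in> points \<Gamma>\<^sub>1"
    and theta_phi: "x \<in> points \<Gamma>\<^sub>1 \<Longrightarrow> \<theta> (\<phi> x) = x"
    and phi_theta: "y \<in> points \<Gamma>\<^sub>2 \<Longrightarrow> \<phi> (\<theta> y) = y"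
    and rat_push: "A.rat f \<Longrightarrow> B.rat (\<lambda>y\<in>points \<Gamma>\<^sub>2. ereal r * f (\<theta> y))"
    and rat_pull: "B.rat g \<Longrightarrow> A.rat (\<lambda>x\<in>points \<Gamma>\<^sub>1. ereal (1 / r) * g (\<phi> x))"
begin

lemma inverse_pair: "scaled_pair \<Gamma>\<^sub>2 \<Gamma>\<^sub>1 (1 / r) \<theta> \<phi>"
  by unfold_locales (use r_pos phi_mem theta_mem theta_phi phi_theta rat_push rat_pull in simp_all)

text \<open>
  A point \<open>y\<close> outside the open set \<open>U\<close> is separated from \<open>\<phi> x\<close> by a rational function \<open>h\<close> that vanishes at \<open>\<phi> x\<close>. Since
  \<open>h \<circ> \<phi>\<close> is a multiple of a rational function, it is continuous, and \<open>\<phi>\<close> keeps a neighbourhood of \<open>x\<close> away from a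
  neighbourhood of \<open>y\<close>. Finitely many of the latter, together with \<open>U\<close>, cover the second curve.
\<close>
lemma phi_continuous: "continuous_map A.top_curve B.top_curve \<phi>"
  unfolding continuous_map_def A.topspace_curve B.topspace_curve
proof (intro conjI allI impI)
  show "\<phi> \<in> points \<Gamma>\<^sub>1 \<rightarrow> points \<Gamma>\<^sub>2" using phi_mem by simp
  fix U assume U: "openin B.top_curve U"
  show "openin A.top_curve {x \<in> points \<Gamma>\<^sub>1. \<phi> x \<in> U}"
  proof (subst openin_subopen, rule ballI)
    fix x assume "x \<in> {x \<in> points \<Gamma>\<^sub>1. \<phi> x \<in> U}"
    then have x: "x \<in> points \<Gamma>\<^sub>1" "\<phi> x \<in> U" by simp_all
    \<comment> \<open>on \<open>N\<close> the map \<open>\<phi>\<close> does not enter \<open>W\<close>, unless it is in \<open>U\<close>\<close>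
    define good where "good N W \<longleftrightarrow> openin A.top_curve N \<and> x \<in> N \<and> (\<forall>z\<in>N. \<phi> z \<in> W \<longrightarrow> \<phi> z \<in> U)" for N W
    define \<U> where "\<U> = {W. openin B.top_curve W \<and> (\<exists>N. good N W)}"
    have "\<forall>W\<in>\<U>. openin B.top_curve W" by (simp add: \<U>_def)
    moreover have "topspace B.top_curve \<subseteq> \<Union>\<U>"
    proof
      fix y assume "y \<in> topspace B.top_curve"
      then have y: "y \<in> points \<Gamma>\<^sub>2" by (simp add: B.topspace_curve)
      show "y \<in> \<Union>\<U>"
      proof (cases "y \<in> U")
        case True
        have "openin A.top_curve (points \<Gamma>\<^sub>1)" using openin_topspace[of A.top_curve] by (simp add: A.topspace_curve)
        then have "good (points \<Gamma>\<^sub>1) U" using x(1) by (simp add: good_def)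
        then have "U \<in> \<U>" using U by (auto simp: \<U>_def)
        then show ?thesis using True by (rule UnionI)
      next
        case False
        then have ne: "\<phi> x \<noteq> y" using x(2) by auto
        obtain f where f: "B.bounded_rat f" "f (\<phi> x) \<noteq> f y"
          by (rule B.bounded_rat_separates[OF phi_mem[OF x(1)] y ne])
        obtain v where v: "f (\<phi> x) = ereal v" using B.bounded_rat_finite[OF f(1) phi_mem[OF x(1)]] by (cases "f (\<phi> x)") auto
        obtain w where w: "f y = ereal w" using B.bounded_rat_finite[OF f(1) y] by (cases "f y") auto
        define h where "h = (\<lambda>z\<in>points \<Gamma>\<^sub>2. \<bar>f z - ereal v\<bar>)"
        define \<delta> where "\<delta> = \<bar>w - v\<bar> / 2"
        have \<delta>: "0 < \<delta>" using f(2) v w by (auto simp: \<delta>_def)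
        have h: "B.bounded_rat h" unfolding h_def by (rule B.bounded_rat_abs_diff[OF f(1)])
        have hx: "h (\<phi> x) = 0" using phi_mem[OF x(1)] v by (simp add: h_def)
        have hy: "h y = ereal \<bar>w - v\<bar>" using y w by (simp add: h_def)
        define k where "k = (\<lambda>x\<in>points \<Gamma>\<^sub>1. ereal (1 / r) * h (\<phi> x))"
        have k: "A.rat k" unfolding k_def by (rule rat_pull[OF B.bounded_rat_rat[OF h]])
        define W where "W = {z \<in> topspace B.top_curve. h z \<in> {ereal \<delta><..}}"
        define N where "N = {z \<in> topspace A.top_curve. k z \<in> {..<ereal (\<delta> / r)}}"
        have "openin B.top_curve W" unfolding W_def
          by (rule openin_continuous_map_preimage[OF B.rat_continuous[OF B.bounded_rat_rat[OF h]]]) simp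
        moreover have "openin A.top_curve N" unfolding N_def
          by (rule openin_continuous_map_preimage[OF A.rat_continuous[OF k]]) simp
        moreover have "x \<in> N" using x(1) hx \<delta> r_pos by (simp add: N_def A.topspace_curve k_def)
        moreover have "\<forall>z\<in>N. \<phi> z \<notin> W"
        proof
          fix z assume "z \<in> N"
          then have z: "z \<in> points \<Gamma>\<^sub>1" "k z < ereal (\<delta> / r)" by (simp_all add: N_def A.topspace_curve)
          obtain u where u: "h (\<phi> z) = ereal u" using B.bounded_rat_finite[OF h phi_mem[OF z(1)]] by (cases "h (\<phi> z)") auto
          have "u / r < \<delta> / r" using z u by (simp add: k_def)
          then have "u < \<delta>" using r_pos by (simp add: divide_less_cancel)
          then show "\<phi> z \<notin> W" using u by (simp add: W_def)
        qed
        ultimately have "W \<in> \<U>" unfolding \<U>_def good_def by blast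
        moreover have "y \<in> W" using y hy \<delta> by (simp add: W_def B.topspace_curve \<delta>_def)
        ultimately show ?thesis by (rule UnionI)
      qed
    qed
    ultimately obtain \<F> where F: "finite \<F>" "\<F> \<subseteq> \<U>" "topspace B.top_curve \<subseteq> \<Union>\<F>"
      using B.compact_curve[unfolded compact_space_alt, rule_format, of \<U>] by blast
    have "\<exists>N. good N (\<Union>\<F>)" using F(1,2)
    proof (induction \<F> rule: finite_induct)
      case empty
      have "openin A.top_curve (points \<Gamma>\<^sub>1)" using openin_topspace[of A.top_curve] by (simp add: A.topspace_curve)
      then show ?case using x(1) by (auto simp: good_def)
    next
      case (insert W \<F>)
      then obtain N M where N: "good N (\<Union>\<F>)" and M: "good M W" by (auto simp: \<U>_def)
      have "good (N \<inter> M) (\<Union>(insert W \<F>))" using N M by (auto simp: good_def)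
      then show ?case by blast
    qed
    then obtain N where N: "good N (\<Union>\<F>)" by blast
    have Nsub: "N \<subseteq> points \<Gamma>\<^sub>1" using N openin_subset[of A.top_curve N] by (simp add: good_def A.topspace_curve)
    have "N \<subseteq> {x \<in> points \<Gamma>\<^sub>1. \<phi> x \<in> U}"
    proof
      fix z assume z: "z \<in> N"
      then have zp: "z \<in> points \<Gamma>\<^sub>1" using Nsub by blast
      have "\<phi> z \<in> \<Union>\<F>" using F(3)[unfolded B.topspace_curve] phi_mem[OF zp] by (rule subsetD)
      then show "z \<in> {x \<in> points \<Gamma>\<^sub>1. \<phi> x \<in> U}" using N z zp by (simp add: good_def)
    qed
    then show "\<exists>T. openin A.top_curve T \<and> x \<in> T \<and> T \<subseteq> {x \<in> points \<Gamma>\<^sub>1. \<phi> x \<in> U}"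
      using N by (intro exI[of _ N]) (simp add: good_def)
  qed
qed

text \<open>
  The chip-firing move of a tail takes the value \<open>-\<infinity>\<close> at \<open>x\<close>, hence its image does so at \<open>\<phi> x\<close>. At finite points rational
  functions are finite.
\<close>
lemma phi_infinite:
  assumes "x \<in> inf_points \<Gamma>\<^sub>1" shows "\<phi> x \<in> inf_points \<Gamma>\<^sub>2"
proof -
  interpret S: curve_model \<Gamma>\<^sub>1 \<Gamma>\<^sub>1 by (rule curve_model_refl) (unfold_locales)
  have x: "x \<in> points \<Gamma>\<^sub>1" using assms A.inf_subset by blast
  obtain e where e: "e \<in> A.E" "A.L e = \<infinity>" "x = A.ch e \<infinity>" using assms by (rule A.inf_pointE)
  define f where "f = CF \<Gamma>\<^sub>1 (points \<Gamma>\<^sub>1 - A.tail e 0) \<infinity>"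
  have f: "A.rat f" unfolding f_def by (rule S.rat_CF_tail[OF e(1,2) order_refl])
  have "f x = - A.tail_dist e 0 x" using S.CF_tail[OF e(1,2) order_refl] x by (simp add: f_def)
  then have fx: "f x = -\<infinity>" using A.tail_dist_infinite[OF e(1,2) order_refl x] e(3) by simp
  have p: "\<phi> x \<in> points \<Gamma>\<^sub>2" by (rule phi_mem[OF x])
  have "(\<lambda>y\<in>points \<Gamma>\<^sub>2. ereal r * f (\<theta> y)) (\<phi> x) = -\<infinity>" using p theta_phi[OF x] fx r_pos by simp
  then have "\<phi> x \<notin> fin_points \<Gamma>\<^sub>2" using B.rat_finite[OF rat_push[OF f], of "\<phi> x"] by auto
  then show ?thesis using p by (simp add: fin_points_def)
qed

lemma phi_inf_iff:
  assumes x: "x \<in> points \<Gamma>\<^sub>1" shows "\<phi> x \<in> inf_points \<Gamma>\<^sub>2 \<longleftrightarrow> x \<in> inf_points \<Gamma>\<^sub>1"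
proof -
  interpret I: scaled_pair \<Gamma>\<^sub>2 \<Gamma>\<^sub>1 "1 / r" \<theta> \<phi> by (rule inverse_pair)
  show ?thesis using phi_infinite[of x] I.phi_infinite[of "\<phi> x"] theta_phi[OF x] by auto
qed

lemma phi_fin_iff: "x \<in> points \<Gamma>\<^sub>1 \<Longrightarrow> \<phi> x \<in> fin_points \<Gamma>\<^sub>2 \<longleftrightarrow> x \<in> fin_points \<Gamma>\<^sub>1"
  using phi_inf_iff phi_mem by (simp add: fin_points_def)

end

context curve begin

lemma openin_chart_interval:
  assumes e: "e \<in> E" and ab: "0 \<le> a" "b \<le> L e"
  shows "openin top_curve (ch e ` {a<..<b})"
  unfolding openin_curve_topology
proof (intro conjI ballI)
  have sub: "{a<..<b} \<subseteq> {0<..<L e}"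
    using ab by (auto intro: le_less_trans less_le_trans)
  show "ch e ` {a<..<b} \<subseteq> points \<Gamma>"
  proof
    fix x assume "x \<in> ch e ` {a<..<b}"
    then obtain t where t: "t \<in> {a<..<b}" "x = ch e t" by blast
    have "t \<in> {0<..<L e}" using sub t(1) by (rule subsetD)
    then show "x \<in> points \<Gamma>" using chart_in_points[OF e, of t] t(2) by (simp add: less_imp_le)
  qed
  fix e' assume e': "e' \<in> E"
  have "{t \<in> {0..L e'}. ch e' t \<in> ch e ` {a<..<b}} = {0..L e'} \<inter> (if e' = e then {a<..<b} else {})"
  proof (rule Set.set_eqI)
    fix t
    show "t \<in> {t \<in> {0..L e'}. ch e' t \<in> ch e ` {a<..<b}} \<longleftrightarrow> t \<in> {0..L e'} \<inter> (if e' = e then {a<..<b} else {})"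
    proof
      assume t: "t \<in> {t \<in> {0..L e'}. ch e' t \<in> ch e ` {a<..<b}}"
      then obtain u where u: "u \<in> {a<..<b}" "ch e' t = ch e u" by blast
      have "e' = e \<and> t = u" using interior_unique[OF e subsetD[OF sub u(1)] e', of t] t u(2) by simp
      then show "t \<in> {0..L e'} \<inter> (if e' = e then {a<..<b} else {})" using t u(1) by simp
    next
      assume "t \<in> {0..L e'} \<inter> (if e' = e then {a<..<b} else {})"
      then show "t \<in> {t \<in> {0..L e'}. ch e' t \<in> ch e ` {a<..<b}}" by (simp split: if_splits)
    qed
  qed
  then show "openin (top_of_set {0..L e'}) {t \<in> {0..L e'}. ch e' t \<in> ch e ` {a<..<b}}"
    by (simp only:) (intro openin_open_Int, simp)
qed

lemma open_contains_germ:
  assumes U: "openin top_curve U" and e: "e \<in> E" and t: "0 \<le> t" "ereal t < L e" "ch e (ereal t) \<in> U"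
  shows "eventually (\<lambda>u. ch e (ereal u) \<in> U) (at_right t)"
proof -
  have "openin (top_of_set {0..L e}) {t \<in> {0..L e}. ch e t \<in> U}"
    using U e unfolding openin_curve_topology by simp
  then obtain W where W: "open W" "{t \<in> {0..L e}. ch e t \<in> U} = {0..L e} \<inter> W"
    unfolding openin_open by (elim exE conjE)
  have "ereal t \<in> {t \<in> {0..L e}. ch e t \<in> U}" using t by (simp add: less_imp_le)
  then have tW: "ereal t \<in> W" using W(2) by blast
  have F: "at_right t \<in> edge_filters (L e)" using t by (auto simp: edge_filters_def)
  have "open (ereal -` W)" using W(1) by (rule open_ereal_vimage)
  then have "eventually (\<lambda>u. u \<in> ereal -` W) (nhds t)" using tW by (intro eventually_nhds_in_open) simp_all
  then have "eventually (\<lambda>u. u \<in> ereal -` W) (at_right t)"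
    by (rule filter_leD[rotated]) (simp add: at_within_def)
  then show ?thesis using edge_filter_inside[OF F len_pos[OF e]]
  proof eventually_elim
    case (elim u)
    then have "ereal u \<in> {0..L e} \<inter> W" by (simp add: less_imp_le)
    then have "ereal u \<in> {t \<in> {0..L e}. ch e t \<in> U}" using W(2) by blast
    then show ?case by simp
  qed
qed

lemma infinite_set_meets_interior:
  assumes "infinite U" "U \<subseteq> points \<Gamma>"
  obtains e t where "e \<in> E" "0 < t" "ereal t < L e" "ch e (ereal t) \<in> U"
proof -
  have "\<not> U \<subseteq> V" using assms(1) finite_V finite_subset by blast
  then obtain x where x: "x \<in> U" "x \<notin> V" by blast
  then have "x \<in> points \<Gamma>" using assms(2) by blast
  then show ?thesis
  proof (cases rule: points_cases)
    case (2 e t)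
    then obtain u where "t = ereal u" by (cases t) auto
    then show ?thesis using that[of e u] 2 x by simp
  qed (use x in simp)
qed

end

context scaled_pair begin

text \<open>
  Let \<open>u\<close> have slope \<open>m\<close> on an interval. On a smaller one there is a function \<open>g\<close> of slope \<open>\<plusminus>1\<close>, so that
  \<open>u = \<plusminus>m * g + const\<close> on the corresponding open set \<open>U\<close>. On the image of \<open>U\<close>, which is open too, this becomes
  a relation between the distance to \<open>a'\<close> and \<open>\<plusminus>m\<close> times a rational function. Comparing slopes at some interior point of
  an edge, \<open>m\<close> divides the slope of the distance to \<open>a'\<close>, that is, 1 or -1.
\<close>
lemma slope_unit:
  assumes a': "a' \<in> fin_points \<Gamma>\<^sub>2"
  shows "A.slopes_in {-1, 1} (\<lambda>x\<in>points \<Gamma>\<^sub>1. ereal (1 / r) * CF \<Gamma>\<^sub>2 {a'} \<infinity> (\<phi> x))"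
  (is "A.slopes_in _ ?u")
  unfolding A.slopes_in_def
proof (intro ballI allI impI; elim conjE)
  interpret I: scaled_pair \<Gamma>\<^sub>2 \<Gamma>\<^sub>1 "1 / r" \<theta> \<phi> by (rule inverse_pair)
  fix e a b m c assume e: "e \<in> A.E" and ab: "0 \<le> a" "a < b" "ereal b \<le> A.L e"
    and aff: "\<forall>t. a < t \<and> t < b \<longrightarrow> ?u (A.ch e (ereal t)) = ereal (of_int m * t + c)"
  obtain x0 where x0: "x0 \<in> fin_points \<Gamma>\<^sub>1" using A.fin_points_nonempty by (auto simp: ex_in_conv[symmetric])
  define g where "g = CF \<Gamma>\<^sub>1 {x0} \<infinity>"
  have g: "A.rat g" unfolding g_def by (rule A.rat_CF_inf[OF x0])
  have gv: "g x = - cdist \<Gamma>\<^sub>1 x0 x" if "x \<in> points \<Gamma>\<^sub>1" for x using that by (simp add: g_def A.CF_point)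
  have aL: "ereal a < A.L e" using ab(2,3) less_le_trans[of "ereal a" "ereal b" "A.L e"] by simp
  have F: "at_right a \<in> edge_filters (A.L e)" using ab(1) aL by (auto simp: edge_filters_def)
  obtain n d where n: "n \<in> {1, -1}" and ev: "eventually (\<lambda>u. cdist \<Gamma>\<^sub>1 x0 (A.ch e (ereal u)) = ereal (of_int n * u + d)) (at_right a)"
    using A.cdist_chart_germ[OF e x0 F] unfolding affine_germ_def by blast
  from ev obtain b' where b': "a < b'" "\<And>u. a < u \<Longrightarrow> u < b' \<Longrightarrow> cdist \<Gamma>\<^sub>1 x0 (A.ch e (ereal u)) = ereal (of_int n * u + d)"
    unfolding eventually_at_right_field by blast
  define q where "q = min b b'"
  have q: "a < q" "q \<le> b" "q \<le> b'" using ab(2) b'(1) by (auto simp: q_def)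
  have qL: "ereal q \<le> A.L e" using q(2) ab(3) order_trans[of "ereal q" "ereal b" "A.L e"] by simp
  define U where "U = A.ch e ` {ereal a<..<ereal q}"
  have U: "openin A.top_curve U" unfolding U_def by (rule A.openin_chart_interval[OF e]) (use ab(1) qL in simp_all)
  have Usub: "U \<subseteq> points \<Gamma>\<^sub>1" using openin_subset[OF U] by (simp add: A.topspace_curve)
  have n2: "of_int n * of_int n = (1::real)" using n by auto
  \<comment> \<open>\<open>g\<close> has slope \<open>- n\<close> on \<open>U\<close> and \<open>n * n = 1\<close>, so slope \<open>m\<close> is slope \<open>- n\<close> times \<open>- (m * n)\<close>\<close>
  have on_U: "?u x = ereal (- (of_int m * of_int n)) * g x + ereal (c - of_int m * of_int n * d)" if xU: "x \<in> U" for x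
  proof -
    obtain t where t: "ereal a < t" "t < ereal q" "x = A.ch e t" using xU unfolding U_def by auto
    then obtain s where s: "t = ereal s" by (cases t) auto
    have xp: "x \<in> points \<Gamma>\<^sub>1" using Usub xU by (rule subsetD)
    have gx: "g x = ereal (- (of_int n * s + d))" using gv[OF xp] b'(2)[of s] t s q by simp
    have ux: "?u x = ereal (of_int m * s + c)" using aff[rule_format, of s] t s q by simp
    have "- (of_int m * of_int n) * - (of_int n * s + d) + (c - of_int m * of_int n * d) = of_int m * (of_int n * of_int n) * s + c"
      by (simp add: algebra_simps)
    then show ?thesis unfolding gx ux by (simp only: times_ereal.simps plus_ereal.simps n2) simp
  qed
  \<comment> \<open>the image of \<open>U\<close> under \<open>\<phi>\<close>; it is infinite, so it contains more than vertices\<close>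
  define W where "W = {y \<in> topspace B.top_curve. \<theta> y \<in> U}"
  have W: "openin B.top_curve W" unfolding W_def
    by (rule openin_continuous_map_preimage[OF I.phi_continuous U])
  have Wsub: "W \<subseteq> points \<Gamma>\<^sub>2" by (auto simp: W_def B.topspace_curve)
  have "infinite U"
  proof -
    have sub: "{ereal a<..<ereal q} \<subseteq> {0<..<A.L e}"
    proof
      fix t assume "t \<in> {ereal a<..<ereal q}"
      then show "t \<in> {0<..<A.L e}"
        using ab(1) qL le_less_trans[of 0 "ereal a" t] less_le_trans[of t "ereal q" "A.L e"] by simp
    qed
    have "inj_on (A.ch e) {ereal a<..<ereal q}" using A.inj_interior[OF e] sub by (rule inj_on_subset)
    moreover have "infinite {ereal a<..<ereal q}" using q(1) by (intro infinite_Ioo) simp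
    ultimately show ?thesis unfolding U_def by (simp add: finite_image_iff)
  qed
  moreover have "inj_on \<phi> U" by (rule inj_on_inverseI[of _ \<theta>]) (rule theta_phi, rule subsetD[OF Usub])
  ultimately have infU: "infinite (\<phi> ` U)" by (simp add: finite_image_iff)
  have "\<phi> ` U \<subseteq> W"
  proof
    fix y assume "y \<in> \<phi> ` U"
    then obtain x where "x \<in> U" "y = \<phi> x" by blast
    then show "y \<in> W" using subsetD[OF Usub, of x] phi_mem[of x] theta_phi[of x] by (simp add: W_def B.topspace_curve)
  qed
  then have "infinite W" using infU by (rule infinite_super)
  then obtain e' t where e': "e' \<in> B.E" and t: "0 < t" "ereal t < B.L e'" "B.ch e' (ereal t) \<in> W"
    by (rule B.infinite_set_meets_interior[OF _ Wsub])
  have F': "at_right t \<in> edge_filters (B.L e')" using t by (auto simp: edge_filters_def)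
  have inW: "eventually (\<lambda>u. B.ch e' (ereal u) \<in> W) (at_right t)"
    by (rule B.open_contains_germ[OF W e' less_imp_le[OF t(1)] t(2,3)])
  obtain n' d' where n': "n' \<in> {1, -1}" and ev1: "eventually (\<lambda>u. cdist \<Gamma>\<^sub>2 a' (B.ch e' (ereal u)) = ereal (of_int n' * u + d')) (at_right t)"
    using B.cdist_chart_germ[OF e' a' F'] unfolding affine_germ_def by blast
  obtain k l where ev2: "eventually (\<lambda>u. (\<lambda>y\<in>points \<Gamma>\<^sub>2. ereal r * g (\<theta> y)) (B.ch e' (ereal u)) = ereal (of_int k * u + l)) (at_right t)"
    using B.rat_germ[OF rat_push[OF g] e' F'] unfolding affine_germ_def by blast
  have "eventually (\<lambda>u. of_int (- n') * u + (- d') =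
      of_int (- (m * n) * k) * u + (- (of_int m * of_int n) * l + r * (c - of_int m * of_int n * d))) (at_right t)"
    using inW ev1 ev2
  proof eventually_elim
    case (elim u)
    let ?y = "B.ch e' (ereal u)"
    have y: "?y \<in> points \<Gamma>\<^sub>2" using elim(1) Wsub by blast
    have ty: "\<theta> ?y \<in> U" using elim(1) by (simp add: W_def)
    have typt: "\<theta> ?y \<in> points \<Gamma>\<^sub>1" using ty Usub by blast
    have "ereal (1 / r) * CF \<Gamma>\<^sub>2 {a'} \<infinity> ?y = ?u (\<theta> ?y)" using typt phi_theta[OF y] by simp
    then have 1: "ereal (1 / r) * ereal (- (of_int n' * u + d')) = ?u (\<theta> ?y)"
      using y elim(2) by (simp add: B.CF_point)
    have 2: "ereal r * g (\<theta> ?y) = ereal (of_int k * u + l)" using elim(3) y by simp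
    obtain w where w: "g (\<theta> ?y) = ereal w" using 2 r_pos by (cases "g (\<theta> ?y)") auto
    have w': "r * w = of_int k * u + l" using 2 w by simp
    have "ereal (1 / r) * ereal (- (of_int n' * u + d')) = ereal (- (of_int m * of_int n)) * ereal w + ereal (c - of_int m * of_int n * d)"
      unfolding 1 on_U[OF ty] w ..
    then have "(1 / r) * (- (of_int n' * u + d')) = - (of_int m * of_int n) * w + (c - of_int m * of_int n * d)"
      by (simp only: times_ereal.simps plus_ereal.simps ereal.inject)
    then have "r * ((1 / r) * (- (of_int n' * u + d'))) = r * (- (of_int m * of_int n) * w + (c - of_int m * of_int n * d))"
      by simp
    then have "- (of_int n' * u + d') = - (of_int m * of_int n) * (r * w) + r * (c - of_int m * of_int n * d)"
      using r_pos by (simp add: algebra_simps)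
    then show ?case unfolding w' by (simp add: algebra_simps)
  qed
  then have "real_of_int (- n') = real_of_int (- (m * n) * k)"
    by (rule affine_slope_unique[OF F' B.len_pos[OF e']])
  then have "- n' = - (m * n) * k" by (simp only: of_int_eq_iff)
  then have "m dvd n'" by (auto simp: dvd_def mult.assoc)
  then have "m dvd 1" using n' by auto
  then show "m \<in> {-1, 1}" by auto
qed

text \<open>
  The function \<open>u\<close> vanishes at \<open>x\<close>, equals \<open>- cdist (\<phi> x) (\<phi> y) / r\<close> at \<open>y\<close>, and is 1-Lipschitz by \<open>slope_unit\<close>.
\<close>
lemma cdist_phi_le:
  assumes x: "x \<in> fin_points \<Gamma>\<^sub>1" and y: "y \<in> fin_points \<Gamma>\<^sub>1"
  shows "cdist \<Gamma>\<^sub>2 (\<phi> x) (\<phi> y) \<le> ereal r * cdist \<Gamma>\<^sub>1 x y"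
proof -
  let ?u = "\<lambda>z\<in>points \<Gamma>\<^sub>1. ereal (1 / r) * CF \<Gamma>\<^sub>2 {\<phi> x} \<infinity> (\<phi> z)"
  have xp: "x \<in> points \<Gamma>\<^sub>1" "y \<in> points \<Gamma>\<^sub>1" using x y A.fin_subset by auto
  have px: "\<phi> x \<in> fin_points \<Gamma>\<^sub>2" "\<phi> y \<in> fin_points \<Gamma>\<^sub>2" using phi_fin_iff xp x y by auto
  have u: "A.rat ?u" by (rule rat_pull[OF B.rat_CF_inf[OF px(1)]])
  have le: "?u x - ?u y \<le> cdist \<Gamma>\<^sub>1 x y"
    by (rule A.rat_lipschitz_cdist[OF u x y slope_unit[OF px(1)]])
  obtain d where d: "cdist \<Gamma>\<^sub>2 (\<phi> x) (\<phi> y) = ereal d" by (rule B.cdist_realE[OF px])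
  obtain d' where d': "cdist \<Gamma>\<^sub>1 x y = ereal d'" by (rule A.cdist_realE[OF x y])
  have "?u x = 0" using xp(1) phi_mem[OF xp(1)] B.cdist_self[OF phi_mem[OF xp(1)]] by (simp add: B.CF_point)
  moreover have "?u y = ereal (- d / r)" using xp(2) phi_mem[OF xp(2)] d by (simp add: B.CF_point)
  ultimately have "d / r \<le> d'" using le d' by simp
  then show ?thesis using d d' r_pos by (simp add: field_simps)
qed

lemma cdist_phi:
  assumes x: "x \<in> points \<Gamma>\<^sub>1" and y: "y \<in> points \<Gamma>\<^sub>1"
  shows "cdist \<Gamma>\<^sub>2 (\<phi> x) (\<phi> y) = ereal r * cdist \<Gamma>\<^sub>1 x y"
proof (cases "x \<in> fin_points \<Gamma>\<^sub>1 \<and> y \<in> fin_points \<Gamma>\<^sub>1")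
  case True
  interpret I: scaled_pair \<Gamma>\<^sub>2 \<Gamma>\<^sub>1 "1 / r" \<theta> \<phi> by (rule inverse_pair)
  have f: "\<phi> x \<in> fin_points \<Gamma>\<^sub>2" "\<phi> y \<in> fin_points \<Gamma>\<^sub>2" using True phi_fin_iff x y by auto
  have "cdist \<Gamma>\<^sub>1 x y \<le> ereal (1 / r) * cdist \<Gamma>\<^sub>2 (\<phi> x) (\<phi> y)"
    using I.cdist_phi_le[OF f] theta_phi x y by simp
  moreover have "cdist \<Gamma>\<^sub>2 (\<phi> x) (\<phi> y) \<le> ereal r * cdist \<Gamma>\<^sub>1 x y" using True cdist_phi_le by simp
  moreover obtain d where d: "cdist \<Gamma>\<^sub>2 (\<phi> x) (\<phi> y) = ereal d" by (rule B.cdist_realE[OF f])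
  moreover obtain d' where d': "cdist \<Gamma>\<^sub>1 x y = ereal d'" by (rule A.cdist_realE[OF conjunct1[OF True] conjunct2[OF True]])
  ultimately have "d' \<le> d / r" "d \<le> r * d'" by simp_all
  then have "d = r * d'" using r_pos by (simp add: field_simps)
  then show ?thesis using d d' by simp
next
  case False
  then have inf: "x \<in> inf_points \<Gamma>\<^sub>1 \<or> y \<in> inf_points \<Gamma>\<^sub>1" using x y by (auto simp: fin_points_def)
  show ?thesis
  proof (cases "x = y")
    case True
    then show ?thesis using A.cdist_self[OF x] B.cdist_self[OF phi_mem[OF x]] by simp
  next
    case ne: False
    then have "\<phi> x \<noteq> \<phi> y" using theta_phi[OF x] theta_phi[OF y] by metis
    then have "cdist \<Gamma>\<^sub>2 (\<phi> x) (\<phi> y) = \<infinity>"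
      using inf phi_inf_iff[OF x] phi_inf_iff[OF y] by (intro B.cdist_infinity phi_mem x y) auto
    moreover have "cdist \<Gamma>\<^sub>1 x y = \<infinity>" by (rule A.cdist_infinity[OF x y inf ne])
    ultimately show ?thesis using r_pos by simp
  qed
qed

lemma bij_points: "bij_betw \<phi> (points \<Gamma>\<^sub>1) (points \<Gamma>\<^sub>2)"
  by (rule bij_betw_byWitness[where f' = \<theta>]) (use phi_mem theta_mem theta_phi phi_theta in auto)

lemma expansive: "expansive_map r \<Gamma>\<^sub>1 \<Gamma>\<^sub>2 \<phi>"
  unfolding expansive_map_def
proof (intro conjI ballI r_pos phi_continuous bij_points)
  interpret I: scaled_pair \<Gamma>\<^sub>2 \<Gamma>\<^sub>1 "1 / r" \<theta> \<phi> by (rule inverse_pair)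
  have "\<phi> x \<in> fin_points \<Gamma>\<^sub>2 \<and> \<theta> (\<phi> x) = x" if "x \<in> fin_points \<Gamma>\<^sub>1" for x
    using that phi_fin_iff[of x] theta_phi[of x] subsetD[OF A.fin_subset, of x] by simp
  moreover have "\<theta> y \<in> fin_points \<Gamma>\<^sub>1 \<and> \<phi> (\<theta> y) = y" if "y \<in> fin_points \<Gamma>\<^sub>2" for y
    using that I.phi_fin_iff[of y] phi_theta[of y] subsetD[OF B.fin_subset, of y] by simp
  ultimately show "bij_betw \<phi> (fin_points \<Gamma>\<^sub>1) (fin_points \<Gamma>\<^sub>2)"
    by (intro bij_betw_byWitness[where f' = \<theta>]) auto
  fix x y assume "x \<in> fin_points \<Gamma>\<^sub>1" "y \<in> fin_points \<Gamma>\<^sub>1"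
  then show "ereal r * cdist \<Gamma>\<^sub>1 x y = cdist \<Gamma>\<^sub>2 (\<phi> x) (\<phi> y)"
    using cdist_phi[of x y] subsetD[OF A.fin_subset] by simp
qed

end

section \<open>The map induced by an isomorphism\<close>

locale induced_pair = scaled_pair +
  fixes \<psi> :: "('a \<Rightarrow> ereal) \<Rightarrow> ('b \<Rightarrow> ereal)"
  assumes psi_eq: "A.rat f \<Longrightarrow> y \<in> points \<Gamma>\<^sub>2 \<Longrightarrow> \<psi> f y = ereal r * f (\<theta> y)"
    and psi_ext: "A.rat f \<Longrightarrow> \<psi> f \<in> extensional (points \<Gamma>\<^sub>2)"
begin

lemma psi_CF_point:
  assumes x: "x \<in> fin_points \<Gamma>\<^sub>1" and \<epsilon>: "0 < \<epsilon>"
  shows "\<psi> (CF \<Gamma>\<^sub>1 {x} (ereal \<epsilon>)) = CF \<Gamma>\<^sub>2 {\<phi> x} (ereal (r * \<epsilon>))"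
proof (rule extensionalityI)
  have rat: "A.rat (CF \<Gamma>\<^sub>1 {x} (ereal \<epsilon>))" by (rule A.bounded_rat_rat[OF A.bounded_rat_CF[OF x \<epsilon>]])
  show "\<psi> (CF \<Gamma>\<^sub>1 {x} (ereal \<epsilon>)) \<in> extensional (points \<Gamma>\<^sub>2)" by (rule psi_ext[OF rat])
  show "CF \<Gamma>\<^sub>2 {\<phi> x} (ereal (r * \<epsilon>)) \<in> extensional (points \<Gamma>\<^sub>2)" by (simp add: CF_def)
  fix y assume y: "y \<in> points \<Gamma>\<^sub>2"
  have xp: "x \<in> points \<Gamma>\<^sub>1" using x A.fin_subset by blast
  have d: "cdist \<Gamma>\<^sub>2 (\<phi> x) y = ereal r * cdist \<Gamma>\<^sub>1 x (\<theta> y)"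
    using cdist_phi[OF xp theta_mem[OF y]] phi_theta[OF y] by simp
  have "\<psi> (CF \<Gamma>\<^sub>1 {x} (ereal \<epsilon>)) y = ereal r * (- min (ereal \<epsilon>) (cdist \<Gamma>\<^sub>1 x (\<theta> y)))"
    using psi_eq[OF rat y] theta_mem[OF y] by (simp add: A.CF_point)
  also have "\<dots> = - min (ereal (r * \<epsilon>)) (ereal r * cdist \<Gamma>\<^sub>1 x (\<theta> y))"
  proof (cases "cdist \<Gamma>\<^sub>1 x (\<theta> y)")
    case (real c)
    have "r * min \<epsilon> c = min (r * \<epsilon>) (r * c)" using r_pos by (simp add: min_mult_distrib_left)
    then show ?thesis using real r_pos by (auto simp: min_def)
  qed (use r_pos A.cdist_nonneg[of x "\<theta> y"] in auto)
  finally show "\<psi> (CF \<Gamma>\<^sub>1 {x} (ereal \<epsilon>)) y = CF \<Gamma>\<^sub>2 {\<phi> x} (ereal (r * \<epsilon>)) y"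
    using y d by (simp add: B.CF_point)
qed

text \<open>
  For uniqueness, evaluate two chip-firing moves with the same image at \<open>\<phi> x\<close>: the move at \<open>x'\<close> vanishes only
  at \<open>x'\<close>.
\<close>
lemma corresponding_finite_phi:
  assumes x: "x \<in> fin_points \<Gamma>\<^sub>1"
  shows "corresponding_finite \<Gamma>\<^sub>1 \<Gamma>\<^sub>2 \<psi> r x x' \<longleftrightarrow> x' = \<phi> x"
proof
  have xp: "x \<in> points \<Gamma>\<^sub>1" using x A.fin_subset by blast
  have px: "\<phi> x \<in> fin_points \<Gamma>\<^sub>2" using phi_fin_iff[OF xp] x by simp
  { assume "x' = \<phi> x"
    then show "corresponding_finite \<Gamma>\<^sub>1 \<Gamma>\<^sub>2 \<psi> r x x'"
      unfolding corresponding_finite_def using px psi_CF_point[OF x, of 1]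
      by (intro conjI exI[of _ 1]) simp_all }
  assume "corresponding_finite \<Gamma>\<^sub>1 \<Gamma>\<^sub>2 \<psi> r x x'"
  then obtain \<epsilon> where x': "x' \<in> fin_points \<Gamma>\<^sub>2" and \<epsilon>: "0 < \<epsilon>"
    and eq: "\<psi> (CF \<Gamma>\<^sub>1 {x} (ereal \<epsilon>)) = CF \<Gamma>\<^sub>2 {x'} (ereal (r * \<epsilon>))"
    unfolding corresponding_finite_def by blast
  have "CF \<Gamma>\<^sub>2 {x'} (ereal (r * \<epsilon>)) (\<phi> x) = CF \<Gamma>\<^sub>2 {\<phi> x} (ereal (r * \<epsilon>)) (\<phi> x)"
    using eq psi_CF_point[OF x \<epsilon>] by simp
  moreover have re: "0 < r * \<epsilon>" using r_pos \<epsilon> by simp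
  ultimately have "min (ereal (r * \<epsilon>)) (cdist \<Gamma>\<^sub>2 x' (\<phi> x)) = 0"
    using phi_mem[OF xp] B.cdist_self[OF phi_mem[OF xp]] by (simp add: B.CF_point min_def)
  then have "cdist \<Gamma>\<^sub>2 x' (\<phi> x) = 0" using re by (auto simp: min_def split: if_splits)
  then show "x' = \<phi> x"
    using B.cdist_eq_0_iff[OF subsetD[OF B.fin_subset x'] phi_mem[OF xp]] by simp
qed

text \<open>
  A tail is connected and its starting point separates it from the rest of the curve. So a homeomorphism that maps the
  starting point and the point at infinity of one tail to those of another maps the tail into the other; its inverse
  does the same.
\<close>
lemma tail_image:
  assumes "curve_model \<Gamma>\<^sub>1 C" "curve_model \<Gamma>\<^sub>2 D"
    and e: "e \<in> edges C" "len C e = \<infinity>" and e': "e' \<in> edges D" "len D e' = \<infinity>"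
    and s: "0 \<le> s" and s': "0 \<le> s'"
    and y: "\<phi> (chart C e (ereal s)) = chart D e' (ereal s')" and x: "\<phi> (chart C e \<infinity>) = chart D e' \<infinity>"
    and z: "z \<in> points \<Gamma>\<^sub>1"
  shows "\<phi> z \<in> curve.tail D e' s' \<longleftrightarrow> z \<in> curve.tail C e s"
proof -
  interpret C: curve_model \<Gamma>\<^sub>1 C by fact
  interpret D: curve_model \<Gamma>\<^sub>2 D by fact
  interpret I: scaled_pair \<Gamma>\<^sub>2 \<Gamma>\<^sub>1 "1 / r" \<theta> \<phi> by (rule inverse_pair)
  let ?T = "C.M.tail e s" and ?T' = "D.M.tail e' s'"
  let ?y = "chart C e (ereal s)" and ?x = "chart C e \<infinity>"
  have yp: "?y \<in> points \<Gamma>\<^sub>1" using C.M.tail_start(1)[OF e s] C.M.fin_subset C.same_points by blast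
  have xT: "?x \<in> ?T" by (simp add: C.M.tail_def)
  have xT': "\<phi> ?x \<in> ?T'" by (simp add: x D.M.tail_def)
  have T: "?T \<subseteq> points \<Gamma>\<^sub>1" using C.M.tail_subset[OF e s] C.same_points by simp
  have T': "?T' \<subseteq> points \<Gamma>\<^sub>2" using D.M.tail_subset[OF e' s'] D.same_points by simp
  have "connectedin B.top_curve (\<phi> ` ?T)"
    using connectedin_continuous_map_image[OF phi_continuous] C.M.connectedin_tail[OF e s] C.same_topology by simp
  moreover have "chart D e' (ereal s') \<notin> \<phi> ` ?T"
  proof
    assume "chart D e' (ereal s') \<in> \<phi> ` ?T"
    then obtain w where w: "w \<in> ?T" "\<phi> w = \<phi> ?y" using y by auto
    then have "w = ?y" using theta_phi[OF yp] theta_phi[OF subsetD[OF T w(1)]] by simp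
    then show False using w(1) C.M.tail_start(2)[OF e s] by simp
  qed
  ultimately have "\<phi> ` ?T \<subseteq> ?T' \<or> \<phi> ` ?T \<inter> ?T' = {}"
    using D.M.connectedin_tail_cases[OF e' s'] D.same_topology by simp
  then have 1: "\<phi> ` ?T \<subseteq> ?T'" using xT xT' by blast
  have "connectedin A.top_curve (\<theta> ` ?T')"
    using connectedin_continuous_map_image[OF I.phi_continuous] D.M.connectedin_tail[OF e' s'] D.same_topology by simp
  moreover have "?y \<notin> \<theta> ` ?T'"
  proof
    assume "?y \<in> \<theta> ` ?T'"
    then obtain w where w: "w \<in> ?T'" "?y = \<theta> w" by blast
    then have "w = chart D e' (ereal s')" using phi_theta[OF subsetD[OF T' w(1)]] y by simp
    then show False using w(1) D.M.tail_start(2)[OF e' s'] by simp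
  qed
  ultimately have "\<theta> ` ?T' \<subseteq> ?T \<or> \<theta> ` ?T' \<inter> ?T = {}"
    using C.M.connectedin_tail_cases[OF e s] C.same_topology by simp
  moreover have "?x \<in> \<theta> ` ?T'"
  proof -
    have "\<theta> (\<phi> ?x) = ?x" by (rule theta_phi[OF subsetD[OF T xT]])
    then show ?thesis using xT' by (metis imageI)
  qed
  ultimately have 2: "\<theta> ` ?T' \<subseteq> ?T" using xT by blast
  show ?thesis
  proof
    assume "\<phi> z \<in> ?T'"
    then have "\<theta> (\<phi> z) \<in> ?T" using 2 by blast
    then show "z \<in> ?T" by (simp add: theta_phi[OF z])
  qed (use 1 in blast)
qed

lemma psi_CF_tail:
  assumes "curve_model \<Gamma>\<^sub>1 C" and e: "e \<in> edges C" "len C e = \<infinity>" and s: "0 \<le> s" and z: "z \<in> points \<Gamma>\<^sub>1"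
  shows "\<psi> (CF \<Gamma>\<^sub>1 (points \<Gamma>\<^sub>1 - curve.tail C e s) \<infinity>) (\<phi> z) = - (ereal r * curve.tail_dist C e s z)"
proof -
  interpret C: curve_model \<Gamma>\<^sub>1 C by fact
  show ?thesis
    using psi_eq[OF C.rat_CF_tail[OF e s] phi_mem[OF z]] theta_phi[OF z] C.CF_tail[OF e s] z by simp
qed

text \<open>
  For existence, the point
  \<open>y\<close> is chosen so far out that \<open>\<phi>\<close> maps the rest of the ray into the ray at \<open>\<phi> x\<close>. For uniqueness, a chip-firing move of a
  tail is infinite at the point at infinity of the tail and nowhere else.
\<close>
lemma corresponding_infinite_phi:
  assumes C: "model_for \<Gamma>\<^sub>1 C\<^sub>1" and D: "model_for \<Gamma>\<^sub>2 C\<^sub>2" and x: "x \<in> inf_points \<Gamma>\<^sub>1"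
  shows "corresponding_infinite \<Gamma>\<^sub>1 \<Gamma>\<^sub>2 C\<^sub>1 C\<^sub>2 \<psi> \<phi> x x' \<longleftrightarrow> x' = \<phi> x"
proof
  have cm: "curve_model \<Gamma>\<^sub>1 C\<^sub>1" "curve_model \<Gamma>\<^sub>2 C\<^sub>2"
    using C D A.curve_axioms B.curve_axioms
    by (simp_all add: curve_model_def curve_model_axioms_def curve_def model_for_def)
  interpret C: curve_model \<Gamma>\<^sub>1 C\<^sub>1 by (rule cm(1))
  interpret D: curve_model \<Gamma>\<^sub>2 C\<^sub>2 by (rule cm(2))
  have xp: "x \<in> points \<Gamma>\<^sub>1" using x A.inf_subset by blast
  have px: "\<phi> x \<in> inf_points \<Gamma>\<^sub>2" by (rule phi_infinite[OF x])
  { assume x': "x' = \<phi> x"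
    obtain e where e: "e \<in> edges C\<^sub>1" "len C\<^sub>1 e = \<infinity>" "x = chart C\<^sub>1 e \<infinity>"
      using x unfolding C.same_inf[symmetric] by (rule C.M.inf_pointE)
    obtain e' where e': "e' \<in> edges C\<^sub>2" "len C\<^sub>2 e' = \<infinity>" "\<phi> x = chart C\<^sub>2 e' \<infinity>"
      using px unfolding D.same_inf[symmetric] by (rule D.M.inf_pointE)
    let ?U = "{z \<in> topspace A.top_curve. \<phi> z \<in> D.M.tail e' 0}"
    have "openin B.top_curve (D.M.tail e' 0)"
      using D.M.openin_tail[OF e'(1,2) order_refl] D.same_topology by simp
    then have "openin A.top_curve ?U" by (rule openin_continuous_map_preimage[OF phi_continuous])
    then have U: "openin (curve_topology C\<^sub>1) ?U" by (simp add: C.same_topology)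
    have "\<phi> x \<in> D.M.tail e' 0" unfolding e'(3) by (simp add: D.M.tail_def)
    then have "chart C\<^sub>1 e \<infinity> \<in> ?U" using xp e(3) by (simp add: A.topspace_curve)
    then obtain s0 where s0: "0 \<le> s0" "C.M.tail e s0 \<subseteq> ?U"
      by (rule C.M.tail_neighbourhood[OF e(1,2) U])
    \<comment> \<open>one step further, so that \<open>y\<close> itself lies in the tail from \<open>s0\<close>, and not only its successors\<close>
    define s where "s = s0 + 1"
    have s: "0 \<le> s" using s0(1) by (simp add: s_def)
    define y where "y = chart C\<^sub>1 e (ereal s)"
    have "y \<in> C.M.tail e s0" by (simp add: y_def C.M.tail_def s_def)
    then have yU: "y \<in> points \<Gamma>\<^sub>1" "\<phi> y \<in> D.M.tail e' 0" using s0(2) by (auto simp: A.topspace_curve)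
    have yf: "y \<in> fin_points \<Gamma>\<^sub>1" using C.M.tail_start(1)[OF e(1,2) s] C.same_fin by (simp add: y_def)
    have pyf: "\<phi> y \<in> fin_points C\<^sub>2" using phi_fin_iff[OF yU(1)] yf D.same_fin by simp
    have "\<phi> y \<in> e'"
    proof -
      obtain u where u: "ereal 0 < u" "\<phi> y = chart C\<^sub>2 e' u" using yU(2) by (auto simp: D.M.tail_def)
      have "0 \<le> u" using u(1) by (simp only: zero_ereal_def less_imp_le)
      then show ?thesis using D.M.chart_in_edge[OF e'(1), of u] e'(2) u(2) by simp
    qed
    then obtain s' where s': "0 \<le> s'" "\<phi> y = chart C\<^sub>2 e' (ereal s')"
      using pyf by (rule D.M.finite_point_on_ray[OF e'(1,2)])
    have tails: "\<phi> z \<in> D.M.tail e' s' \<longleftrightarrow> z \<in> C.M.tail e s" if "z \<in> points \<Gamma>\<^sub>1" for z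
      by (rule tail_image[OF cm e(1,2) e'(1,2) s s'(1) _ _ that]) (use s'(2) e(3) e'(3) y_def in simp_all)
    have dist: "D.M.tail_dist e' s' (\<phi> z) = ereal r * C.M.tail_dist e s z" if z: "z \<in> points \<Gamma>\<^sub>1" for z
      using tails[OF z] cdist_phi[OF yU(1) z] C.same_cdist[OF yU(1) z] D.same_cdist[OF phi_mem[OF yU(1)] phi_mem[OF z]]
      by (simp add: C.M.tail_dist_def D.M.tail_dist_def s'(2)[symmetric] y_def[symmetric])
    have "\<psi> (CF \<Gamma>\<^sub>1 (points \<Gamma>\<^sub>1 - C.M.tail e s) \<infinity>) = CF \<Gamma>\<^sub>2 (points \<Gamma>\<^sub>2 - D.M.tail e' s') \<infinity>"
    proof (rule extensionalityI)
      show "\<psi> (CF \<Gamma>\<^sub>1 (points \<Gamma>\<^sub>1 - C.M.tail e s) \<infinity>) \<in> extensional (points \<Gamma>\<^sub>2)"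
        by (rule psi_ext[OF C.rat_CF_tail[OF e(1,2) s]])
      show "CF \<Gamma>\<^sub>2 (points \<Gamma>\<^sub>2 - D.M.tail e' s') \<infinity> \<in> extensional (points \<Gamma>\<^sub>2)" by (simp add: CF_def)
      fix w assume w: "w \<in> points \<Gamma>\<^sub>2"
      show "\<psi> (CF \<Gamma>\<^sub>1 (points \<Gamma>\<^sub>1 - C.M.tail e s) \<infinity>) w = CF \<Gamma>\<^sub>2 (points \<Gamma>\<^sub>2 - D.M.tail e' s') \<infinity> w"
        using psi_CF_tail[OF cm(1) e(1,2) s theta_mem[OF w]] dist[OF theta_mem[OF w]]
          D.CF_tail[OF e'(1,2) s'(1)] w by (simp add: phi_theta[OF w])
    qed
    moreover have "half_open_segment C\<^sub>1 e y x = C.M.tail e s"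
      unfolding y_def e(3) by (rule C.M.half_open_segment_tail[OF e(1,2) s])
    moreover have "half_open_segment C\<^sub>2 e' (\<phi> y) (\<phi> x) = D.M.tail e' s'"
      unfolding s'(2) e'(3) by (rule D.M.half_open_segment_tail[OF e'(1,2) s'(1)])
    moreover have "x \<in> e" using C.M.chart_in_edge[OF e(1), of \<infinity>] e(2,3) by simp
    moreover have "y \<in> e" using C.M.chart_in_edge[OF e(1), of "ereal s"] e(2) s by (simp add: y_def)
    moreover have "\<phi> x \<in> e'" using D.M.chart_in_edge[OF e'(1), of \<infinity>] e'(2,3) by simp
    ultimately show "corresponding_infinite \<Gamma>\<^sub>1 \<Gamma>\<^sub>2 C\<^sub>1 C\<^sub>2 \<psi> \<phi> x x'"
      unfolding corresponding_infinite_def x' using px \<open>\<phi> y \<in> e'\<close> yf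
      by (intro conjI bexI[of _ e] bexI[of _ e'] bexI[of _ y] e(1) e'(1)) simp_all }
  assume "corresponding_infinite \<Gamma>\<^sub>1 \<Gamma>\<^sub>2 C\<^sub>1 C\<^sub>2 \<psi> \<phi> x x'"
  then obtain e e' y where x': "x' \<in> inf_points \<Gamma>\<^sub>2" and e: "e \<in> edges C\<^sub>1" and e': "e' \<in> edges C\<^sub>2" and y: "y \<in> fin_points \<Gamma>\<^sub>1"
    and mem: "x \<in> e" "y \<in> e" "x' \<in> e'" "\<phi> y \<in> e'"
    and eq: "\<psi> (CF \<Gamma>\<^sub>1 (points \<Gamma>\<^sub>1 - half_open_segment C\<^sub>1 e y x) \<infinity>) =
          CF \<Gamma>\<^sub>2 (points \<Gamma>\<^sub>2 - half_open_segment C\<^sub>2 e' (\<phi> y) x') \<infinity>"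
    unfolding corresponding_infinite_def by (elim conjE bexE)
  have ex: "len C\<^sub>1 e = \<infinity>" "x = chart C\<^sub>1 e \<infinity>"
    using C.M.edge_at_infinity[OF _ e mem(1)] x C.same_inf by simp_all
  have ex': "len C\<^sub>2 e' = \<infinity>" "x' = chart C\<^sub>2 e' \<infinity>"
    using D.M.edge_at_infinity[OF _ e' mem(3)] x' D.same_inf by simp_all
  have "y \<in> fin_points C\<^sub>1" using y C.same_fin by simp
  then obtain s where s: "0 \<le> s" "y = chart C\<^sub>1 e (ereal s)" by (rule C.M.finite_point_on_ray[OF e ex(1) mem(2)])
  have "\<phi> y \<in> fin_points C\<^sub>2" using phi_fin_iff[OF subsetD[OF A.fin_subset y]] y D.same_fin by simp
  then obtain s' where s': "0 \<le> s'" "\<phi> y = chart C\<^sub>2 e' (ereal s')" by (rule D.M.finite_point_on_ray[OF e' ex'(1) mem(4)])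
  have "half_open_segment C\<^sub>1 e y x = C.M.tail e s"
    unfolding s(2) ex(2) by (rule C.M.half_open_segment_tail[OF e ex(1) s(1)])
  moreover have "half_open_segment C\<^sub>2 e' (\<phi> y) x' = D.M.tail e' s'"
    unfolding s'(2) ex'(2) by (rule D.M.half_open_segment_tail[OF e' ex'(1) s'(1)])
  ultimately have "\<psi> (CF \<Gamma>\<^sub>1 (points \<Gamma>\<^sub>1 - C.M.tail e s) \<infinity>) (\<phi> x) = CF \<Gamma>\<^sub>2 (points \<Gamma>\<^sub>2 - D.M.tail e' s') \<infinity> (\<phi> x)"
    using eq by simp
  then have "- (ereal r * C.M.tail_dist e s x) = - D.M.tail_dist e' s' (\<phi> x)"
    using psi_CF_tail[OF cm(1) e ex(1) s(1) xp] D.CF_tail[OF e' ex'(1) s'(1)] phi_mem[OF xp] by simp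
  moreover have "C.M.tail_dist e s x = \<infinity>"
    using C.M.tail_dist_infinite[OF e ex(1) s(1), of x] xp ex(2) C.same_points by simp
  ultimately have "D.M.tail_dist e' s' (\<phi> x) = \<infinity>" using r_pos by simp
  then show "x' = \<phi> x"
    using D.M.tail_dist_infinite[OF e' ex'(1) s'(1), of "\<phi> x"] phi_mem[OF xp] ex'(2) D.same_points by simp
qed

lemma induces_phi: "induces \<Gamma>\<^sub>1 \<Gamma>\<^sub>2 \<psi> r \<phi>"
  unfolding induces_def
proof (intro conjI ballI allI impI)
  show "corresponding_finite \<Gamma>\<^sub>1 \<Gamma>\<^sub>2 \<psi> r x (\<phi> x)" if "x \<in> fin_points \<Gamma>\<^sub>1" for x
    using corresponding_finite_phi[OF that] by simp
  show "x' = \<phi> x" if "x \<in> fin_points \<Gamma>\<^sub>1" "corresponding_finite \<Gamma>\<^sub>1 \<Gamma>\<^sub>2 \<psi> r x x'" for x x'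
    using corresponding_finite_phi[OF that(1)] that(2) by simp
  fix C\<^sub>1 C\<^sub>2 x assume "canonical_model \<Gamma>\<^sub>1 C\<^sub>1" "canonical_model \<Gamma>\<^sub>2 C\<^sub>2" and x: "x \<in> inf_points \<Gamma>\<^sub>1"
  then have m: "model_for \<Gamma>\<^sub>1 C\<^sub>1" "model_for \<Gamma>\<^sub>2 C\<^sub>2" by (simp_all add: canonical_model_def)
  show "corresponding_infinite \<Gamma>\<^sub>1 \<Gamma>\<^sub>2 C\<^sub>1 C\<^sub>2 \<psi> \<phi> x (\<phi> x)"
    using corresponding_infinite_phi[OF m x] by simp
  show "x' = \<phi> x" if "corresponding_infinite \<Gamma>\<^sub>1 \<Gamma>\<^sub>2 C\<^sub>1 C\<^sub>2 \<psi> \<phi> x x'" for x'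
    using corresponding_infinite_phi[OF m x] that by simp
qed

end

section \<open>Subdividing the edges\<close>

text \<open>
  The edges are halved and the result is transported along the injective map \<open>\<phi>\<close>. For the identity this is a loopless
  model of \<open>\<Gamma>\<close>, and for an isometry it is a loopless model of the other curve, made of the images of the halves.
\<close>
locale curve_embedding = curve \<Gamma> for \<Gamma> :: "'a curve" +
  fixes \<phi> :: "'a \<Rightarrow> 'b"
  assumes inj: "inj_on \<phi> (points \<Gamma>)"
begin

text \<open>
  A ray is cut at 1; its outer half is a ray again.
\<close>
definition mid :: "'a set \<Rightarrow> real" where
  "mid e = (if L e = \<infinity> then 1 else real_of_ereal (L e) / 2)"

text \<open>
  The Boolean tells the half at the far end (\<open>True\<close>) from the half at coordinate 0.
\<close>
definition halves :: "('a set \<times> bool) set" where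
  "halves = E \<times> UNIV"

definition lo :: "'a set \<times> bool \<Rightarrow> ereal" where
  "lo i = (if snd i then ereal (mid (fst i)) else 0)"

definition hi :: "'a set \<times> bool \<Rightarrow> ereal" where
  "hi i = (if snd i then L (fst i) else ereal (mid (fst i)))"

definition half :: "'a set \<times> bool \<Rightarrow> 'b set" where
  "half i = \<phi> ` ch (fst i) ` {lo i..hi i}"

definition half_chart :: "'a set \<times> bool \<Rightarrow> ereal \<Rightarrow> 'b" where
  "half_chart i t = \<phi> (ch (fst i) (lo i + t))"

text \<open>
  Edges of a curve are sets of points, so the data of a half have to be recovered from its set of points.
\<close>
definition index :: "'b set \<Rightarrow> 'a set \<times> bool" where
  "index = inv_into halves half"

definition subverts :: "'a set" where
  "subverts = V \<union> (\<lambda>e. ch e (ereal (mid e))) ` E"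

definition subdivision :: "'b curve" where
  "subdivision = \<lparr>verts = \<phi> ` subverts, edges = half ` halves,
     ends = (\<lambda>A. {\<phi> (ch (fst (index A)) (lo (index A))), \<phi> (ch (fst (index A)) (hi (index A)))}),
     len = (\<lambda>A. hi (index A) - lo (index A)), chart = (\<lambda>A. half_chart (index A))\<rparr>"

lemma mid_bounds: assumes "e \<in> E" shows "0 < mid e" "ereal (mid e) < L e"
  using len_pos[OF assms] by (cases "L e"; simp add: mid_def)+

lemma mid_interior: "e \<in> E \<Longrightarrow> ereal (mid e) \<in> {0<..<L e}"
  using mid_bounds by simp

lemma mid_closed: "e \<in> E \<Longrightarrow> ereal (mid e) \<in> {0..L e}"
  using mid_bounds by (simp add: less_imp_le)

lemma half_bounds:
  assumes "i \<in> halves" shows "fst i \<in> E" "0 \<le> lo i" "lo i < hi i" "hi i \<le> L (fst i)" "lo i \<noteq> \<infinity>" "lo i \<noteq> - \<infinity>"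
proof -
  show e: "fst i \<in> E" using assms by (auto simp: halves_def)
  show "0 \<le> lo i" "lo i < hi i" "hi i \<le> L (fst i)" "lo i \<noteq> \<infinity>" "lo i \<noteq> - \<infinity>"
    using mid_bounds[OF e] by (simp_all add: lo_def hi_def less_imp_le)
qed

lemma half_interior:
  assumes i: "i \<in> halves" and t: "t \<in> {lo i<..<hi i}"
  shows "t \<in> {0<..<L (fst i)}" "t \<noteq> ereal (mid (fst i))"
proof -
  show "t \<in> {0<..<L (fst i)}"
    using le_less_trans[OF half_bounds(2)[OF i], of t] less_le_trans[OF _ half_bounds(4)[OF i], of t] t by simp
  show "t \<noteq> ereal (mid (fst i))" using t by (cases "snd i") (auto simp: lo_def hi_def)
qed

lemma half_closed: assumes "i \<in> halves" "t \<in> {lo i..hi i}" shows "t \<in> {0..L (fst i)}"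
  using half_bounds[OF assms(1)] assms(2) order_trans[of 0 "lo i" t] order_trans[of t "hi i" "L (fst i)"] by simp

lemma half_unique:
  assumes i: "i \<in> halves" and j: "j \<in> halves" and t: "t \<in> {lo i<..<hi i}" and u: "u \<in> {lo j..hi j}"
    and eq: "ch (fst i) t = ch (fst j) u"
  shows "i = j \<and> t = u"
proof -
  have *: "fst j = fst i \<and> u = t"
    by (rule interior_unique[OF half_bounds(1)[OF i] half_interior(1)[OF i t] half_bounds(1)[OF j] half_closed[OF j u] eq])
  then have "snd i = snd j" using t u by (auto simp: lo_def hi_def split: if_splits)
  then show ?thesis using * by (simp add: prod_eq_iff)
qed

lemma phi_chart_eq: "e \<in> E \<Longrightarrow> s \<in> {0..L e} \<Longrightarrow> e' \<in> E \<Longrightarrow> t \<in> {0..L e'} \<Longrightarrow>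
    \<phi> (ch e s) = \<phi> (ch e' t) \<longleftrightarrow> ch e s = ch e' t"
  using inj_on_eq_iff[OF inj chart_in_points chart_in_points] by blast

lemma inj_half: "inj_on half halves"
proof (rule inj_onI)
  fix i j assume i: "i \<in> halves" and j: "j \<in> halves" and eq: "half i = half j"
  obtain t where t: "lo i < t" "t < hi i" using dense[OF half_bounds(3)[OF i]] by blast
  then have ti: "t \<in> {lo i..hi i}" by (simp add: less_imp_le)
  then have "\<phi> (ch (fst i) t) \<in> half i" unfolding half_def by (intro imageI)
  then have "\<phi> (ch (fst i) t) \<in> half j" by (simp only: eq)
  then obtain u where u: "u \<in> {lo j..hi j}" "\<phi> (ch (fst i) t) = \<phi> (ch (fst j) u)" unfolding half_def by blast
  then have "ch (fst i) t = ch (fst j) u"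
    using phi_chart_eq[OF half_bounds(1)[OF i] half_closed[OF i ti] half_bounds(1)[OF j] half_closed[OF j u(1)]] by simp
  then show "i = j" using half_unique[OF i j _ u(1), of t] t by simp
qed

lemma index_half: "i \<in> halves \<Longrightarrow> index (half i) = i"
  unfolding index_def by (rule inv_into_f_f[OF inj_half])

lemma subdivision_simps:
  "verts subdivision = \<phi> ` subverts" "edges subdivision = half ` halves"
  "i \<in> halves \<Longrightarrow> ends subdivision (half i) = {\<phi> (ch (fst i) (lo i)), \<phi> (ch (fst i) (hi i))}"
  "i \<in> halves \<Longrightarrow> len subdivision (half i) = hi i - lo i"
  "i \<in> halves \<Longrightarrow> chart subdivision (half i) t = \<phi> (ch (fst i) (lo i + t))"
  by (simp_all add: subdivision_def index_half half_chart_def)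

lemma shift:
  assumes i: "i \<in> halves"
  shows "t \<in> {0..hi i - lo i} \<longleftrightarrow> lo i + t \<in> {lo i..hi i}" "t \<in> {0<..<hi i - lo i} \<longleftrightarrow> lo i + t \<in> {lo i<..<hi i}"
    "lo i + (hi i - lo i) = hi i" "lo i + (s - lo i) = s"
proof -
  obtain a where a: "lo i = ereal a" using half_bounds[OF i] by (cases "lo i") auto
  show "t \<in> {0..hi i - lo i} \<longleftrightarrow> lo i + t \<in> {lo i..hi i}" "t \<in> {0<..<hi i - lo i} \<longleftrightarrow> lo i + t \<in> {lo i<..<hi i}"
    using half_bounds[OF i] by (cases t; cases "hi i"; auto simp: a)+
  show "lo i + (hi i - lo i) = hi i" by (cases "hi i") (simp_all add: a)
  show "lo i + (s - lo i) = s" by (cases s) (simp_all add: a)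
qed

lemma shift_image:
  assumes i: "i \<in> halves"
  shows "(\<lambda>t. lo i + t) ` {0..hi i - lo i} = {lo i..hi i}"
proof
  show "(\<lambda>t. lo i + t) ` {0..hi i - lo i} \<subseteq> {lo i..hi i}" using shift(1)[OF i] by blast
  show "{lo i..hi i} \<subseteq> (\<lambda>t. lo i + t) ` {0..hi i - lo i}"
  proof
    fix s assume s: "s \<in> {lo i..hi i}"
    have "lo i + (s - lo i) = s" by (rule shift(4)[OF i])
    moreover then have "s - lo i \<in> {0..hi i - lo i}" using shift(1)[OF i, of "s - lo i"] s by simp
    ultimately show "s \<in> (\<lambda>t. lo i + t) ` {0..hi i - lo i}" by (metis imageI)
  qed
qed

lemma chart_lo_hi:
  assumes i: "i \<in> halves"
  shows "ch (fst i) (lo i) \<in> subverts" "ch (fst i) (hi i) \<in> subverts"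
  using chart_end_vertex[OF half_bounds(1)[OF i]] half_bounds(1)[OF i] by (auto simp: lo_def hi_def subverts_def)

lemma interior_not_subvert:
  assumes i: "i \<in> halves" and t: "t \<in> {lo i<..<hi i}"
  shows "ch (fst i) t \<notin> subverts"
proof
  note e = half_bounds(1)[OF i]
  assume "ch (fst i) t \<in> subverts"
  moreover have "ch (fst i) t \<notin> V" by (rule interior_not_vertex[OF e half_interior(1)[OF i t]])
  ultimately obtain e' where e': "e' \<in> E" "ch (fst i) t = ch e' (ereal (mid e'))" by (auto simp: subverts_def)
  from interior_unique[OF e half_interior(1)[OF i t] e'(1) mid_closed[OF e'(1)] e'(2)] half_interior(2)[OF i t]
  show False by auto
qed

lemma subverts_points: "subverts \<subseteq> points \<Gamma>"
proof
  fix x assume "x \<in> subverts"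
  then consider "x \<in> V" | e where "e \<in> E" "x = ch e (ereal (mid e))" by (auto simp: subverts_def)
  then show "x \<in> points \<Gamma>"
  proof cases
    case 2
    then show ?thesis using chart_in_points[OF 2(1) mid_closed[OF 2(1)]] by simp
  qed (use V_subset in blast)
qed

lemma lo_hi_closed: assumes "i \<in> halves" shows "lo i \<in> {lo i..hi i}" "hi i \<in> {lo i..hi i}"
  using half_bounds[OF assms] by simp_all

lemma ends_distinct:
  assumes i: "i \<in> halves" shows "\<phi> (ch (fst i) (lo i)) \<noteq> \<phi> (ch (fst i) (hi i))"
proof
  note e = half_bounds(1)[OF i]
  assume "\<phi> (ch (fst i) (lo i)) = \<phi> (ch (fst i) (hi i))"
  then have eq: "ch (fst i) (lo i) = ch (fst i) (hi i)"
    using phi_chart_eq[OF e half_closed[OF i] e half_closed[OF i]] lo_hi_closed[OF i] by blast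
  have m: "ch (fst i) (ereal (mid (fst i))) \<notin> V" by (rule interior_not_vertex[OF e mid_interior[OF e]])
  show False
  proof (cases "snd i")
    case True
    then show False using eq m chart_end_vertex(2)[OF e] by (simp add: lo_def hi_def)
  next
    case False
    then show False using eq[symmetric] m chart_end_vertex(1)[OF e] by (simp add: lo_def hi_def)
  qed
qed

lemma subdivision_loopless: "loopless subdivision"
  unfolding loopless_def subdivision_simps(2)
proof
  fix A assume "A \<in> half ` halves"
  then obtain i where i: "i \<in> halves" "A = half i" by blast
  show "card (ends subdivision A) = 2" using ends_distinct[OF i(1)] unfolding i(2) subdivision_simps(3)[OF i(1)] by simp
qed

lemma finite_halves: "finite halves"
  using finite_E by (simp add: halves_def)

text \<open>
  Every edge of \<open>\<Gamma>\<close> becomes a walk of two edges through its midpoint.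
\<close>
lemma subdivision_connected:
  assumes "u \<in> subverts" "v \<in> subverts"
  shows "(\<phi> u, \<phi> v) \<in> {(a, b). \<exists>A\<in>edges subdivision. ends subdivision A = {a, b}}\<^sup>*"
    (is "_ \<in> ?R\<^sup>*")
proof -
  have sym: "sym ?R"
    by (rule symI) (auto simp: insert_commute)
  have half_step: "(\<phi> (ch (fst i) (lo i)), \<phi> (ch (fst i) (hi i))) \<in> ?R" if i: "i \<in> halves" for i
    using i subdivision_simps(2,3) by auto
  have to_mid: "(\<phi> (ch e 0), \<phi> (ch e (ereal (mid e)))) \<in> ?R" "(\<phi> (ch e (ereal (mid e))), \<phi> (ch e (L e))) \<in> ?R" if e: "e \<in> E" for e
    using half_step[of "(e, False)"] half_step[of "(e, True)"] e by (simp_all add: halves_def lo_def hi_def)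
  have sym': "(b, a) \<in> ?R\<^sup>*" if "(a, b) \<in> ?R\<^sup>*" for a b
    using sym_rtrancl[OF sym] that by (rule symD)
  have ends: "(\<phi> (ch e 0), \<phi> (ch e (L e))) \<in> ?R\<^sup>*" if e: "e \<in> E" for e
    using to_mid[OF e] by (rule converse_rtrancl_into_rtrancl[OF _ r_into_rtrancl])
  have step: "(\<phi> a, \<phi> b) \<in> ?R\<^sup>*" if "e \<in> E" "ends \<Gamma> e = {a, b}" for e a b
  proof -
    have "{a, b} = {ch e 0, ch e (L e)}" using that ends_eq by simp
    then consider "a = ch e 0" "b = ch e (L e)" | "b = ch e 0" "a = ch e (L e)" by (auto simp: doubleton_eq_iff)
    then show ?thesis using ends[OF that(1)] sym'[OF ends[OF that(1)]] by cases simp_all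
  qed
  have VV: "(\<phi> a, \<phi> b) \<in> ?R\<^sup>*" if "a \<in> V" "b \<in> V" for a b
    using connected_graph[OF that]
  proof (induction rule: rtrancl_induct)
    case (step y z)
    then obtain e where "e \<in> E" "ends \<Gamma> e = {y, z}" by auto
    with \<open>(\<phi> a, \<phi> y) \<in> ?R\<^sup>*\<close> show ?case using \<open>\<And>e a b. e \<in> E \<Longrightarrow> ends \<Gamma> e = {a, b} \<Longrightarrow> (\<phi> a, \<phi> b) \<in> ?R\<^sup>*\<close> by (rule_tac rtrancl_trans)
  qed simp
  have toV: "\<exists>v. v \<in> V \<and> (\<phi> v, \<phi> u) \<in> ?R\<^sup>*" if "u \<in> subverts" for u
  proof -
    consider "u \<in> V" | e where "e \<in> E" "u = ch e (ereal (mid e))" using \<open>u \<in> subverts\<close> by (auto simp: subverts_def)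
    then show ?thesis
    proof cases
      case 2
      then show ?thesis using to_mid(1)[OF 2(1)] chart_end_vertex(1)[OF 2(1)] by (intro exI[of _ "ch e 0"]) auto
    qed auto
  qed
  obtain a where a: "a \<in> V" "(\<phi> a, \<phi> u) \<in> ?R\<^sup>*" using toV[OF assms(1)] by blast
  obtain b where b: "b \<in> V" "(\<phi> b, \<phi> v) \<in> ?R\<^sup>*" using toV[OF assms(2)] by blast
  show ?thesis using sym'[OF a(2)] VV[OF a(1) b(1)] b(2) by (meson rtrancl_trans)
qed

lemma subdivision_leaf:
  assumes i: "i \<in> halves" and inf: "hi i = \<infinity>"
  shows "leaf_end subdivision (\<phi> (ch (fst i) \<infinity>))"
proof -
  note e = half_bounds(1)[OF i]
  have Le: "L (fst i) = \<infinity>" and si: "snd i" using half_bounds(4)[OF i] inf by (auto simp: hi_def split: if_splits)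
  have A: "{A \<in> edges subdivision. \<phi> (ch (fst i) \<infinity>) \<in> ends subdivision A} = {half i}"
  proof (intro equalityI subsetI)
    fix A assume "A \<in> {A \<in> edges subdivision. \<phi> (ch (fst i) \<infinity>) \<in> ends subdivision A}"
    then obtain j where j: "j \<in> halves" "A = half j" "\<phi> (ch (fst i) \<infinity>) \<in> ends subdivision (half j)"
      by (auto simp: subdivision_simps(2))
    then obtain t where t: "t = lo j \<or> t = hi j" "\<phi> (ch (fst i) \<infinity>) = \<phi> (ch (fst j) t)"
      by (auto simp: subdivision_simps(3))
    have tj: "t \<in> {lo j..hi j}" using t(1) lo_hi_closed[OF j(1)] by blast
    have "ch (fst j) t = ch (fst i) \<infinity>"
      using t(2) phi_chart_eq[OF e _ half_bounds(1)[OF j(1)] half_closed[OF j(1) tj], of \<infinity>] Le by simp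
    from infinity_unique[OF e Le half_bounds(1)[OF j(1)] half_closed[OF j(1) tj] this]
    have *: "fst j = fst i" "t = \<infinity>" by simp_all
    then have "hi j = \<infinity>" using t(1) half_bounds(5)[OF j(1)] by auto
    then have "snd j" by (auto simp: hi_def split: if_splits)
    then have "j = i" using *(1) si by (simp add: prod_eq_iff)
    then show "A \<in> {half i}" using j(2) by simp
  next
    fix A assume "A \<in> {half i}"
    then show "A \<in> {A \<in> edges subdivision. \<phi> (ch (fst i) \<infinity>) \<in> ends subdivision A}"
      using i inf by (simp add: subdivision_simps)
  qed
  have B: "{A \<in> edges subdivision. ends subdivision A = {\<phi> (ch (fst i) \<infinity>)}} = {}"
  proof -
    have "ends subdivision A \<noteq> {x}" if "A \<in> edges subdivision" for A x
      using that subdivision_loopless unfolding loopless_def by fastforce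
    then show ?thesis by blast
  qed
  have "\<phi> (ch (fst i) \<infinity>) \<in> verts subdivision"
    using chart_lo_hi(2)[OF i] inf by (simp add: subdivision_simps(1))
  then show ?thesis unfolding leaf_end_def vertex_valence_def A B by simp
qed

lemma subdivision_curve: "tropical_curve subdivision"
proof -
  have "multigraph subdivision"
    unfolding multigraph_def
  proof (intro conjI ballI)
    show "finite (verts subdivision)" using finite_V finite_E by (simp add: subdivision_simps(1) subverts_def)
    show "verts subdivision \<noteq> {}" using V_nonempty by (simp add: subdivision_simps(1) subverts_def)
    show "finite (edges subdivision)" using finite_halves by (simp add: subdivision_simps(2))
    fix A assume A: "A \<in> edges subdivision"
    then obtain i where i: "i \<in> halves" "A = half i" by (auto simp: subdivision_simps(2))
    show "ends subdivision A \<subseteq> verts subdivision" using chart_lo_hi[OF i(1)] i by (simp add: subdivision_simps)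
    show "card (ends subdivision A) \<in> {1, 2}" using subdivision_loopless A by (simp add: loopless_def)
  next
    fix u v assume "u \<in> verts subdivision" "v \<in> verts subdivision"
    then obtain x y where "x \<in> subverts" "u = \<phi> x" "y \<in> subverts" "v = \<phi> y" by (auto simp: subdivision_simps(1))
    then show "(u, v) \<in> {(a, b). \<exists>e\<in>edges subdivision. ends subdivision e = {a, b}}\<^sup>*"
      using subdivision_connected by simp
  qed
  moreover have "0 < len subdivision A \<and> (len subdivision A = \<infinity> \<longrightarrow> leaf_edge subdivision A)"
    if A: "A \<in> edges subdivision" for A
  proof -
    obtain i where i: "i \<in> halves" "A = half i" using A by (auto simp: subdivision_simps(2))
    have len: "len subdivision A = hi i - lo i" using i by (simp add: subdivision_simps)
    show ?thesis
    proof (intro conjI impI)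
      obtain a where a: "lo i = ereal a" using half_bounds[OF i(1)] by (cases "lo i") auto
      show "0 < len subdivision A" using half_bounds(3)[OF i(1)] a len by (cases "hi i") auto
      assume "len subdivision A = \<infinity>"
      then have "hi i = \<infinity>" using len a by (cases "hi i") auto
      then have "leaf_end subdivision (\<phi> (ch (fst i) (hi i)))" using subdivision_leaf[OF i(1)] by simp
      then show "leaf_edge subdivision A"
        unfolding leaf_edge_def using A i by (auto simp: subdivision_simps)
    qed
  qed
  ultimately have "edge_weighted_graph subdivision" by (simp add: edge_weighted_graph_def)
  moreover have "chart subdivision A ` {0..len subdivision A} = A \<and>
        ends subdivision A = {chart subdivision A 0, chart subdivision A (len subdivision A)} \<and>
        (len subdivision A = \<infinity> \<longrightarrow> leaf_end subdivision (chart subdivision A \<infinity>)) \<and>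
        inj_on (chart subdivision A) {0<..<len subdivision A} \<and>
        chart subdivision A ` {0<..<len subdivision A} \<inter> verts subdivision = {}"
    if A: "A \<in> edges subdivision" for A
  proof -
    obtain i where i: "i \<in> halves" "A = half i" using A by (auto simp: subdivision_simps(2))
    note e = half_bounds(1)[OF i(1)]
    have ch_eq: "chart subdivision A = (\<lambda>t. \<phi> (ch (fst i) (lo i + t)))" using i by (auto simp: subdivision_simps)
    have len: "len subdivision A = hi i - lo i" using i by (simp add: subdivision_simps)
    show ?thesis
    proof (intro conjI impI)
      have "chart subdivision A ` {0..len subdivision A} = \<phi> ` ch (fst i) ` (\<lambda>t. lo i + t) ` {0..hi i - lo i}"
        unfolding ch_eq len by (simp add: image_image)
      then show "chart subdivision A ` {0..len subdivision A} = A"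
        unfolding shift_image[OF i(1)] by (simp add: i(2) half_def)
      show "ends subdivision A = {chart subdivision A 0, chart subdivision A (len subdivision A)}"
        unfolding ch_eq len shift(3)[OF i(1)] using i by (simp add: subdivision_simps)
      show "leaf_end subdivision (chart subdivision A \<infinity>)" if "len subdivision A = \<infinity>"
      proof -
        obtain a where a: "lo i = ereal a" using half_bounds[OF i(1)] by (cases "lo i") auto
        have "hi i = \<infinity>" using that len a by (cases "hi i") auto
        then show ?thesis using subdivision_leaf[OF i(1)] a unfolding ch_eq by simp
      qed
      show "inj_on (chart subdivision A) {0<..<len subdivision A}"
      proof (rule inj_onI)
        fix s t assume s: "s \<in> {0<..<len subdivision A}" and t: "t \<in> {0<..<len subdivision A}"
          and eq: "chart subdivision A s = chart subdivision A t"
        have s': "lo i + s \<in> {lo i<..<hi i}" and t': "lo i + t \<in> {lo i<..<hi i}"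
          using s t unfolding len by (simp_all only: shift(2)[OF i(1)])
        have "ch (fst i) (lo i + s) = ch (fst i) (lo i + t)"
          using eq phi_chart_eq[OF e half_closed[OF i(1)] e half_closed[OF i(1)]] s' t' unfolding ch_eq by (simp add: less_imp_le)
        then have "lo i + s = lo i + t" using half_unique[OF i(1) i(1) s', of "lo i + t"] t' by (simp add: less_imp_le)
        then show "s = t" using half_bounds[OF i(1)] by (cases "lo i"; cases s; cases t) auto
      qed
      show "chart subdivision A ` {0<..<len subdivision A} \<inter> verts subdivision = {}"
      proof (rule ccontr)
        assume "\<not> ?thesis"
        then obtain x where x: "x \<in> chart subdivision A ` {0<..<len subdivision A}" "x \<in> verts subdivision" by blast
        from x(1) obtain t where t: "t \<in> {0<..<len subdivision A}" "x = \<phi> (ch (fst i) (lo i + t))" unfolding ch_eq by blast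
        from x(2) obtain v where v: "v \<in> subverts" "\<phi> (ch (fst i) (lo i + t)) = \<phi> v"
          unfolding subdivision_simps(1) t(2) by blast
        have t': "lo i + t \<in> {lo i<..<hi i}" using t(1) unfolding len by (simp only: shift(2)[OF i(1)])
        have "ch (fst i) (lo i + t) \<in> points \<Gamma>"
          using t' by (intro chart_in_points[OF e] half_closed[OF i(1)]) (simp add: less_imp_le)
        then have "ch (fst i) (lo i + t) = v" using v subverts_points inj by (auto dest: inj_onD)
        then show False using interior_not_subvert[OF i(1) t'] v(1) by simp
      qed
    qed
  qed
  moreover have "A \<inter> B \<subseteq> verts subdivision" if A: "A \<in> edges subdivision" and B: "B \<in> edges subdivision" and ne: "A \<noteq> B" for A B
  proof
    obtain i where i: "i \<in> halves" "A = half i" using A by (auto simp: subdivision_simps(2))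
    obtain j where j: "j \<in> halves" "B = half j" using B by (auto simp: subdivision_simps(2))
    fix x assume "x \<in> A \<inter> B"
    then obtain t u where t: "t \<in> {lo i..hi i}" "x = \<phi> (ch (fst i) t)" and u: "u \<in> {lo j..hi j}" "x = \<phi> (ch (fst j) u)"
      unfolding i(2) j(2) half_def by blast
    have eq: "ch (fst i) t = ch (fst j) u"
      using t(2) u(2) phi_chart_eq[OF half_bounds(1)[OF i(1)] half_closed[OF i(1) t(1)] half_bounds(1)[OF j(1)] half_closed[OF j(1) u(1)]] by simp
    have "t \<notin> {lo i<..<hi i}" using half_unique[OF i(1) j(1) _ u(1) eq] ne i(2) j(2) by blast
    then have "t = lo i \<or> t = hi i" using t(1) by (auto simp: order_less_le)
    then show "x \<in> verts subdivision" using chart_lo_hi[OF i(1)] t(2) by (auto simp: subdivision_simps(1))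
  qed
  ultimately show ?thesis unfolding tropical_curve_def by blast
qed

lemma halves_cover: "e \<in> E \<Longrightarrow> \<phi> ` e = half (e, False) \<union> half (e, True)"
proof -
  assume e: "e \<in> E"
  have "{0..L e} = {0..ereal (mid e)} \<union> {ereal (mid e)..L e}"
    using mid_bounds[OF e] by (simp add: ivl_disj_un less_imp_le)
  then have "ch e ` {0..L e} = ch e ` {0..ereal (mid e)} \<union> ch e ` {ereal (mid e)..L e}" by (simp only: image_Un)
  from arg_cong[OF this, of "image \<phi>"] show ?thesis
    unfolding chart_image[OF e] by (simp only: half_def lo_def hi_def image_Un fst_conv snd_conv if_True if_False)
qed

lemma subdivision_points: "points subdivision = \<phi> ` points \<Gamma>"
proof -
  have "\<Union> (half ` halves) = \<phi> ` \<Union> E"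
  proof -
    have "\<Union> (half ` halves) = (\<Union>e\<in>E. half (e, False) \<union> half (e, True))"
      unfolding halves_def by (auto simp: UNIV_bool)
    also have "\<dots> = (\<Union>e\<in>E. \<phi> ` e)" by (intro SUP_cong refl) (simp add: halves_cover)
    finally show ?thesis by (simp add: image_Union)
  qed
  then have "points subdivision = \<phi> ` (subverts \<union> \<Union> E)" by (simp add: points_def subdivision_simps image_Un)
  also have "subverts \<union> \<Union> E = points \<Gamma>" using subverts_points by (auto simp: points_def subverts_def)
  finally show ?thesis .
qed

lemma subdivision_inf_points: "inf_points subdivision = \<phi> ` inf_points \<Gamma>"
proof (intro equalityI subsetI)
  fix x assume "x \<in> inf_points subdivision"
  then obtain A where A: "A \<in> edges subdivision" "len subdivision A = \<infinity>" "x = chart subdivision A \<infinity>"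
    by (auto simp: inf_points_def)
  then obtain i where i: "i \<in> halves" "A = half i" by (auto simp: subdivision_simps(2))
  obtain a where a: "lo i = ereal a" using half_bounds[OF i(1)] by (cases "lo i") auto
  have "hi i = \<infinity>" using A(2) i a by (cases "hi i") (auto simp: subdivision_simps)
  then have "L (fst i) = \<infinity>" using half_bounds(4)[OF i(1)] by simp
  then have "ch (fst i) \<infinity> \<in> inf_points \<Gamma>" by (rule inf_pointI[OF half_bounds(1)[OF i(1)]])
  moreover have "x = \<phi> (ch (fst i) \<infinity>)" using A(3) i a by (simp add: subdivision_simps)
  ultimately show "x \<in> \<phi> ` inf_points \<Gamma>" by blast
next
  fix x assume "x \<in> \<phi> ` inf_points \<Gamma>"
  then obtain z where z: "z \<in> inf_points \<Gamma>" "x = \<phi> z" by blast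
  obtain e where e: "e \<in> E" "L e = \<infinity>" "z = ch e \<infinity>" using z(1) by (rule inf_pointE)
  have i: "(e, True) \<in> halves" using e by (simp add: halves_def)
  have "len subdivision (half (e, True)) = \<infinity>" "chart subdivision (half (e, True)) \<infinity> = x"
    using e z(2) by (simp_all add: subdivision_simps i lo_def hi_def)
  moreover have "half (e, True) \<in> edges subdivision" using i by (simp add: subdivision_simps)
  ultimately show "x \<in> inf_points subdivision" unfolding inf_points_def by blast
qed

text \<open>
  A set is open in an edge if and only if it is open in both halves: its complement is the union of two sets that are
  closed in the halves, hence closed.
\<close>
lemma openin_subdivision:
  "openin (curve_topology subdivision) U \<longleftrightarrow> U \<subseteq> \<phi> ` points \<Gamma> \<and> openin top_curve {x \<in> points \<Gamma>. \<phi> x \<in> U}"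
proof -
  have half_iff: "openin (top_of_set {0..len subdivision (half i)}) {t \<in> {0..len subdivision (half i)}. chart subdivision (half i) t \<in> U}
     \<longleftrightarrow> openin (top_of_set {lo i..hi i}) {t \<in> {lo i..hi i}. \<phi> (ch (fst i) t) \<in> U}" (is "?a \<longleftrightarrow> ?b") if i: "i \<in> halves" for i
  proof -
    obtain a where a: "lo i = ereal a" using half_bounds[OF i] by (cases "lo i") auto
    have c1: "continuous_on S (\<lambda>t. lo i + t)" for S
      unfolding a continuous_on_def by (auto intro!: tendsto_add_ereal_general2)
    have c2: "continuous_on S (\<lambda>t. t + - lo i)" for S
      unfolding a continuous_on_def by (auto intro!: tendsto_add_ereal_general1)
    let ?S = "{t \<in> {0..hi i - lo i}. \<phi> (ch (fst i) (lo i + t)) \<in> U}" and ?T = "{t \<in> {lo i..hi i}. \<phi> (ch (fst i) t) \<in> U}"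
    have sub: "t \<in> {lo i..hi i} \<Longrightarrow> t + - lo i \<in> {0..hi i - lo i}" for t
      using shift(1)[OF i, of "t - lo i"] shift(4)[OF i, of t] by (simp add: minus_ereal_def)
    have add: "lo i + (t + - lo i) = t" for t using shift(4)[OF i, of t] by (simp add: minus_ereal_def)
    have "openin (top_of_set {lo i..hi i}) ?T" if "openin (top_of_set {0..hi i - lo i}) ?S"
    proof -
      have "openin (top_of_set {lo i..hi i}) ({lo i..hi i} \<inter> (\<lambda>t. t + - lo i) -` ?S)"
        by (rule continuous_openin_preimage[OF c2 _ that]) (use sub in blast)
      moreover have "{lo i..hi i} \<inter> (\<lambda>t. t + - lo i) -` ?S = ?T" using sub add by auto
      ultimately show ?thesis by simp
    qed
    moreover have "openin (top_of_set {0..hi i - lo i}) ?S" if "openin (top_of_set {lo i..hi i}) ?T"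
    proof -
      have "openin (top_of_set {0..hi i - lo i}) ({0..hi i - lo i} \<inter> (\<lambda>t. lo i + t) -` ?T)"
        by (rule continuous_openin_preimage[OF c1 _ that]) (use shift(1)[OF i] in blast)
      moreover have "{0..hi i - lo i} \<inter> (\<lambda>t. lo i + t) -` ?T = ?S" using shift(1)[OF i] by auto
      ultimately show ?thesis by simp
    qed
    ultimately show ?thesis unfolding subdivision_simps(4,5)[OF i] by blast
  qed
  have edge_iff: "openin (top_of_set {0..L e}) {t \<in> {0..L e}. ch e t \<in> {x \<in> points \<Gamma>. \<phi> x \<in> U}} \<longleftrightarrow>
      openin (top_of_set {0..ereal (mid e)}) {t \<in> {0..ereal (mid e)}. \<phi> (ch e t) \<in> U} \<and>
      openin (top_of_set {ereal (mid e)..L e}) {t \<in> {ereal (mid e)..L e}. \<phi> (ch e t) \<in> U}" if e: "e \<in> E" for e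
  proof -
    let ?X = "{0..L e}" and ?Y = "{0..ereal (mid e)}" and ?Z = "{ereal (mid e)..L e}"
    let ?P = "\<lambda>t. \<phi> (ch e t) \<in> U"
    have XYZ: "?X = ?Y \<union> ?Z" using mid_bounds[OF e] by (simp add: ivl_disj_un less_imp_le)
    have eq: "{t \<in> ?X. ch e t \<in> {x \<in> points \<Gamma>. \<phi> x \<in> U}} = {t \<in> ?X. ?P t}"
      using chart_in_points[OF e] by blast
    have restrict: "openin (top_of_set W) {t \<in> W. ?P t}" if op: "openin (top_of_set ?X) {t \<in> ?X. ?P t}" and W: "W \<subseteq> ?X" for W
    proof -
      obtain K where K: "open K" "{t \<in> ?X. ?P t} = ?X \<inter> K" using op unfolding openin_open by (elim exE conjE)
      have "{t \<in> W. ?P t} = W \<inter> K" using K(2) W by blast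
      then show ?thesis using K(1) by (simp only: openin_open_Int)
    qed
    have closed_part: "closed {t \<in> W. \<not> ?P t}" if op: "openin (top_of_set W) {t \<in> W. ?P t}" and W: "closed W" for W
    proof -
      obtain K where K: "open K" "{t \<in> W. ?P t} = W \<inter> K" using op unfolding openin_open by (elim exE conjE)
      have "{t \<in> W. \<not> ?P t} = W \<inter> - K" using K(2) by blast
      then show ?thesis using K(1) W by (simp only: closed_Int closed_Compl)
    qed
    have sub: "?Y \<subseteq> ?X" "?Z \<subseteq> ?X" unfolding XYZ by simp_all
    show ?thesis unfolding eq
    proof (intro iffI conjI; (elim conjE)?)
      assume X: "openin (top_of_set ?X) {t \<in> ?X. ?P t}"
      show "openin (top_of_set ?Y) {t \<in> ?Y. ?P t}" by (rule restrict[OF X sub(1)])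
      show "openin (top_of_set ?Z) {t \<in> ?Z. ?P t}" by (rule restrict[OF X sub(2)])
    next
      assume Y: "openin (top_of_set ?Y) {t \<in> ?Y. ?P t}" and Z: "openin (top_of_set ?Z) {t \<in> ?Z. ?P t}"
      have "closed ({t \<in> ?Y. \<not> ?P t} \<union> {t \<in> ?Z. \<not> ?P t})"
        by (intro closed_Un closed_part Y Z) simp_all
      moreover have "{t \<in> ?X. ?P t} = ?X \<inter> - ({t \<in> ?Y. \<not> ?P t} \<union> {t \<in> ?Z. \<not> ?P t})" using XYZ by blast
      ultimately show "openin (top_of_set ?X) {t \<in> ?X. ?P t}" by (simp only: openin_open_Int open_Compl)
    qed
  qed
  have "(\<forall>A\<in>edges subdivision. openin (top_of_set {0..len subdivision A}) {t \<in> {0..len subdivision A}. chart subdivision A t \<in> U})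
      \<longleftrightarrow> (\<forall>i\<in>halves. openin (top_of_set {lo i..hi i}) {t \<in> {lo i..hi i}. \<phi> (ch (fst i) t) \<in> U})"
    using half_iff by (simp add: subdivision_simps(2))
  also have "\<dots> \<longleftrightarrow> (\<forall>e\<in>E. openin (top_of_set {0..L e}) {t \<in> {0..L e}. ch e t \<in> {x \<in> points \<Gamma>. \<phi> x \<in> U}})"
    using edge_iff by (auto simp: halves_def lo_def hi_def all_bool_eq split: if_splits)
  finally show ?thesis unfolding openin_curve_topology subdivision_points by blast
qed

lemma path_half:
  assumes i: "i \<in> halves" and p: "path_length subdivision a (\<phi> (ch (fst i) s)) d"
    and s: "s \<in> {lo i..hi i}" and t: "t \<in> {lo i..hi i}"
  shows "path_length subdivision a (\<phi> (ch (fst i) t)) (d + \<bar>s - t\<bar>)"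
proof -
  obtain c where c: "lo i = ereal c" using half_bounds[OF i] by (cases "lo i") auto
  have s': "s - lo i \<in> {0..len subdivision (half i)}" "chart subdivision (half i) (s - lo i) = \<phi> (ch (fst i) s)"
    and t': "t - lo i \<in> {0..len subdivision (half i)}" "chart subdivision (half i) (t - lo i) = \<phi> (ch (fst i) t)"
    using shift(1,4)[OF i] s t by (simp_all add: subdivision_simps i)
  have "path_length subdivision a (chart subdivision (half i) (t - lo i)) (d + \<bar>(s - lo i) - (t - lo i)\<bar>)"
    using p s' t' i by (intro path_length.segment) (simp_all add: subdivision_simps)
  moreover have "\<bar>(s - lo i) - (t - lo i)\<bar> = \<bar>s - t\<bar>" unfolding c by (cases s; cases t) auto
  ultimately show ?thesis using t'(2) by simp
qed

text \<open>
  A segment that crosses the midpoint is cut there into two.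
\<close>
lemma path_to_subdivision:
  "path_length \<Gamma> x y d \<Longrightarrow> path_length subdivision (\<phi> x) (\<phi> y) d"
proof (induction rule: path_length.induct)
  case (const x)
  then show ?case by (intro path_length.const) (simp add: subdivision_points)
next
  case (segment x e s d t)
  let ?m = "ereal (mid e)"
  have h: "(e, b) \<in> halves" for b using segment by (simp add: halves_def)
  have F: "path_length subdivision a (\<phi> (ch e v)) (d' + \<bar>u - v\<bar>)"
    if "path_length subdivision a (\<phi> (ch e u)) d'" "u \<in> {0..?m}" "v \<in> {0..?m}" for a u v d'
    using path_half[OF h[of False], of a u d' v] that by (simp add: lo_def hi_def)
  have T: "path_length subdivision a (\<phi> (ch e v)) (d' + \<bar>u - v\<bar>)"
    if "path_length subdivision a (\<phi> (ch e u)) d'" "u \<in> {?m..L e}" "v \<in> {?m..L e}" for a u v d'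
    using path_half[OF h[of True], of a u d' v] that by (simp add: lo_def hi_def)
  have m: "0 \<le> ?m" "?m \<le> L e" using mid_bounds[OF segment(2)] by (simp_all add: less_imp_le)
  consider "s \<le> ?m" "t \<le> ?m" | "?m \<le> s" "?m \<le> t" | "s \<le> ?m" "?m \<le> t" | "?m \<le> s" "t \<le> ?m" using linear by blast
  then show ?case
  proof cases
    case 1 then show ?thesis using F[OF segment.IH] segment by simp
  next
    case 2 then show ?thesis using T[OF segment.IH] segment by simp
  next
    case 3
    have "path_length subdivision (\<phi> x) (\<phi> (ch e ?m)) (d + \<bar>s - ?m\<bar>)" using F[OF segment.IH] segment 3 m by simp
    from T[OF this, of t] have "path_length subdivision (\<phi> x) (\<phi> (ch e t)) (d + \<bar>s - ?m\<bar> + \<bar>?m - t\<bar>)" using segment 3 m by simp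
    moreover have "\<bar>s - ?m\<bar> + \<bar>?m - t\<bar> = \<bar>s - t\<bar>" using 3 segment(3) by (cases s; cases t) auto
    ultimately show ?thesis by (simp add: add.assoc)
  next
    case 4
    have "path_length subdivision (\<phi> x) (\<phi> (ch e ?m)) (d + \<bar>s - ?m\<bar>)" using T[OF segment.IH] segment 4 m by simp
    from F[OF this, of t] have "path_length subdivision (\<phi> x) (\<phi> (ch e t)) (d + \<bar>s - ?m\<bar> + \<bar>?m - t\<bar>)" using segment 4 m by simp
    moreover have "\<bar>s - ?m\<bar> + \<bar>?m - t\<bar> = \<bar>s - t\<bar>" using 4 segment(4) by (cases s; cases t) auto
    ultimately show ?thesis by (simp add: add.assoc)
  qed
qed

lemma path_from_subdivision:
  "path_length subdivision a b d \<Longrightarrow> \<exists>x y. x \<in> points \<Gamma> \<and> y \<in> points \<Gamma> \<and> a = \<phi> x \<and> b = \<phi> y \<and> path_length \<Gamma> x y d"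
proof (induction rule: path_length.induct)
  case (const a)
  then obtain x where "x \<in> points \<Gamma>" "a = \<phi> x" by (auto simp: subdivision_points)
  then show ?case using path_length.const[of x \<Gamma>] by blast
next
  case (segment a A s d t)
  then obtain i where i: "i \<in> halves" "A = half i" by (auto simp: subdivision_simps(2))
  note e = half_bounds(1)[OF i(1)]
  obtain c where c: "lo i = ereal c" using half_bounds[OF i(1)] by (cases "lo i") auto
  have s: "lo i + s \<in> {lo i..hi i}" and t: "lo i + t \<in> {lo i..hi i}"
    using segment(3,4) i shift(1)[OF i(1)] by (simp_all add: subdivision_simps)
  have cs: "chart subdivision A s = \<phi> (ch (fst i) (lo i + s))" and ct: "chart subdivision A t = \<phi> (ch (fst i) (lo i + t))"
    using i by (simp_all add: subdivision_simps)
  from segment.IH obtain x y where xy: "x \<in> points \<Gamma>" "y \<in> points \<Gamma>" "a = \<phi> x" "chart subdivision A s = \<phi> y" "path_length \<Gamma> x y d"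
    by blast
  have "y = ch (fst i) (lo i + s)"
    using xy(2,4) cs chart_in_points[OF e half_closed[OF i(1) s]] inj by (auto dest: inj_onD)
  then have "path_length \<Gamma> x (ch (fst i) (lo i + t)) (d + \<bar>(lo i + s) - (lo i + t)\<bar>)"
    using xy(5) half_closed[OF i(1) s] half_closed[OF i(1) t] e by (intro path_length.segment) simp_all
  moreover have "\<bar>(lo i + s) - (lo i + t)\<bar> = \<bar>s - t\<bar>" unfolding c by (cases s; cases t) auto
  moreover have "ch (fst i) (lo i + t) \<in> points \<Gamma>" by (rule chart_in_points[OF e half_closed[OF i(1) t]])
  ultimately show ?case using xy(1,3) ct by auto
qed

lemma subdivision_cdist:
  assumes x: "x \<in> points \<Gamma>" and y: "y \<in> points \<Gamma>"
  shows "cdist subdivision (\<phi> x) (\<phi> y) = cdist \<Gamma> x y"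
proof -
  have "path_length subdivision (\<phi> x) (\<phi> y) d \<longleftrightarrow> path_length \<Gamma> x y d" for d
  proof
    assume "path_length subdivision (\<phi> x) (\<phi> y) d"
    from path_from_subdivision[OF this] show "path_length \<Gamma> x y d"
      using inj x y by (auto dest: inj_onD)
  qed (rule path_to_subdivision)
  then show ?thesis by (simp add: cdist_def)
qed

end

section \<open>Isometries have degree one\<close>

context curve begin

lemma identity_pair: "scaled_pair \<Gamma> \<Gamma> 1 id id"
proof unfold_locales
  fix f assume f: "rat f"
  have "(\<lambda>x\<in>points \<Gamma>. ereal 1 * f (id x)) = f"
    using extensional_restrict[OF rat_extensional[OF f]] by (simp add: one_ereal_def[symmetric])
  then show "rat (\<lambda>x\<in>points \<Gamma>. ereal 1 * f (id x))" "rat (\<lambda>x\<in>points \<Gamma>. ereal (1 / 1) * f (id x))"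
    using f by simp_all
qed simp_all

lemma edge_subset_points: "e \<in> E \<Longrightarrow> e \<subseteq> points \<Gamma>"
  by (auto simp: points_def)

lemma ends_subset_edge: "e \<in> E \<Longrightarrow> ends \<Gamma> e \<subseteq> e"
  using chart_in_edge[of e 0] chart_in_edge[of e "L e"] len_pos[of e] by (simp add: ends_eq less_imp_le)

end

locale isometry = scaled_pair \<Gamma>\<^sub>1 \<Gamma>\<^sub>2 1 \<phi> \<theta> for \<Gamma>\<^sub>1 :: "'a curve" and \<Gamma>\<^sub>2 :: "'b curve" and \<phi> \<theta>
begin

lemma phi_inj: "inj_on \<phi> (points \<Gamma>\<^sub>1)"
  using bij_points by (simp add: bij_betw_def)

lemma subdivision_model: "model_for \<Gamma>\<^sub>2 (curve_embedding.subdivision \<Gamma>\<^sub>1 \<phi>)"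
proof -
  interpret S: curve_embedding \<Gamma>\<^sub>1 \<phi> by unfold_locales (rule phi_inj)
  interpret I: scaled_pair \<Gamma>\<^sub>2 \<Gamma>\<^sub>1 "1 / 1" \<theta> \<phi> by (rule inverse_pair)
  have im: "\<phi> ` points \<Gamma>\<^sub>1 = points \<Gamma>\<^sub>2" using bij_points by (simp add: bij_betw_def)
  have "openin (curve_topology S.subdivision) U \<longleftrightarrow> openin B.top_curve U" for U
    unfolding S.openin_subdivision im
  proof
    assume *: "U \<subseteq> points \<Gamma>\<^sub>2 \<and> openin A.top_curve {x \<in> points \<Gamma>\<^sub>1. \<phi> x \<in> U}"
    then have "openin B.top_curve {y \<in> topspace B.top_curve. \<theta> y \<in> {x \<in> points \<Gamma>\<^sub>1. \<phi> x \<in> U}}"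
      by (intro openin_continuous_map_preimage[OF I.phi_continuous]) simp
    moreover have "{y \<in> topspace B.top_curve. \<theta> y \<in> {x \<in> points \<Gamma>\<^sub>1. \<phi> x \<in> U}} = U"
      using * theta_mem phi_theta by (auto simp: B.topspace_curve)
    ultimately show "openin B.top_curve U" by simp
  next
    assume U: "openin B.top_curve U"
    have "openin A.top_curve {x \<in> topspace A.top_curve. \<phi> x \<in> U}"
      by (rule openin_continuous_map_preimage[OF phi_continuous U])
    then show "U \<subseteq> points \<Gamma>\<^sub>2 \<and> openin A.top_curve {x \<in> points \<Gamma>\<^sub>1. \<phi> x \<in> U}"
      using openin_subset[OF U] by (simp add: A.topspace_curve B.topspace_curve)
  qed
  then have "curve_topology S.subdivision = B.top_curve" by (simp add: topology_eq)
  moreover have "inf_points S.subdivision = inf_points \<Gamma>\<^sub>2"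
  proof -
    have "\<phi> ` inf_points \<Gamma>\<^sub>1 = inf_points \<Gamma>\<^sub>2"
    proof (intro equalityI subsetI)
      fix y assume "y \<in> \<phi> ` inf_points \<Gamma>\<^sub>1"
      then show "y \<in> inf_points \<Gamma>\<^sub>2" using phi_infinite by blast
    next
      fix y assume y: "y \<in> inf_points \<Gamma>\<^sub>2"
      then have "\<phi> (\<theta> y) = y" using B.inf_subset by (intro phi_theta) blast
      moreover have "\<theta> y \<in> inf_points \<Gamma>\<^sub>1" by (rule I.phi_infinite[OF y])
      ultimately show "y \<in> \<phi> ` inf_points \<Gamma>\<^sub>1" by (metis imageI)
    qed
    then show ?thesis by (simp add: S.subdivision_inf_points)
  qed
  moreover have "cdist S.subdivision x y = cdist \<Gamma>\<^sub>2 x y" if x: "x \<in> points \<Gamma>\<^sub>2" and y: "y \<in> points \<Gamma>\<^sub>2" for x y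
    using S.subdivision_cdist[OF theta_mem[OF x] theta_mem[OF y]] cdist_phi[OF theta_mem[OF x] theta_mem[OF y]]
    by (simp add: phi_theta[OF x] phi_theta[OF y] one_ereal_def[symmetric])
  ultimately show ?thesis using S.subdivision_curve by (simp add: model_for_def)
qed

definition source :: "'a curve" where
  "source = curve_embedding.subdivision \<Gamma>\<^sub>1 id"

definition target :: "'b curve" where
  "target = curve_embedding.subdivision \<Gamma>\<^sub>1 \<phi>"

lemma source_model: "model_for \<Gamma>\<^sub>1 source" "loopless source"
  and target_model: "model_for \<Gamma>\<^sub>2 target" "loopless target"
  and target_image: "verts target = \<phi> ` verts source" "edges target = image \<phi> ` edges source"
proof -
  interpret J: isometry \<Gamma>\<^sub>1 \<Gamma>\<^sub>1 id id unfolding isometry_def by (rule A.identity_pair)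
  interpret R: curve_embedding \<Gamma>\<^sub>1 id by unfold_locales simp
  interpret S: curve_embedding \<Gamma>\<^sub>1 \<phi> by unfold_locales (rule phi_inj)
  show "model_for \<Gamma>\<^sub>1 source" unfolding source_def by (rule J.subdivision_model)
  show "model_for \<Gamma>\<^sub>2 target" unfolding target_def by (rule subdivision_model)
  show "loopless source" unfolding source_def by (rule R.subdivision_loopless)
  show "loopless target" unfolding target_def by (rule S.subdivision_loopless)
  show "verts target = \<phi> ` verts source"
    unfolding source_def target_def by (simp add: R.subdivision_simps S.subdivision_simps R.subverts_def S.subverts_def R.mid_def S.mid_def)
  have "S.half i = \<phi> ` R.half i" for i
    by (simp add: S.half_def R.half_def S.lo_def R.lo_def S.hi_def R.hi_def R.mid_def S.mid_def image_image)
  then show "edges target = image \<phi> ` edges source"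
    unfolding source_def target_def by (simp add: R.subdivision_simps S.subdivision_simps S.halves_def R.halves_def image_image)
qed

lemma curve_source: "curve source"
  using source_model by (simp add: curve_def model_for_def)

lemma points_source: "points source = points \<Gamma>\<^sub>1"
proof -
  interpret G: curve source by (rule curve_source)
  show ?thesis using source_model(1) G.topspace_curve A.topspace_curve by (simp add: model_for_def)
qed

text \<open>
  As \<open>\<phi>\<close> is injective on points, it is injective on edges, and the edge over \<open>e'\<close> contains \<open>v\<close>.
\<close>
lemma local_degree_one:
  assumes v: "v \<in> verts source" and e': "e' \<in> edges target" and ve: "\<phi> v \<in> e'"
  shows "local_degree source \<phi> (\<lambda>_. 1) v e' = 1"
proof -
  interpret G: curve source by (rule curve_source)
  obtain e where e: "e \<in> edges source" "e' = \<phi> ` e" using e' target_image by blast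
  have sub: "a \<subseteq> points \<Gamma>\<^sub>1" if "a \<in> edges source" for a using G.edge_subset_points[OF that] points_source by simp
  have vp: "v \<in> points \<Gamma>\<^sub>1" using v G.V_subset points_source by blast
  have "{a \<in> edges source. \<phi> ` a = e' \<and> v \<in> a} = {e}"
  proof (intro equalityI subsetI)
    fix a assume "a \<in> {a \<in> edges source. \<phi> ` a = e' \<and> v \<in> a}"
    then show "a \<in> {e}" using inj_on_image_eq_iff[OF phi_inj, of a e] sub e by simp
  next
    fix a assume "a \<in> {e}"
    moreover have "v \<in> e" using ve inj_on_image_mem_iff[OF phi_inj vp sub[OF e(1)]] e(2) by simp
    ultimately show "a \<in> {a \<in> edges source. \<phi> ` a = e' \<and> v \<in> a}" using e by simp
  qed
  then show ?thesis by (simp add: local_degree_def)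
qed

lemma harmonic: "harmonic_on_models \<Gamma>\<^sub>1 \<Gamma>\<^sub>2 source target \<phi> (\<lambda>_. 1)"
  unfolding harmonic_on_models_def
proof (intro conjI ballI impI source_model target_model)
  interpret G: curve source by (rule curve_source)
  show "\<phi> ` verts source \<subseteq> verts target" by (simp add: target_image)
  fix e assume e: "e \<in> edges source"
  show "\<phi> ` e \<in> edges target" using e by (simp add: target_image)
  show "(0::nat) < 1" by simp
  fix x y assume "x \<in> e" "y \<in> e"
  then have "x \<in> points \<Gamma>\<^sub>1" "y \<in> points \<Gamma>\<^sub>1" using G.edge_subset_points[OF e] points_source by auto
  then show "cdist \<Gamma>\<^sub>2 (\<phi> x) (\<phi> y) = ereal (of_nat 1) * cdist \<Gamma>\<^sub>1 x y" using cdist_phi by simp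
next
  fix v e' e'' assume "v \<in> verts source" "e' \<in> edges target" "e'' \<in> edges target" "\<phi> v \<in> e'" "\<phi> v \<in> e''"
  then show "local_degree source \<phi> (\<lambda>_. 1) v e' = local_degree source \<phi> (\<lambda>_. 1) v e''"
    by (simp only: local_degree_one)
qed

lemma finite_harmonic: "finite_harmonic_morphism \<Gamma>\<^sub>1 \<Gamma>\<^sub>2 \<phi>"
  unfolding finite_harmonic_morphism_def using phi_continuous harmonic by blast

lemma degree_one: "has_degree \<Gamma>\<^sub>1 \<Gamma>\<^sub>2 \<phi> 1"
proof (cases "is_singleton (points \<Gamma>\<^sub>1) \<and> is_singleton (points \<Gamma>\<^sub>2)")
  case True
  then show ?thesis by (simp add: has_degree_def)
next
  case False
  interpret G: curve source by (rule curve_source)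
  have "\<not> is_singleton (points source)"
    using False bij_betw_same_card[OF bij_points] by (simp add: points_source is_singleton_altdef)
  have vd: "vertex_degree source target \<phi> (\<lambda>_. 1) v = 1" if v: "v \<in> verts source" for v
  proof -
    obtain e where e: "e \<in> edges source" "v \<in> ends source e"
      by (rule G.vertex_in_edge[OF v \<open>\<not> is_singleton (points source)\<close>])
    then have "\<phi> v \<in> \<phi> ` e" using G.ends_subset_edge[OF e(1)] by blast
    moreover have "\<phi> ` e \<in> edges target" using e by (simp add: target_image)
    ultimately show ?thesis
      unfolding vertex_degree_def using local_degree_one[OF v] by (intro the_equality) auto
  qed
  have "(\<Sum>v\<in>{v \<in> verts source. \<phi> v = v'}. vertex_degree source target \<phi> (\<lambda>_. 1) v) = 1" if v': "v' \<in> verts target" for v'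
  proof -
    obtain w where w: "w \<in> verts source" "v' = \<phi> w" using v' target_image by blast
    have "{v \<in> verts source. \<phi> v = v'} = {w}"
      using w G.V_subset points_source phi_inj by (auto dest: inj_onD)
    then show ?thesis using vd[OF w(1)] by simp
  qed
  with harmonic show ?thesis unfolding has_degree_def if_not_P[OF False]
    by (intro exI[of _ source] exI[of _ target] exI[of _ "\<lambda>_. 1"] conjI ballI)
qed

end

section \<open>Isomorphic rational function semifields\<close>

theorem theorem1p1:
  fixes \<Gamma>\<^sub>1 :: "'a curve" and \<Gamma>\<^sub>2 :: "'b curve"
    and \<psi> :: "('a \<Rightarrow> ereal) \<Rightarrow> ('b \<Rightarrow> ereal)"
  assumes "tropical_curve \<Gamma>\<^sub>1" and "tropical_curve \<Gamma>\<^sub>2"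
    and "\<psi> \<in> semiring_iso (Rat_semifield \<Gamma>\<^sub>1) (Rat_semifield \<Gamma>\<^sub>2)"
  shows "\<exists>r::real. 0 < r \<and> \<psi> (const_fun \<Gamma>\<^sub>1 1) = const_fun \<Gamma>\<^sub>2 (ereal r) \<and>
    (\<exists>\<phi>. induces \<Gamma>\<^sub>1 \<Gamma>\<^sub>2 \<psi> r \<phi> \<and> expansive_map r \<Gamma>\<^sub>1 \<Gamma>\<^sub>2 \<phi> \<and>
      (\<psi> \<in> T_algebra_iso \<Gamma>\<^sub>1 \<Gamma>\<^sub>2 \<longrightarrow>
        r = 1 \<and> finite_harmonic_morphism \<Gamma>\<^sub>1 \<Gamma>\<^sub>2 \<phi> \<and> has_degree \<Gamma>\<^sub>1 \<Gamma>\<^sub>2 \<phi> 1))"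
proof -
  interpret P: rat_iso \<Gamma>\<^sub>1 \<Gamma>\<^sub>2 \<psi>
    using assms by (intro semiring_iso_imp_rat_iso) (simp_all add: curve_def)
  obtain \<phi> \<theta> where \<phi>: "\<forall>x\<in>points \<Gamma>\<^sub>1. \<phi> x \<in> points \<Gamma>\<^sub>2 \<and> \<theta> (\<phi> x) = x"
    and \<theta>: "\<forall>y\<in>points \<Gamma>\<^sub>2. \<theta> y \<in> points \<Gamma>\<^sub>1 \<and> \<phi> (\<theta> y) = y"
    and eval: "\<forall>f. P.A.rat f \<longrightarrow> (\<forall>y\<in>points \<Gamma>\<^sub>2. \<psi> f y = ereal P.scale * f (\<theta> y))"
    using P.psi_substitution by (elim exE conjE)
  interpret Q: induced_pair \<Gamma>\<^sub>1 \<Gamma>\<^sub>2 P.scale \<phi> \<theta> \<psi>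
  proof unfold_locales
    show "0 < P.scale" by (rule P.scale_pos)
    show "\<phi> x \<in> points \<Gamma>\<^sub>2" if "x \<in> points \<Gamma>\<^sub>1" for x using \<phi> that by simp
    show "\<theta> y \<in> points \<Gamma>\<^sub>1" if "y \<in> points \<Gamma>\<^sub>2" for y using \<theta> that by simp
    show "\<theta> (\<phi> x) = x" if "x \<in> points \<Gamma>\<^sub>1" for x using \<phi> that by simp
    show "\<phi> (\<theta> y) = y" if "y \<in> points \<Gamma>\<^sub>2" for y using \<theta> that by simp
    show "P.B.rat (\<lambda>y\<in>points \<Gamma>\<^sub>2. ereal P.scale * f (\<theta> y))" if f: "P.A.rat f" for f
    proof -
      have "(\<lambda>y\<in>points \<Gamma>\<^sub>2. ereal P.scale * f (\<theta> y)) = restrict (\<psi> f) (points \<Gamma>\<^sub>2)"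
        by (rule restrict_ext) (use eval f in simp)
      then show ?thesis using extensional_restrict[OF P.B.rat_extensional[OF P.psi_rat[OF f]]] P.psi_rat[OF f] by simp
    qed
    show "P.A.rat (\<lambda>x\<in>points \<Gamma>\<^sub>1. ereal (1 / P.scale) * g (\<phi> x))" if g: "P.B.rat g" for g
    proof -
      obtain f where f: "P.A.rat f" "\<psi> f = g" using g by (rule P.psi_surj)
      have "ereal (1 / P.scale) * g (\<phi> x) = f x" if x: "x \<in> points \<Gamma>\<^sub>1" for x
      proof -
        have "g (\<phi> x) = ereal P.scale * f x"
          using eval[rule_format, OF f(1), of "\<phi> x"] \<phi> x f(2) by simp
        then show ?thesis using P.scale_pos by (cases "f x") auto
      qed
      then have "(\<lambda>x\<in>points \<Gamma>\<^sub>1. ereal (1 / P.scale) * g (\<phi> x)) = restrict f (points \<Gamma>\<^sub>1)"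
        by (intro restrict_ext)
      then show ?thesis using extensional_restrict[OF P.A.rat_extensional[OF f(1)]] f(1) by simp
    qed
    show "\<psi> f y = ereal P.scale * f (\<theta> y)" if "P.A.rat f" "y \<in> points \<Gamma>\<^sub>2" for f y using eval that by simp
    show "\<psi> f \<in> extensional (points \<Gamma>\<^sub>2)" if "P.A.rat f" for f
      by (rule P.B.rat_extensional[OF P.psi_rat[OF that]])
  qed
  have one: "\<psi> (const_fun \<Gamma>\<^sub>1 1) = const_fun \<Gamma>\<^sub>2 (ereal P.scale)"
    using P.psi_const_scale[of 1] by (simp add: one_ereal_def)
  have T_part: "P.scale = 1 \<and> finite_harmonic_morphism \<Gamma>\<^sub>1 \<Gamma>\<^sub>2 \<phi> \<and> has_degree \<Gamma>\<^sub>1 \<Gamma>\<^sub>2 \<phi> 1"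
    if T: "\<psi> \<in> T_algebra_iso \<Gamma>\<^sub>1 \<Gamma>\<^sub>2"
  proof -
    have "\<psi> (const_fun \<Gamma>\<^sub>1 1) = const_fun \<Gamma>\<^sub>2 1" using T by (simp add: T_algebra_iso_def)
    then have "const_fun \<Gamma>\<^sub>2 (ereal P.scale) = const_fun \<Gamma>\<^sub>2 (ereal 1)" using one by (simp add: one_ereal_def)
    then have s: "P.scale = 1" by (auto dest: P.const_fun_inj)
    interpret R: isometry \<Gamma>\<^sub>1 \<Gamma>\<^sub>2 \<phi> \<theta>
      unfolding isometry_def s[symmetric] by (rule Q.scaled_pair_axioms)
    show ?thesis using s R.finite_harmonic R.degree_one by simp
  qed
  have "induces \<Gamma>\<^sub>1 \<Gamma>\<^sub>2 \<psi> P.scale \<phi> \<and> expansive_map P.scale \<Gamma>\<^sub>1 \<Gamma>\<^sub>2 \<phi> \<and>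
      (\<psi> \<in> T_algebra_iso \<Gamma>\<^sub>1 \<Gamma>\<^sub>2 \<longrightarrow>
        P.scale = 1 \<and> finite_harmonic_morphism \<Gamma>\<^sub>1 \<Gamma>\<^sub>2 \<phi> \<and> has_degree \<Gamma>\<^sub>1 \<Gamma>\<^sub>2 \<phi> 1)"
    by (rule conjI[OF Q.induces_phi conjI[OF Q.expansive impI]]) (rule T_part)
  then show ?thesis
    by (intro exI[of _ P.scale] conjI P.scale_pos one) (rule exI[of _ \<phi>])
qed

end
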